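(* In the exponential model, suppose that $\underline{\alpha}+\underline{\beta}>0$, and define $$c_1=\frac{\mathrm E[(b+\underline{\alpha})^{-2}]}{\mathrm E[(a-\underline{\alpha})^{-2}]},\qquad c_2=\frac{\mathrm E[(b-\underline{\beta})^{-2}]}{\mathrm E[(a+\underline{\beta})^{-2}]},$$ so that $0\le c_1<c_2\le\infty$. Then the shape function $g$ on $(0,\infty)^2$ satisfies the following. (a) $g(s,t)=s\,\mathrm E[(a-\underline{\alpha})^{-1}]+t\,\mathrm E[(b+\underline{\alpha})^{-1}]$ for $s,t>0$ with $s/t\le c_1$. (b) $g(s,t)=s\,\mathrm E[(a+\underline{\beta})^{-1}]+t\,\mathrm E[(b-\underline{\beta})^{-1}]$ for $s,t>0$ with $s/t\ge c_2$. (c) $g(cs_1+(1-c)s_2,\,ct_1+(1-c)t_2)>c\,g(s_1,t_1)+(1-c)\,g(s_2,t_2)$ for all $c\in(0,1)$ and $s_1,s_2,t_1,t_2>0$ such that $c_1<s_1/t_1<c_2$, $c_1<s_2/t_2<c_2$ and $(s_1,t_1)\ne k(s_2,t_2)$ for any $k\in\mathbb R$. (d) $g$ is continuously differentiable.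
   Context: Let $\mathbb N=\{1,2,\dots\}$. Conventions: $1/0=\infty$ and $1/\infty=0$ (so $c_1=0$ if $\mathrm E[(a-\underline\alpha)^{-2}]=\infty$, and $c_2=\infty$ if $\mathrm E[(b-\underline\beta)^{-2}]=\infty$). Exponential model: Let $\mathbf a=(a_n)_{n\in\mathbb N}$ and $\mathbf b=(b_n)_{n\in\mathbb N}$ be stationary random sequences with terms in $(0,\infty)$, with joint distribution $\mu$. Let $\tau_k$ denote the shift $(c_n)_{n\in\mathbb N}\mapsto(c_{n+k})_{n\in\mathbb N}$. It is assumed that $\mu$ is totally ergodic: for each $k,l\in\mathbb N$ separately, $\mu$ is (stationary and) ergodic under $\tau_k\times\tau_l$, which acts by $(\mathbf a,\mathbf b)\mapsto(\tau_k\mathbf a,\tau_l\mathbf b)$. Given $(\mathbf a,\mathbf b)$, the weights $\{W(i,j):i,j\in\mathbb N\}$ are independent under the conditional law $\mathbf P_{\mathbf a,\mathbf b}$ with $\mathbf P_{\mathbf a,\mathbf b}(W(i,j)\ge x)=e^{-(a_i+b_j)x}$ for $x\ge0$. Let $\mathbb P(\cdot)=\int\mathbf P_{\mathbf a,\mathbf b}(\cdot)\,\mu(d\mathbf a,d\mathbf b)$ be the unconditional law of the weights. Last-passage times: $G(m,n)=\max_\pi\sum_{(i,j)\in\pi}W(i,j)$, the maximum being over all directed paths $\pi$ from $(1,1)$ to $(m,n)$ in $\mathbb Z^2$ (finite sequences of sites with steps in $\{(1,0),(0,1)\}$). Shape function: $g:(0,\infty)^2\to[0,\infty]$ is the deterministic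 function such that, $\mathbb P$-a.s., $\lim_{n\to\infty}n^{-1}G(\lfloor ns\rfloor,\lfloor nt\rfloor)=g(s,t)$ for all $s,t>0$ (such a function exists). Notation: $\alpha$ and $\beta$ are the distributions of $a=a_1$ and $b=b_1$; $\underline{\alpha}$ and $\underline{\beta}$ are the left endpoints of their supports (the essential infima of $a_1$ and $b_1$); $\mathrm E$ is expectation under $\mu$. *)

theory Defs
  imports "HOL-Probability.Probability"
begin

section \<open>The environment\<close>

text \<open>
  The index set \<open>\<nat> = {1, 2, \<dots>}\<close> is rendered as \<open>{1..} :: nat set\<close>; sequences are elements of
  a product measure space over this index set, i.e. functions that are \<open>undefined\<close> at \<open>0\<close>.
\<close>

definition pos_seq_space :: "(nat \<Rightarrow> real) measure" where
  "pos_seq_space = PiM {1..} (\<lambda>_. restrict_space borel {0<..})"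

definition shift :: "nat \<Rightarrow> (nat \<Rightarrow> real) \<Rightarrow> (nat \<Rightarrow> real)" where
  "shift k c = (\<lambda>n\<in>{1..}. c (n + k))"

definition stationary_under :: "'a measure \<Rightarrow> ('a \<Rightarrow> 'a) \<Rightarrow> bool" where
  "stationary_under M T \<longleftrightarrow> T \<in> measurable M M \<and> distr M M T = M"

definition ergodic_under :: "'a measure \<Rightarrow> ('a \<Rightarrow> 'a) \<Rightarrow> bool" where
  "ergodic_under M T \<longleftrightarrow> stationary_under M T \<and>
     (\<forall>A\<in>sets M. T -` A \<inter> space M = A \<longrightarrow> emeasure M A = 0 \<or> emeasure M A = 1)"

definition totally_ergodic :: "((nat \<Rightarrow> real) \<times> (nat \<Rightarrow> real)) measure \<Rightarrow> bool" where
  "totally_ergodic \<mu> \<longleftrightarrow> (\<forall>k\<ge>1. \<forall>l\<ge>1. ergodic_under \<mu> (map_prod (shift k) (shift l)))"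

definition exponential_model :: "((nat \<Rightarrow> real) \<times> (nat \<Rightarrow> real)) measure \<Rightarrow> bool" where
  "exponential_model \<mu> \<longleftrightarrow> prob_space \<mu> \<and>
     sets \<mu> = sets (pos_seq_space \<Otimes>\<^sub>M pos_seq_space) \<and> totally_ergodic \<mu>"


section \<open>The weights\<close>

definition conditional_weight_law ::
    "(nat \<Rightarrow> real) \<times> (nat \<Rightarrow> real) \<Rightarrow> (nat \<times> nat \<Rightarrow> real) measure" where
  "conditional_weight_law = (\<lambda>(a, b). PiM ({1..} \<times> {1..})
     (\<lambda>(i, j). density lborel (exponential_density (a i + b j))))"

definition weight_law ::
    "((nat \<Rightarrow> real) \<times> (nat \<Rightarrow> real)) measure \<Rightarrow> (nat \<times> nat \<Rightarrow> real) measure" where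
  "weight_law \<mu> = \<mu> \<bind> conditional_weight_law"

text \<open>
  The Giry bind is only meaningful for measurable kernels, so we record that
  \<^const>\<open>conditional_weight_law\<close> is one.
\<close>

lemma conditional_weight_law_measurable:
  "conditional_weight_law \<in>
     measurable (pos_seq_space \<Otimes>\<^sub>M pos_seq_space) (prob_algebra (PiM ({1..} \<times> {1..}) (\<lambda>_. borel)))"
proof -
  let ?I = "{1..} \<times> {1..} :: (nat \<times> nat) set"
  let ?S = "pos_seq_space \<Otimes>\<^sub>M pos_seq_space"
  define r :: "(nat \<Rightarrow> real) \<times> (nat \<Rightarrow> real) \<Rightarrow> nat \<times> nat \<Rightarrow> real"
    where "r = (\<lambda>ab k. if k \<in> ?I then fst ab (fst k) + snd ab (snd k) else 1)"
  let ?F = "\<lambda>ab k. density lborel (exponential_density (r ab k))"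
  have rpos: "r ab k > 0" if "ab \<in> space ?S" for ab k
    using that by (auto simp: r_def space_pair_measure pos_seq_space_def space_PiM PiE_iff space_restrict_space add_pos_pos)
  have law: "conditional_weight_law ab = PiM ?I (?F ab)" for ab
    unfolding conditional_weight_law_def by (auto simp: r_def case_prod_beta intro!: PiM_cong)
  have setsF: "sets (PiM ?I (?F ab)) = sets (PiM ?I (\<lambda>_. borel))" for ab
    by (intro sets_PiM_cong) auto
  have prod: "product_prob_space (?F ab)" if "ab \<in> space ?S" for ab
  proof -
    have "prob_space (?F ab k)" for k
      using rpos[OF that] by (rule prob_space_exponential_density)
    then show ?thesis
      by (simp add: product_prob_space_def product_prob_space_axioms_def product_sigma_finite_def
          prob_space_imp_sigma_finite)
  qed
  have coord: "(\<lambda>c. c i) \<in> borel_measurable pos_seq_space" if "i \<ge> 1" for i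
  proof -
    have 1: "(\<lambda>c. c i) \<in> measurable pos_seq_space (restrict_space borel {0<..})"
      unfolding pos_seq_space_def using that by (intro measurable_component_singleton) auto
    have 2: "(\<lambda>x::real. x) \<in> measurable (restrict_space borel {0<..}) borel"
      by (intro measurable_restrict_space1 measurable_ident_sets) simp
    show ?thesis by (rule measurable_compose[OF 1 2])
  qed
  have fst_meas: "(\<lambda>ab. fst ab i) \<in> borel_measurable ?S" if "i \<ge> 1" for i
    by (rule measurable_compose[OF measurable_fst coord[OF that]])
  have snd_meas: "(\<lambda>ab. snd ab i) \<in> borel_measurable ?S" if "i \<ge> 1" for i
    by (rule measurable_compose[OF measurable_snd coord[OF that]])
  have rmeas [measurable]: "(\<lambda>ab. r ab k) \<in> borel_measurable ?S" for k
    unfolding r_def using fst_meas[of "fst k"] snd_meas[of "snd k"] by (cases "k \<in> ?I") (auto simp: mem_Times_iff)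
  have em: "(\<lambda>ab. emeasure (?F ab k) A) \<in> borel_measurable ?S" if [measurable]: "A \<in> sets borel" for k A
  proof -
    have "(\<lambda>ab. \<integral>\<^sup>+x. ennreal (exponential_density (r ab k) x) * indicator A x \<partial>lborel) \<in> borel_measurable ?S"
      unfolding exponential_density_def by measurable
    then show ?thesis by (simp add: emeasure_density)
  qed
  show ?thesis
  proof (rule measurable_prob_algebra_generated[OF sets_PiM Int_stable_prod_algebra prod_algebra_sets_into_space])
    fix ab assume ab: "ab \<in> space ?S"
    interpret product_prob_space "?F ab" ?I by (rule prod[OF ab])
    show "prob_space (conditional_weight_law ab)" unfolding law by unfold_locales
    show "sets (conditional_weight_law ab) = sets (PiM ?I (\<lambda>_. borel))" unfolding law by (rule setsF)
  next
    fix A :: "(nat \<times> nat \<Rightarrow> real) set"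
    assume "A \<in> prod_algebra ?I (\<lambda>_. borel)"
    then obtain J X where JX: "finite J" "J \<subseteq> ?I" "\<And>j. j \<in> J \<Longrightarrow> X j \<in> sets borel"
      "A = prod_emb ?I (\<lambda>_. borel) J (Pi\<^sub>E J X)"
      by (rule prod_algebraE) auto
    have "emeasure (conditional_weight_law ab) A = (\<Prod>j\<in>J. emeasure (?F ab j) (X j))"
      if "ab \<in> space ?S" for ab
    proof -
      interpret product_prob_space "?F ab" ?I by (rule prod[OF that])
      have "A = prod_emb ?I (?F ab) J (Pi\<^sub>E J X)"
        using JX by (simp add: prod_emb_def)
      then show ?thesis
        unfolding law using JX by (simp only:) (rule emeasure_PiM_emb, auto)
    qed
    then have "(\<lambda>ab. emeasure (conditional_weight_law ab) A) \<in> borel_measurable ?S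
       \<longleftrightarrow> (\<lambda>ab. \<Prod>j\<in>J. emeasure (?F ab j) (X j)) \<in> borel_measurable ?S"
      by (intro measurable_cong) auto
    then show "(\<lambda>ab. emeasure (conditional_weight_law ab) A) \<in> borel_measurable ?S"
      using JX by (simp only:) (intro borel_measurable_prod_ennreal em, auto)
  qed
qed


section \<open>Last-passage times and the shape function\<close>

text \<open>Sites can be taken in \<open>nat \<times> nat\<close>, since directed paths from \<open>(1, 1)\<close> stay in \<open>{1..} \<times> {1..}\<close>.\<close>

definition directed_paths :: "nat \<times> nat \<Rightarrow> nat \<times> nat \<Rightarrow> (nat \<times> nat) list set" where
  "directed_paths u v = {p. p \<noteq> [] \<and> hd p = u \<and> last p = v \<and>
     successively (\<lambda>(i, j) y. y = (i + 1, j) \<or> y = (i, j + 1)) p}"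

definition last_passage_time :: "(nat \<times> nat \<Rightarrow> real) \<Rightarrow> nat \<Rightarrow> nat \<Rightarrow> real" where
  "last_passage_time w m n = Max ((\<lambda>p. \<Sum>x\<leftarrow>p. w x) ` directed_paths (1, 1) (m, n))"

text \<open>
  Only the values of \<open>g\<close> at positive arguments matter. For fixed \<open>s, t > 0\<close> the arguments of the
  last-passage time are at least \<open>1\<close> for all but finitely many \<open>n\<close>; the weights are nonnegative
  almost surely, so that \<^const>\<open>ennreal\<close> does not truncate.
\<close>

definition is_shape_function ::
    "((nat \<Rightarrow> real) \<times> (nat \<Rightarrow> real)) measure \<Rightarrow> (real \<Rightarrow> real \<Rightarrow> ennreal) \<Rightarrow> bool" where
  "is_shape_function \<mu> g \<longleftrightarrow> (AE w in weight_law \<mu>. \<forall>s>0. \<forall>t>0.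
     (\<lambda>n. ennreal (last_passage_time w (nat \<lfloor>real n * s\<rfloor>) (nat \<lfloor>real n * t\<rfloor>) / real n))
       \<longlonglongrightarrow> g s t)"


section \<open>Marginals and the critical slopes\<close>

definition measure_support :: "'a::topological_space measure \<Rightarrow> 'a set" where
  "measure_support M = {x. \<forall>U. open U \<and> x \<in> U \<longrightarrow> 0 < emeasure M U}"

definition alpha_dist :: "((nat \<Rightarrow> real) \<times> (nat \<Rightarrow> real)) measure \<Rightarrow> real measure" where
  "alpha_dist \<mu> = distr \<mu> borel (\<lambda>(a, b). a 1)"

definition beta_dist :: "((nat \<Rightarrow> real) \<times> (nat \<Rightarrow> real)) measure \<Rightarrow> real measure" where
  "beta_dist \<mu> = distr \<mu> borel (\<lambda>(a, b). b 1)"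

definition alpha_inf :: "((nat \<Rightarrow> real) \<times> (nat \<Rightarrow> real)) measure \<Rightarrow> real" where
  "alpha_inf \<mu> = Inf (measure_support (alpha_dist \<mu>))"

definition beta_inf :: "((nat \<Rightarrow> real) \<times> (nat \<Rightarrow> real)) measure \<Rightarrow> real" where
  "beta_inf \<mu> = Inf (measure_support (beta_dist \<mu>))"

text \<open>
  \<open>E[(a\<^sub>1 + z)\<^sup>-\<^sup>k]\<close> and \<open>E[(b\<^sub>1 + z)\<^sup>-\<^sup>k]\<close>, valued in \<open>[0, \<infinity>]\<close>. The reciprocal is taken in
  \<^typ>\<open>ennreal\<close>, where \<open>1 / 0 = \<infinity>\<close> and \<open>1 / \<infinity> = 0\<close>; below, \<open>z\<close> is such that \<open>a\<^sub>1 + z\<close>, respectively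
  \<open>b\<^sub>1 + z\<close>, is nonnegative almost surely.
\<close>

definition a_moment :: "((nat \<Rightarrow> real) \<times> (nat \<Rightarrow> real)) measure \<Rightarrow> real \<Rightarrow> nat \<Rightarrow> ennreal" where
  "a_moment \<mu> z k = (\<integral>\<^sup>+ (a, b). 1 / ennreal (a 1 + z) ^ k \<partial>\<mu>)"

definition b_moment :: "((nat \<Rightarrow> real) \<times> (nat \<Rightarrow> real)) measure \<Rightarrow> real \<Rightarrow> nat \<Rightarrow> ennreal" where
  "b_moment \<mu> z k = (\<integral>\<^sup>+ (a, b). 1 / ennreal (b 1 + z) ^ k \<partial>\<mu>)"

definition c1 :: "((nat \<Rightarrow> real) \<times> (nat \<Rightarrow> real)) measure \<Rightarrow> ennreal" where
  "c1 \<mu> = b_moment \<mu> (alpha_inf \<mu>) 2 / a_moment \<mu> (- alpha_inf \<mu>) 2"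

definition c2 :: "((nat \<Rightarrow> real) \<times> (nat \<Rightarrow> real)) measure \<Rightarrow> ennreal" where
  "c2 \<mu> = b_moment \<mu> (- beta_inf \<mu>) 2 / a_moment \<mu> (beta_inf \<mu>) 2"

definition continuously_differentiable_on ::
    "('a::real_normed_vector \<Rightarrow> 'b::real_normed_vector) \<Rightarrow> 'a set \<Rightarrow> bool" where
  "continuously_differentiable_on f S \<longleftrightarrow> (\<exists>D :: 'a \<Rightarrow> 'a \<Rightarrow>\<^sub>L 'b.
     (\<forall>x\<in>S. (f has_derivative blinfun_apply (D x)) (at x)) \<and> continuous_on S D)"

end

theory Submission
  imports Defs
begin

text \<open>
  Realise the weights as \<open>W(i,j) = e(i,j) / (a\<^sub>i + b\<^sub>j)\<close> with independent unit exponential variables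
  \<open>e(i,j)\<close>. Write \<open>\<alpha>\<close> and \<open>\<beta>\<close> for the essential infima of \<open>a\<^sub>1\<close> and \<open>b\<^sub>1\<close>, and put
  \<open>A(z) = E[1 / (a\<^sub>1 + z)]\<close> and \<open>B(z) = E[1 / (b\<^sub>1 - z)]\<close>. The heart of the matter is the identity
  \<open>g(s,t) = min (s A(z) + t B(z))\<close>, where \<open>z\<close> ranges over \<open>(-\<alpha>, \<beta>)\<close> together with those end points at
  which the second moments of the reciprocals are finite.

  For \<open>z\<close> in \<open>(-\<alpha>, \<beta>)\<close> the model becomes stationary if a row \<open>j = 0\<close> with rates \<open>a\<^sub>i + z\<close> and a column
  \<open>i = 0\<close> with rates \<open>b\<^sub>j - z\<close> are added. Indeed, crossing one site replaces the increments of the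
  last-passage time along its south and west sides by those along its north and east sides, and this
  local map preserves the product of exponential laws (Burke property, \<open>distr_exchange\<close>). Sweeping
  over all sites shows that the increments along the far side of a rectangle have the laws of the
  boundary weights (\<open>distr_sweep\<close>), whence the mean and a bound for the second moment of the stationary
  last-passage time. Since the extra weights only help, \<open>g(s,t) \<le> s A(z) + t B(z)\<close>
  (\<open>g_le_stationary\<close>).

  For the converse, a maximal path of the stationary model follows an axis up to an exit point and
  then stays in the bulk. By stationarity of the environment and the ergodic theorem,
  \<open>s A(z) + t B(z)\<close> is at most the supremum of \<open>x A(z) + g(s - x, t)\<close> over \<open>x\<close> and of \<open>y B(z) + g(s, t - y)\<close>
  over \<open>y\<close>; this is proved up to a discretisation error in \<open>exit_inequality\<close>. If the derivative
  \<open>t E[(b\<^sub>1 - z)\<^sup>-\<^sup>2] - s E[(a\<^sub>1 + z)\<^sup>-\<^sup>2]\<close> of \<open>s A(z) + t B(z)\<close> vanishes at \<open>z\<close>, then the upper bound with parameters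
  slightly off \<open>z\<close> shows that an almost optimal exit point is close to the origin, so that equality
  holds at \<open>z\<close> (\<open>real_shape_critical\<close>). If the minimum sits at an end point, say \<open>-\<alpha>\<close>, a path can first climb the
  first column on the event of positive probability that \<open>a\<^sub>1\<close> is close to \<open>\<alpha>\<close>, and continue in a
  direction with an interior minimiser; this is just as good (\<open>column_detour\<close>, \<open>row_detour\<close>).

  All assertions are then statements about the minimisation (locale \<open>slope_optimiser\<close>). As \<open>A\<close> and \<open>B\<close> are
  strictly convex, the minimiser is unique and depends continuously on \<open>s / t\<close>. It is an end point
  exactly for \<open>s / t \<le> c\<^sub>1\<close> and \<open>s / t \<ge> c\<^sub>2\<close>, and it is injective in between, which yields the linear parts and the
  strict concavity. A minimum of linear functions with a continuous minimiser \<open>z\<close> is continuously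
  differentiable, with gradient \<open>(A(z), B(z))\<close>.
\<close>

section \<open>Last-passage times by recursion\<close>

text \<open>
  Last-passage times from the origin by their recursion. Sites on the axes carry weights, which serve
  as the boundary of the stationary model, and paths do not collect the weight of the origin.
\<close>

fun lpp :: "(nat \<times> nat \<Rightarrow> real) \<Rightarrow> nat \<Rightarrow> nat \<Rightarrow> real" where
  "lpp w 0 0 = 0"
| "lpp w (Suc i) 0 = lpp w i 0 + w (Suc i, 0)"
| "lpp w 0 (Suc j) = lpp w 0 j + w (0, Suc j)"
| "lpp w (Suc i) (Suc j) = max (lpp w i (Suc j)) (lpp w (Suc i) j) + w (Suc i, Suc j)"

lemma grid_induct [case_names origin row column bulk]:
  assumes "P 0 0" and "\<And>i. P i 0 \<Longrightarrow> P (Suc i) 0" and "\<And>j. P 0 j \<Longrightarrow> P 0 (Suc j)"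
    and "\<And>i j. P i (Suc j) \<Longrightarrow> P (Suc i) j \<Longrightarrow> P (Suc i) (Suc j)"
  shows "P (m :: nat) (n :: nat)"
  by (rule lpp.induct[of "\<lambda>_. P"]) (use assms in blast)+

text \<open>
  The last-passage time from \<open>(k + 1, l + 1)\<close> to \<open>(k + m, l + n)\<close> becomes \<open>lpp (bulk k l w) m n\<close>: with
  nonnegative weights, zeros on the axes cannot change a maximum over paths. This makes passage times
  with and without boundary instances of one recursion.
\<close>

definition bulk :: "nat \<Rightarrow> nat \<Rightarrow> (nat \<times> nat \<Rightarrow> real) \<Rightarrow> nat \<times> nat \<Rightarrow> real" where
  "bulk k l w = (\<lambda>(i, j). if i = 0 \<or> j = 0 then 0 else w (i + k, j + l))"

lemma bulk_simps [simp]: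
  "bulk k l w (0, j) = 0" "bulk k l w (i, 0) = 0" "bulk k l w (Suc i, Suc j) = w (Suc i + k, Suc j + l)"
  by (auto simp: bulk_def)

lemma lpp_row: "lpp w m 0 = (\<Sum>i=1..m. w (i, 0))"
  by (induction m) auto

lemma lpp_column: "lpp w 0 n = (\<Sum>j=1..n. w (0, j))"
  by (induction n) auto

lemma lpp_bulk_boundary [simp]: "lpp (bulk k l w) m 0 = 0" "lpp (bulk k l w) 0 n = 0"
  unfolding lpp_row lpp_column by simp_all

lemma lpp_mono:
  assumes "\<And>i j. i \<le> m \<Longrightarrow> j \<le> n \<Longrightarrow> w (i, j) \<le> w' (i, j)"
  shows "lpp w m n \<le> lpp w' m n"
  using assms
proof (induction m n rule: grid_induct)
  case (bulk i j)
  then show ?case by (auto intro!: add_mono max.mono)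
qed (auto intro!: add_mono)

text \<open>
  Reflection in the diagonal, which turns statements about columns into statements about rows.
\<close>

lemma lpp_swap: "lpp (\<lambda>(i, j). w (j, i)) n m = lpp w m n"
  by (induction m n rule: grid_induct) (auto simp: max.commute)

lemma bulk_swap: "bulk k l (\<lambda>(i, j). w (j, i)) = (\<lambda>(i, j). bulk l k w (j, i))"
  by (auto simp: bulk_def fun_eq_iff)

lemma lpp_zero [simp]: "lpp (\<lambda>_. 0) m n = 0"
  by (induction m n rule: grid_induct) auto

lemma lpp_nonneg:
  assumes "\<And>k. w k \<ge> 0"
  shows "lpp w m n \<ge> 0"
  using lpp_mono[of m n "\<lambda>_. 0" w] assms by simp

lemma bulk_nonneg: "(\<And>k. w k \<ge> 0) \<Longrightarrow> bulk k l w x \<ge> 0"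
  by (auto simp: bulk_def split: prod.splits)

lemma lpp_bulk_nonneg: "(\<And>k. w k \<ge> 0) \<Longrightarrow> lpp (bulk k l w) m n \<ge> 0"
  by (intro lpp_nonneg bulk_nonneg)

lemma lpp_bulk_Suc:
  assumes "\<And>k. w k \<ge> 0"
  shows "lpp (bulk k l w) m n \<le> lpp (bulk k l w) (Suc m) n"
    and "lpp (bulk k l w) m n \<le> lpp (bulk k l w) m (Suc n)"
  using assms bulk_nonneg[OF assms] by (cases n; cases m; auto simp: le_max_iff_disj intro!: add_increasing2 lpp_bulk_nonneg)+

lemma lpp_bulk_le:
  assumes "\<And>k. w k \<ge> 0" and "m \<le> m'" and "n \<le> n'"
  shows "lpp (bulk k l w) m n \<le> lpp (bulk k l w) m' n'"
proof -
  have "lpp (bulk k l w) m n \<le> lpp (bulk k l w) m' n"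
    using \<open>m \<le> m'\<close> by (rule lift_Suc_mono_le[rotated]) (rule lpp_bulk_Suc(1)[OF assms(1)])
  also have "\<dots> \<le> lpp (bulk k l w) m' n'"
    using \<open>n \<le> n'\<close> by (rule lift_Suc_mono_le[rotated]) (rule lpp_bulk_Suc(2)[OF assms(1)])
  finally show ?thesis .
qed

lemma lpp_bulk_drop_column:
  assumes "\<And>k. w k \<ge> 0"
  shows "lpp (bulk (Suc k) l w) m n \<le> lpp (bulk k l w) (Suc m) n"
proof (induction m n rule: grid_induct)
  case (row i)
  then show ?case by simp
next
  case (column j)
  then show ?case by (simp add: lpp_bulk_nonneg assms del: lpp.simps)
next
  case (bulk i j)
  then show ?case by (auto simp: le_max_iff_disj)
qed auto

lemma lpp_bulk_drop_columns:
  assumes "\<And>k. w k \<ge> 0" and "k \<le> k'"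
  shows "lpp (bulk k' l w) m n \<le> lpp (bulk k l w) (m + (k' - k)) n"
  using \<open>k \<le> k'\<close>
proof (induction k' arbitrary: m rule: dec_induct)
  case (step p)
  then show ?case
    using lpp_bulk_drop_column[of w p l m n, OF assms(1)] step.IH[of "Suc m"] by (simp add: Suc_diff_le)
qed simp

lemma lpp_bulk_drop_rows:
  assumes "\<And>k. w k \<ge> 0" and "l \<le> l'"
  shows "lpp (bulk k l' w) m n \<le> lpp (bulk k l w) m (n + (l' - l))"
proof -
  have "(case p of (i, j) \<Rightarrow> w (j, i)) \<ge> 0" for p using assms(1) by (cases p) simp
  from lpp_bulk_drop_columns[of "\<lambda>(i, j). w (j, i)", OF this assms(2), of k n m]
  show ?thesis by (simp add: bulk_swap lpp_swap)
qed

text \<open>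
  One admissible strategy is to climb the first column up to height \<open>l\<close> and then to proceed freely.
\<close>

lemma first_column_then_bulk_le:
  assumes w: "\<And>k. w k \<ge> 0" and m: "m \<ge> 1" and n: "n \<ge> 1"
  shows "(\<Sum>j=1..l. w (1, j)) + lpp (bulk 0 l w) m n \<le> lpp (bulk 0 0 w) m (n + l)"
proof -
  have step: "lpp (bulk k l w) (Suc i) (Suc j) = max (lpp (bulk k l w) i (Suc j)) (lpp (bulk k l w) (Suc i) j) + w (Suc i + k, Suc j + l)" for k l i j
    by simp
  note [simp del] = lpp.simps
  note nonneg = lpp_bulk_nonneg[of w, OF w]
  have col: "(\<Sum>j=1..l. w (1, j)) \<le> lpp (bulk 0 0 w) (Suc 0) l" for l
  proof (induction l)
    case (Suc l)
    then show ?case using step[of 0 0 0 l] nonneg[of 0 0 "Suc 0" l] by simp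
  qed simp
  obtain m0 n0 where mn: "m = Suc m0" "n = Suc n0"
    using m n by (metis not0_implies_Suc not_one_le_zero)
  have max_step: "c + (max a b + x) \<le> max a' b' + x" if "c + a \<le> a'" "c + b \<le> b'" for a b c a' b' x :: real
    using that by linarith
  have max_left: "c + (max a 0 + x) \<le> max a' b' + x" if "c + a \<le> a'" "a \<ge> 0" for a b c a' b' x :: real
    using that by linarith
  have max_right: "c + (max 0 a + x) \<le> max b' a' + x" if "c + a \<le> a'" "a \<ge> 0" for a b c a' b' x :: real
    using that by linarith
  have "(\<Sum>j=1..l. w (1, j)) + lpp (bulk 0 l w) (Suc m0) (Suc n0) \<le> lpp (bulk 0 0 w) (Suc m0) (Suc n0 + l)"
  proof (induction m0 n0 rule: grid_induct)
    case origin
    show ?case using col[of "Suc l"] step[of 0 l 0 0] by simp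
  next
    case (row i)
    show ?case
      using max_left[OF row nonneg, of "w (Suc (Suc i), Suc l)" "lpp (bulk 0 0 w) (Suc (Suc i)) l"]
        step[of 0 l "Suc i" 0] step[of 0 0 "Suc i" l] by simp
  next
    case (column j)
    show ?case
      using max_right[OF column nonneg, of "w (Suc 0, Suc (Suc j) + l)" "lpp (bulk 0 0 w) 0 (Suc (Suc j) + l)"]
        step[of 0 l 0 "Suc j"] step[of 0 0 0 "Suc j + l"] by simp
  next
    case (bulk i j)
    show ?case
      using max_step[OF bulk, of "w (Suc (Suc i), Suc (Suc j) + l)"]
        step[of 0 l "Suc i" "Suc j"] step[of 0 0 "Suc i" "Suc j + l"] by simp
  qed
  then show ?thesis by (simp add: mn)
qed

lemma first_row_then_bulk_le:
  assumes "\<And>k. w k \<ge> 0" and "m \<ge> 1" and "n \<ge> 1"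
  shows "(\<Sum>i=1..k. w (i, 1)) + lpp (bulk k 0 w) m n \<le> lpp (bulk 0 0 w) (m + k) n"
proof -
  have "(case p of (i, j) \<Rightarrow> w (j, i)) \<ge> 0" for p using assms(1) by (cases p) simp
  from first_column_then_bulk_le[of "\<lambda>(i, j). w (j, i)", OF this assms(3,2), of k]
  show ?thesis by (simp add: bulk_swap lpp_swap)
qed

text \<open>
  A maximal path runs along one of the axes up to some last boundary site \<open>k + 1\<close>; there it
  turns into the bulk, in column (or row) \<open>k + 1\<close>. The induction follows the maximal path
  backwards from its end.
\<close>

lemma exit_point:
  assumes w: "\<And>k. w k \<ge> 0"
  shows "(\<exists>k<Suc m. lpp w (Suc m) (Suc n) \<le> (\<Sum>i=1..Suc k. w (i, 0)) + lpp (bulk k 0 w) (Suc m - k) (Suc n))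
       \<or> (\<exists>k<Suc n. lpp w (Suc m) (Suc n) \<le> (\<Sum>j=1..Suc k. w (0, j)) + lpp (bulk 0 k w) (Suc m) (Suc n - k))"
    (is "?X m n \<or> ?Y m n")
proof -
  have left: "?X m n \<or> ?Y m n"
    if pred: "m > 0 \<Longrightarrow> ?X (m - 1) n \<or> ?Y (m - 1) n" and
       eq: "lpp w (Suc m) (Suc n) = lpp w m (Suc n) + w (Suc m, Suc n)" for m n
  proof (cases m)
    case 0
    have "lpp w (Suc m) (Suc n) = (\<Sum>j=1..Suc n. w (0, j)) + lpp (bulk 0 n w) (Suc m) (Suc n - n)"
      unfolding eq unfolding 0 lpp_column by simp
    then show ?thesis by (intro disjI2 exI[of _ n]) simp
  next
    case (Suc p)
    from pred Suc consider (x) "?X p n" | (y) "?Y p n" by auto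
    then show ?thesis
    proof cases
      case x
      then obtain k where k: "k < Suc p" "lpp w (Suc p) (Suc n) \<le> (\<Sum>i=1..Suc k. w (i, 0)) + lpp (bulk k 0 w) (Suc p - k) (Suc n)"
        by blast
      have "lpp (bulk k 0 w) (Suc p - k) (Suc n) + w (Suc m, Suc n) \<le> lpp (bulk k 0 w) (Suc m - k) (Suc n)"
        using k(1) Suc by (simp add: Suc_diff_le)
      then show ?thesis using k Suc eq by (intro disjI1 exI[of _ k]) auto
    next
      case y
      then obtain k where k: "k < Suc n" "lpp w (Suc p) (Suc n) \<le> (\<Sum>j=1..Suc k. w (0, j)) + lpp (bulk 0 k w) (Suc p) (Suc n - k)"
        by blast
      have "lpp (bulk 0 k w) (Suc p) (Suc n - k) + w (Suc m, Suc n) \<le> lpp (bulk 0 k w) (Suc m) (Suc n - k)"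
        using k(1) Suc by (simp add: Suc_diff_le)
      then show ?thesis using k Suc eq by (intro disjI2 exI[of _ k]) auto
    qed
  qed
  have down: "?X m n \<or> ?Y m n"
    if pred: "n > 0 \<Longrightarrow> ?X m (n - 1) \<or> ?Y m (n - 1)" and
       eq: "lpp w (Suc m) (Suc n) = lpp w (Suc m) n + w (Suc m, Suc n)" for m n
  proof (cases n)
    case 0
    have "lpp w (Suc m) (Suc n) = (\<Sum>i=1..Suc m. w (i, 0)) + lpp (bulk m 0 w) (Suc m - m) (Suc n)"
      unfolding eq unfolding 0 lpp_row by simp
    then show ?thesis by (intro disjI1 exI[of _ m]) simp
  next
    case (Suc p)
    from pred Suc consider (x) "?X m p" | (y) "?Y m p" by auto
    then show ?thesis
    proof cases
      case x
      then obtain k where k: "k < Suc m" "lpp w (Suc m) (Suc p) \<le> (\<Sum>i=1..Suc k. w (i, 0)) + lpp (bulk k 0 w) (Suc m - k) (Suc p)"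
        by blast
      have "lpp (bulk k 0 w) (Suc m - k) (Suc p) + w (Suc m, Suc n) \<le> lpp (bulk k 0 w) (Suc m - k) (Suc n)"
        using k(1) Suc by (simp add: Suc_diff_le)
      then show ?thesis using k Suc eq by (intro disjI1 exI[of _ k]) auto
    next
      case y
      then obtain k where k: "k < Suc p" "lpp w (Suc m) (Suc p) \<le> (\<Sum>j=1..Suc k. w (0, j)) + lpp (bulk 0 k w) (Suc m) (Suc p - k)"
        by blast
      have "lpp (bulk 0 k w) (Suc m) (Suc p - k) + w (Suc m, Suc n) \<le> lpp (bulk 0 k w) (Suc m) (Suc n - k)"
        using k(1) Suc by (simp add: Suc_diff_le)
      then show ?thesis using k Suc eq by (intro disjI2 exI[of _ k]) auto
    qed
  qed
  show ?thesis
  proof (induction "m + n" arbitrary: m n rule: less_induct)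
    case less
    consider "lpp w (Suc m) (Suc n) = lpp w m (Suc n) + w (Suc m, Suc n)"
      | "lpp w (Suc m) (Suc n) = lpp w (Suc m) n + w (Suc m, Suc n)"
      by (cases "lpp w m (Suc n) \<le> lpp w (Suc m) n") auto
    then show ?case
    proof cases
      case 1
      show ?thesis by (rule left[OF _ 1]) (use less[of "m - 1" n] in auto)
    next
      case 2
      show ?thesis by (rule down[OF _ 2]) (use less[of m "n - 1"] in auto)
    qed
  qed
qed

lemma directed_paths_snoc:
  assumes "p @ [y] \<in> directed_paths u v" and "p \<noteq> []"
  shows "v = y" and "y = (fst (last p) + 1, snd (last p)) \<or> y = (fst (last p), snd (last p) + 1)"
    and "p \<in> directed_paths u (last p)"
  using assms by (cases "last p"; simp add: directed_paths_def successively_append_iff; force)+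

lemma directed_path_extend:
  assumes "p \<in> directed_paths u (i, j)" and "y = (Suc i, j) \<or> y = (i, Suc j)"
  shows "p @ [y] \<in> directed_paths u y"
  using assms by (auto simp: directed_paths_def successively_append_iff)

text \<open>
  All four facts are needed about the same induction over the path: the range and the length of paths
  give finiteness of the set of paths, hence a meaningful maximum, and the bound on the weight is one
  half of the comparison with the recursion.
\<close>

lemma directed_path_bound:
  assumes "p \<in> directed_paths (1, 1) (m, n)"
  shows "m \<ge> 1 \<and> n \<ge> 1 \<and> length p + 1 = m + n \<and> set p \<subseteq> {..m} \<times> {..n}
       \<and> ((\<forall>i\<ge>1. \<forall>j\<ge>1. w (i, j) \<ge> 0) \<longrightarrow> (\<Sum>x\<leftarrow>p. w x) \<le> lpp (bulk 0 0 w) m n)"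
  using assms
proof (induction p arbitrary: m n rule: rev_induct)
  case Nil
  then show ?case by (auto simp: directed_paths_def)
next
  case (snoc y p)
  show ?case
  proof (cases "p = []")
    case True
    then have "m = 1" "n = 1" "y = (1, 1)" using snoc.prems by (auto simp: directed_paths_def)
    then show ?thesis using True by auto
  next
    case False
    obtain i j where ij: "last p = (i, j)" by (cases "last p")
    have y: "(m, n) = y" "y = (Suc i, j) \<or> y = (i, Suc j)" and p: "p \<in> directed_paths (1, 1) (i, j)"
      using directed_paths_snoc[OF snoc.prems False] ij by auto
    note IH = snoc.IH[OF p]
    have "i \<ge> 1" "j \<ge> 1" using IH by auto
    then obtain i' j' where "i = Suc i'" "j = Suc j'" by (metis not0_implies_Suc not_one_le_zero)
    then show ?thesis using IH y by (auto simp: max_def)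
  qed
qed

lemma directed_path_maximal:
  assumes "\<And>i j. i \<ge> 1 \<Longrightarrow> j \<ge> 1 \<Longrightarrow> w (i, j) \<ge> 0"
  shows "\<exists>p\<in>directed_paths (1, 1) (Suc m, Suc n). (\<Sum>x\<leftarrow>p. w x) = lpp (bulk 0 0 w) (Suc m) (Suc n)"
proof (induction "m + n" arbitrary: m n rule: less_induct)
  case less
  have nonneg: "lpp (bulk 0 0 w) i j \<ge> 0" for i j
    by (intro lpp_nonneg) (auto simp: bulk_def assms split: prod.splits)
  let ?v = "(Suc m, Suc n)"
  have extend: "\<exists>p\<in>directed_paths (1, 1) ?v. (\<Sum>x\<leftarrow>p. w x) = lpp (bulk 0 0 w) (Suc m) (Suc n)"
    if "q \<in> directed_paths (1, 1) (i, j)" "?v = (Suc i, j) \<or> ?v = (i, Suc j)"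
      "(\<Sum>x\<leftarrow>q. w x) + w ?v = lpp (bulk 0 0 w) (Suc m) (Suc n)" for q i j
    using directed_path_extend[OF that(1,2)] that(3) by (intro bexI[of _ "q @ [?v]"]) auto
  have rec: "lpp (bulk 0 0 w) (Suc m) (Suc n) = max (lpp (bulk 0 0 w) m (Suc n)) (lpp (bulk 0 0 w) (Suc m) n) + w ?v"
    by simp
  consider (1) "m = 0" "n = 0" | (2) "m > 0" "lpp (bulk 0 0 w) m (Suc n) \<ge> lpp (bulk 0 0 w) (Suc m) n"
    | (3) "n > 0" "lpp (bulk 0 0 w) m (Suc n) \<le> lpp (bulk 0 0 w) (Suc m) n"
    using nonneg by (metis lpp_bulk_boundary gr0I linear)
  then show ?case
  proof cases
    case 1
    then show ?thesis by (intro bexI[of _ "[(1, 1)]"]) (auto simp: directed_paths_def)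
  next
    case 2
    then obtain m' where m': "m = Suc m'" by (auto simp: gr0_conv_Suc)
    obtain q where q: "q \<in> directed_paths (1, 1) (m, Suc n)" "(\<Sum>x\<leftarrow>q. w x) = lpp (bulk 0 0 w) m (Suc n)"
      using less[of m' n] m' by auto
    show ?thesis using q 2 rec by (intro extend[of q m "Suc n"]) (auto simp: max_def)
  next
    case 3
    then obtain n' where n': "n = Suc n'" by (auto simp: gr0_conv_Suc)
    obtain q where q: "q \<in> directed_paths (1, 1) (Suc m, n)" "(\<Sum>x\<leftarrow>q. w x) = lpp (bulk 0 0 w) (Suc m) n"
      using less[of m n'] n' by auto
    show ?thesis using q 3 rec by (intro extend[of q "Suc m" n]) (auto simp: max_def)
  qed
qed

lemma last_passage_time_eq_lpp:
  assumes w: "\<And>i j. i \<ge> 1 \<Longrightarrow> j \<ge> 1 \<Longrightarrow> w (i, j) \<ge> 0" and "m \<ge> 1" and "n \<ge> 1"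
  shows "last_passage_time w m n = lpp (bulk 0 0 w) m n"
  unfolding last_passage_time_def
proof (rule Max_eqI)
  have "directed_paths (1, 1) (m, n) \<subseteq> {p. set p \<subseteq> {..m} \<times> {..n} \<and> length p = m + n - 1}"
    using directed_path_bound by fastforce
  then have "finite (directed_paths (1, 1) (m, n))"
    by (rule finite_subset) (intro finite_lists_length_eq finite_SigmaI finite_atMost)
  then show "finite ((\<lambda>p. \<Sum>x\<leftarrow>p. w x) ` directed_paths (1, 1) (m, n))" by simp
  show "y \<le> lpp (bulk 0 0 w) m n" if "y \<in> (\<lambda>p. \<Sum>x\<leftarrow>p. w x) ` directed_paths (1, 1) (m, n)" for y
    using that directed_path_bound[of _ m n w] w by auto
  obtain m' n' where mn: "m = Suc m'" "n = Suc n'"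
    using assms by (metis not0_implies_Suc not_one_le_zero)
  have "\<exists>p\<in>directed_paths (1, 1) (Suc m', Suc n'). (\<Sum>x\<leftarrow>p. w x) = lpp (bulk 0 0 w) (Suc m') (Suc n')"
    by (rule directed_path_maximal) (rule w)
  then obtain p where "p \<in> directed_paths (1, 1) (m, n)" "(\<Sum>x\<leftarrow>p. w x) = lpp (bulk 0 0 w) m n"
    unfolding mn by blast
  then show "lpp (bulk 0 0 w) m n \<in> (\<lambda>p. \<Sum>x\<leftarrow>p. w x) ` directed_paths (1, 1) (m, n)"
    by (metis imageI)
qed

section \<open>The Burke property\<close>

definition expo :: "real \<Rightarrow> real measure" where
  "expo r = density lborel (exponential_density r)"

lemma sets_expo [simp, measurable_cong]: "sets (expo r) = sets borel"
  by (simp add: expo_def)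

lemma space_expo [simp]: "space (expo r) = UNIV"
  by (simp add: expo_def)

lemma prob_space_expo: "r > 0 \<Longrightarrow> prob_space (expo r)"
  unfolding expo_def by (rule prob_space_exponential_density)

lemma nn_integral_expo:
  assumes "f \<in> borel_measurable borel"
  shows "(\<integral>\<^sup>+x. f x \<partial>expo r) = (\<integral>\<^sup>+x. ennreal (exponential_density r x) * f x \<partial>lborel)"
  unfolding expo_def using assms by (subst nn_integral_density) auto

lemma AE_expo_nonneg: "AE x in expo r. 0 \<le> x"
  unfolding expo_def by (subst AE_density) (auto simp: exponential_density_def)

text \<open>
  Change of variables from \<open>(x, y)\<close> to the difference \<open>d = x - y\<close> and the minimum \<open>v\<close>; it amounts to one
  translation in \<open>x\<close> and, for fixed \<open>d\<close>, one in \<open>y\<close>.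
\<close>

lemma nn_integral_quadrant_diff_min:
  fixes h :: "real \<Rightarrow> real \<Rightarrow> ennreal"
  assumes h [measurable]: "case_prod h \<in> borel_measurable (borel \<Otimes>\<^sub>M borel)"
    and neg: "\<And>x y. x < 0 \<or> y < 0 \<Longrightarrow> h x y = 0"
  shows "(\<integral>\<^sup>+x. \<integral>\<^sup>+y. h x y \<partial>lborel \<partial>lborel)
       = (\<integral>\<^sup>+d. \<integral>\<^sup>+v. h (v + max 0 d) (v + max 0 (- d)) \<partial>lborel \<partial>lborel)"
proof -
  have "(\<integral>\<^sup>+x. \<integral>\<^sup>+y. h x y \<partial>lborel \<partial>lborel) = (\<integral>\<^sup>+y. \<integral>\<^sup>+x. h x y \<partial>lborel \<partial>lborel)"
    by (rule lborel_pair.Fubini') simp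
  also have "\<dots> = (\<integral>\<^sup>+y. \<integral>\<^sup>+d. h (y + d) y \<partial>lborel \<partial>lborel)"
  proof (rule nn_integral_cong)
    fix y :: real
    show "(\<integral>\<^sup>+x. h x y \<partial>lborel) = (\<integral>\<^sup>+d. h (y + d) y \<partial>lborel)"
      by (subst nn_integral_real_affine[where c=1 and t=y]) auto
  qed
  also have "\<dots> = (\<integral>\<^sup>+d. \<integral>\<^sup>+y. h (y + d) y \<partial>lborel \<partial>lborel)"
    by (rule lborel_pair.Fubini') simp
  also have "\<dots> = (\<integral>\<^sup>+d. \<integral>\<^sup>+v. h (v + max 0 d) (v + max 0 (- d)) \<partial>lborel \<partial>lborel)"
  proof (rule nn_integral_cong)
    fix d :: real
    have "(\<integral>\<^sup>+y. h (y + d) y \<partial>lborel) = (\<integral>\<^sup>+v. h (max 0 (- d) + 1 * v + d) (max 0 (- d) + 1 * v) \<partial>lborel)"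
      by (subst nn_integral_real_affine[where c=1 and t="max 0 (- d)"]) auto
    also have "\<dots> = (\<integral>\<^sup>+v. h (v + max 0 d) (v + max 0 (- d)) \<partial>lborel)"
      by (intro nn_integral_cong arg_cong2[where f=h]) (auto simp: max_def)
    finally show "(\<integral>\<^sup>+y. h (y + d) y \<partial>lborel) = \<dots>" .
  qed
  finally show ?thesis .
qed

text \<open>
  In the coordinates difference \<open>d\<close> and minimum \<open>v\<close> of the first two variables, the map replaces
  \<open>(d, v, w)\<close> by \<open>(d, w, v)\<close>. The joint density, proportional to \<open>exp (- (a + b) (v + w) - a d\<^sup>+ - b d\<^sup>-)\<close>, is
  symmetric in \<open>v\<close> and \<open>w\<close>.
\<close>

lemma burke_exchange_integral:
  fixes f :: "real \<Rightarrow> real \<Rightarrow> real \<Rightarrow> ennreal"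
  assumes f [measurable]: "(\<lambda>(x, y, w). f x y w) \<in> borel_measurable (borel \<Otimes>\<^sub>M borel \<Otimes>\<^sub>M borel)"
    and ab: "a > 0" "b > 0"
  shows "(\<integral>\<^sup>+x. \<integral>\<^sup>+y. \<integral>\<^sup>+w. f (w + max 0 (x - y)) (w + max 0 (y - x)) (min x y) \<partial>expo (a + b) \<partial>expo b \<partial>expo a)
       = (\<integral>\<^sup>+x. \<integral>\<^sup>+y. \<integral>\<^sup>+w. f x y w \<partial>expo (a + b) \<partial>expo b \<partial>expo a)"
proof -
  define p where "p x y w = ennreal (exponential_density a x) * (ennreal (exponential_density b y)
    * ennreal (exponential_density (a + b) w))" for x y w
  have p [measurable]: "(\<lambda>(x, y, w). p x y w) \<in> borel_measurable (borel \<Otimes>\<^sub>M borel \<Otimes>\<^sub>M borel)"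
    unfolding p_def exponential_density_def by measurable
  have p_neg: "p x y w = 0" if "x < 0 \<or> y < 0 \<or> w < 0" for x y w
    using that by (auto simp: p_def exponential_density_def)
  have p_swap: "p (v + max 0 d) (v + max 0 (- d)) w = p (w + max 0 d) (w + max 0 (- d)) v" for d v w
  proof (cases "v \<ge> 0 \<and> w \<ge> 0")
    case True
    have p_eq: "p x y w = ennreal (a * b * (a + b) * exp (- (a * x + b * y + (a + b) * w)))"
      if "x \<ge> 0" "y \<ge> 0" "w \<ge> 0" for x y w
      using that ab by (simp add: p_def exponential_density_def ennreal_mult[symmetric] exp_add[symmetric] exp_minus exp_diff field_simps)
    show ?thesis
      using True by (subst (1 2) p_eq) (auto intro!: arg_cong[where f=ennreal] simp: algebra_simps)
  next
    case False
    then have "v + max 0 d < 0 \<or> v + max 0 (- d) < 0 \<or> w < 0" "w + max 0 d < 0 \<or> w + max 0 (- d) < 0 \<or> v < 0"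
      by (auto simp: max_def)
    then show ?thesis using p_neg by metis
  qed
  have expand: "(\<integral>\<^sup>+x. \<integral>\<^sup>+y. \<integral>\<^sup>+w. F x y w \<partial>expo (a + b) \<partial>expo b \<partial>expo a)
      = (\<integral>\<^sup>+d. \<integral>\<^sup>+v. \<integral>\<^sup>+w. p (v + max 0 d) (v + max 0 (- d)) w * F (v + max 0 d) (v + max 0 (- d)) w \<partial>lborel \<partial>lborel \<partial>lborel)"
    if F [measurable]: "(\<lambda>(x, y, w). F x y w) \<in> borel_measurable (borel \<Otimes>\<^sub>M borel \<Otimes>\<^sub>M borel)" for F
  proof -
    have "(\<integral>\<^sup>+x. \<integral>\<^sup>+y. \<integral>\<^sup>+w. F x y w \<partial>expo (a + b) \<partial>expo b \<partial>expo a)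
      = (\<integral>\<^sup>+x. \<integral>\<^sup>+y. \<integral>\<^sup>+w. p x y w * F x y w \<partial>lborel \<partial>lborel \<partial>lborel)"
    proof -
      have [measurable]: "(\<lambda>z. F (fst (fst z)) (snd (fst z)) (snd z)) \<in> borel_measurable ((borel \<Otimes>\<^sub>M borel) \<Otimes>\<^sub>M borel)"
        using measurable_compose[OF _ F, of "\<lambda>z. (fst (fst z), snd (fst z), snd z)" "(borel \<Otimes>\<^sub>M borel) \<Otimes>\<^sub>M borel"] by simp
      have 1: "(\<integral>\<^sup>+w. F x y w \<partial>expo (a + b)) = (\<integral>\<^sup>+w. ennreal (exponential_density (a + b) w) * F x y w \<partial>lborel)" for x y
        by (rule nn_integral_expo) measurable
      have 2: "(\<integral>\<^sup>+y. \<integral>\<^sup>+w. F x y w \<partial>expo (a + b) \<partial>expo b) =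
          (\<integral>\<^sup>+y. ennreal (exponential_density b y) * (\<integral>\<^sup>+w. ennreal (exponential_density (a + b) w) * F x y w \<partial>lborel) \<partial>lborel)" for x
        unfolding 1 by (rule nn_integral_expo) measurable
      show ?thesis
        unfolding 2
        apply (subst nn_integral_expo)
         apply measurable
        apply (simp add: p_def nn_integral_cmult mult.assoc)
        done
    qed
    also have "\<dots> = (\<integral>\<^sup>+d. \<integral>\<^sup>+v. \<integral>\<^sup>+w. p (v + max 0 d) (v + max 0 (- d)) w * F (v + max 0 d) (v + max 0 (- d)) w \<partial>lborel \<partial>lborel \<partial>lborel)"
    proof (rule nn_integral_quadrant_diff_min)
      have "(\<lambda>z. p (fst (fst z)) (snd (fst z)) (snd z) * F (fst (fst z)) (snd (fst z)) (snd z)) \<in> borel_measurable ((borel \<Otimes>\<^sub>M borel) \<Otimes>\<^sub>M borel)"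
        using measurable_compose[OF _ F, of "\<lambda>z. (fst (fst z), snd (fst z), snd z)" "(borel \<Otimes>\<^sub>M borel) \<Otimes>\<^sub>M borel"]
          measurable_compose[OF _ p, of "\<lambda>z. (fst (fst z), snd (fst z), snd z)" "(borel \<Otimes>\<^sub>M borel) \<Otimes>\<^sub>M borel"] by simp
      then have "(\<lambda>z. p (fst (fst z)) (snd (fst z)) (snd z) * F (fst (fst z)) (snd (fst z)) (snd z)) \<in> borel_measurable ((borel \<Otimes>\<^sub>M borel) \<Otimes>\<^sub>M lborel)"
        by (simp cong: measurable_cong_sets sets_pair_measure_cong)
      from lborel.borel_measurable_nn_integral_fst[OF this]
      show "(\<lambda>(x, y). \<integral>\<^sup>+w. p x y w * F x y w \<partial>lborel) \<in> borel_measurable (borel \<Otimes>\<^sub>M borel)"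
        by (simp add: case_prod_beta)
    qed (auto simp: p_neg)
    finally show ?thesis .
  qed
  have min: "w + max 0 ((v + max 0 d) - (v + max 0 (- d))) = w + max 0 d"
      "w + max 0 ((v + max 0 (- d)) - (v + max 0 d)) = w + max 0 (- d)"
      "min (v + max 0 d) (v + max 0 (- d)) = v" for v w d :: real
    by auto
  have "(\<integral>\<^sup>+x. \<integral>\<^sup>+y. \<integral>\<^sup>+w. f (w + max 0 (x - y)) (w + max 0 (y - x)) (min x y) \<partial>expo (a + b) \<partial>expo b \<partial>expo a)
      = (\<integral>\<^sup>+d. \<integral>\<^sup>+v. \<integral>\<^sup>+w. p (w + max 0 d) (w + max 0 (- d)) v * f (w + max 0 d) (w + max 0 (- d)) v \<partial>lborel \<partial>lborel \<partial>lborel)"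
  proof (subst expand)
    show "(\<lambda>(x, y, w). f (w + max 0 (x - y)) (w + max 0 (y - x)) (min x y)) \<in> borel_measurable (borel \<Otimes>\<^sub>M borel \<Otimes>\<^sub>M borel)"
      using measurable_compose[OF _ f, of "\<lambda>(x, y, w). (w + max 0 (x - y), w + max 0 (y - x), min x y)" "borel \<Otimes>\<^sub>M borel \<Otimes>\<^sub>M borel"]
      by (simp add: case_prod_beta)
  qed (simp only: min p_swap)
  also have "\<dots> = (\<integral>\<^sup>+d. \<integral>\<^sup>+w. \<integral>\<^sup>+v. p (w + max 0 d) (w + max 0 (- d)) v * f (w + max 0 d) (w + max 0 (- d)) v \<partial>lborel \<partial>lborel \<partial>lborel)"
  proof (rule nn_integral_cong)
    fix d :: real
    have "(\<lambda>z. p (fst z + max 0 d) (fst z + max 0 (- d)) (snd z) * f (fst z + max 0 d) (fst z + max 0 (- d)) (snd z))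
        \<in> borel_measurable (lborel \<Otimes>\<^sub>M lborel)"
      using measurable_compose[OF _ f, of "\<lambda>z. (fst z + max 0 d, fst z + max 0 (- d), snd z)" "lborel \<Otimes>\<^sub>M lborel"]
        measurable_compose[OF _ p, of "\<lambda>z. (fst z + max 0 d, fst z + max 0 (- d), snd z)" "lborel \<Otimes>\<^sub>M lborel"]
      by simp
    then show "(\<integral>\<^sup>+v. \<integral>\<^sup>+w. p (w + max 0 d) (w + max 0 (- d)) v * f (w + max 0 d) (w + max 0 (- d)) v \<partial>lborel \<partial>lborel)
        = (\<integral>\<^sup>+w. \<integral>\<^sup>+v. p (w + max 0 d) (w + max 0 (- d)) v * f (w + max 0 d) (w + max 0 (- d)) v \<partial>lborel \<partial>lborel)"
      by (intro lborel_pair.Fubini') (simp add: case_prod_beta)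
  qed
  also have "\<dots> = (\<integral>\<^sup>+x. \<integral>\<^sup>+y. \<integral>\<^sup>+w. f x y w \<partial>expo (a + b) \<partial>expo b \<partial>expo a)"
    by (subst expand) auto
  finally show ?thesis .
qed

text \<open>
  The passage through one site: slots \<open>p\<close> and \<open>q\<close> hold the increments along the sides of a unit square
  through which paths enter, slot \<open>s\<close> holds the weight of the site. Afterwards \<open>p\<close> and \<open>q\<close> hold the increments
  along the two opposite sides; keeping the minimum in slot \<open>s\<close> makes the map preserve the full
  product law.
\<close>

definition exchange :: "'i \<Rightarrow> 'i \<Rightarrow> 'i \<Rightarrow> ('i \<Rightarrow> real) \<Rightarrow> ('i \<Rightarrow> real)" where
  "exchange p q s e = e(p := e s + max 0 (e p - e q), q := e s + max 0 (e q - e p), s := min (e p) (e q))"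

abbreviation expo_product :: "('i \<Rightarrow> real) \<Rightarrow> ('i \<Rightarrow> real) measure" where
  "expo_product r \<equiv> PiM UNIV (\<lambda>k. expo (r k))"

lemma prob_space_expo_product: "(\<And>k. r k > 0) \<Longrightarrow> prob_space (expo_product r)"
  by (intro prob_space_PiM prob_space_expo) auto

lemma measurable_upd_UNIV [measurable (raw)]:
  assumes "f \<in> measurable L (PiM UNIV M)" and "g \<in> measurable L (M i)"
  shows "(\<lambda>z. (f z)(i := g z)) \<in> measurable L (PiM UNIV M)"
  by (rule measurable_fun_upd[of UNIV UNIV i]) (use assms in auto)

lemma measurable_expo_component: "(\<lambda>w. w k) \<in> borel_measurable (expo_product r)"
  using measurable_component_singleton[of k UNIV "\<lambda>k. expo (r k)"] by (simp cong: measurable_cong_sets)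

text \<open>
  Resampling one coordinate of a product measure does not change the law. Integrals over a few
  coordinates are thus isolated without leaving the infinite product.
\<close>

lemma nn_integral_resample:
  assumes M: "\<And>i. prob_space (M i)" and f [measurable]: "f \<in> borel_measurable (PiM UNIV M)"
  shows "(\<integral>\<^sup>+e. f e \<partial>PiM UNIV M) = (\<integral>\<^sup>+e. \<integral>\<^sup>+x. f (e(i := x)) \<partial>M i \<partial>PiM UNIV M)"
proof -
  interpret P: prob_space "PiM UNIV M" by (rule prob_space_PiM) (rule M)
  interpret Q: prob_space "M i" by (rule M)
  interpret pair_sigma_finite "M i" "PiM UNIV M" ..
  have upd [measurable]: "(\<lambda>(x, X). X(i := x)) \<in> measurable (M i \<Otimes>\<^sub>M PiM UNIV M) (PiM UNIV M)"
    using measurable_fun_upd[of UNIV UNIV i "\<lambda>z. snd z" "M i \<Otimes>\<^sub>M PiM UNIV M" M "\<lambda>z. fst z"]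
    by (simp add: case_prod_beta)
  have "(\<integral>\<^sup>+e. f e \<partial>PiM UNIV M) = (\<integral>\<^sup>+e. f e \<partial>distr (M i \<Otimes>\<^sub>M PiM UNIV M) (PiM UNIV M) (\<lambda>(x, X). X(i := x)))"
    using distr_pair_PiM_eq_PiM[of UNIV M i] M by simp
  also have "\<dots> = (\<integral>\<^sup>+z. f ((snd z)(i := fst z)) \<partial>(M i \<Otimes>\<^sub>M PiM UNIV M))"
    by (subst nn_integral_distr) (auto simp: case_prod_beta)
  also have "\<dots> = (\<integral>\<^sup>+e. \<integral>\<^sup>+x. f (e(i := x)) \<partial>M i \<partial>PiM UNIV M)"
    by (subst nn_integral_snd[symmetric]) (use upd in \<open>auto simp: case_prod_beta\<close>)
  finally show ?thesis .
qed

lemma measurable_exchange [measurable]: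
  "exchange p q s \<in> measurable (expo_product r) (expo_product r)"
  unfolding exchange_def
  by (intro measurable_upd_UNIV; simp)

text \<open>
  The Burke property of a single site. Resampling the three slots reduces it to
  \<open>burke_exchange_integral\<close>.
\<close>

lemma distr_exchange:
  assumes r: "\<And>k. r k > 0" and rs: "r s = r p + r q" and dist: "p \<noteq> q" "p \<noteq> s" "q \<noteq> s"
  shows "distr (expo_product r) (expo_product r) (exchange p q s) = expo_product r"
proof (rule measure_eqI)
  fix A assume "A \<in> sets (distr (expo_product r) (expo_product r) (exchange p q s))"
  then have A [measurable]: "A \<in> sets (expo_product r)" by simp
  let ?N = "expo_product r"
  have prob: "\<And>i. prob_space (expo (r i))" using r by (intro prob_space_expo)
  interpret P: prob_space ?N by (intro prob_space_expo_product r)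
  have resample3: "(\<integral>\<^sup>+e. f e \<partial>?N)
      = (\<integral>\<^sup>+e. \<integral>\<^sup>+x. \<integral>\<^sup>+y. \<integral>\<^sup>+w. f (e(p := x, q := y, s := w)) \<partial>expo (r p + r q) \<partial>expo (r q) \<partial>expo (r p) \<partial>?N)"
    if [measurable]: "f \<in> borel_measurable ?N" for f :: "_ \<Rightarrow> ennreal"
  proof -
    interpret Qp: prob_space "expo (r p)" by (rule prob)
    interpret Qq: prob_space "expo (r q)" by (rule prob)
    interpret Qs: prob_space "expo (r s)" by (rule prob)
    have 1: "(\<lambda>e. \<integral>\<^sup>+w. f (e(s := w)) \<partial>expo (r s)) \<in> borel_measurable ?N"
      by (intro Qs.borel_measurable_nn_integral) measurable
    have 2: "(\<lambda>e. \<integral>\<^sup>+y. \<integral>\<^sup>+w. f (e(q := y, s := w)) \<partial>expo (r s) \<partial>expo (r q)) \<in> borel_measurable ?N"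
      by (intro Qq.borel_measurable_nn_integral Qs.borel_measurable_nn_integral) measurable
    show ?thesis
      apply (subst nn_integral_resample[of "\<lambda>k. expo (r k)" f s, OF prob], simp)
      apply (subst nn_integral_resample[of "\<lambda>k. expo (r k)" _ q, OF prob 1])
      apply (subst nn_integral_resample[of "\<lambda>k. expo (r k)" _ p, OF prob 2])
      apply (simp add: rs)
      done
  qed
  let ?f = "indicator A :: _ \<Rightarrow> ennreal"
  have "emeasure (distr ?N ?N (exchange p q s)) A = (\<integral>\<^sup>+e. ?f (exchange p q s e) \<partial>?N)"
    by (subst nn_integral_indicator[symmetric], simp, subst nn_integral_distr) auto
  also have "\<dots> = (\<integral>\<^sup>+e. \<integral>\<^sup>+x. \<integral>\<^sup>+y. \<integral>\<^sup>+w. ?f (exchange p q s (e(p := x, q := y, s := w))) \<partial>expo (r p + r q) \<partial>expo (r q) \<partial>expo (r p) \<partial>?N)"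
    by (rule resample3) measurable
  also have "\<dots> = (\<integral>\<^sup>+e. \<integral>\<^sup>+x. \<integral>\<^sup>+y. \<integral>\<^sup>+w. ?f (e(p := w + max 0 (x - y), q := w + max 0 (y - x), s := min x y)) \<partial>expo (r p + r q) \<partial>expo (r q) \<partial>expo (r p) \<partial>?N)"
    using dist by (simp add: exchange_def fun_upd_twist)
  also have "\<dots> = (\<integral>\<^sup>+e. \<integral>\<^sup>+x. \<integral>\<^sup>+y. \<integral>\<^sup>+w. ?f (e(p := x, q := y, s := w)) \<partial>expo (r p + r q) \<partial>expo (r q) \<partial>expo (r p) \<partial>?N)"
  proof (rule nn_integral_cong)
    fix e assume e: "e \<in> space ?N"
    have upd [measurable]: "(\<lambda>z. e(p := fst z, q := fst (snd z), s := snd (snd z))) \<in> measurable (borel \<Otimes>\<^sub>M borel \<Otimes>\<^sub>M borel) ?N"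
      by (rule measurable_PiM_single') (auto simp: space_PiM)
    have "(\<lambda>(x, y, w). ?f (e(p := x, q := y, s := w))) \<in> borel_measurable (borel \<Otimes>\<^sub>M borel \<Otimes>\<^sub>M borel)"
      using measurable_compose[OF upd, of ?f borel] by (simp add: case_prod_beta)
    from burke_exchange_integral[OF this, of "r p" "r q"] r
    show "(\<integral>\<^sup>+x. \<integral>\<^sup>+y. \<integral>\<^sup>+w. ?f (e(p := w + max 0 (x - y), q := w + max 0 (y - x), s := min x y)) \<partial>expo (r p + r q) \<partial>expo (r q) \<partial>expo (r p))
      = (\<integral>\<^sup>+x. \<integral>\<^sup>+y. \<integral>\<^sup>+w. ?f (e(p := x, q := y, s := w)) \<partial>expo (r p + r q) \<partial>expo (r q) \<partial>expo (r p))"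
      by simp
  qed
  also have "\<dots> = (\<integral>\<^sup>+e. ?f e \<partial>?N)"
    by (rule resample3[symmetric]) measurable
  also have "\<dots> = emeasure ?N A" by simp
  finally show "emeasure (distr ?N ?N (exchange p q s)) A = emeasure ?N A" .
qed simp

text \<open>
  Crossing the sites of column \<open>i\<close> from bottom to top. Slot \<open>(i, 0)\<close> carries the horizontal increment upwards,
  and slot \<open>(0, j)\<close> trades the vertical increment of the preceding column for that of column \<open>i\<close>.
\<close>

primrec sweep_column :: "(nat \<times> nat \<Rightarrow> real) \<Rightarrow> nat \<Rightarrow> nat \<Rightarrow> (nat \<times> nat \<Rightarrow> real)" where
  "sweep_column w i 0 = w"
| "sweep_column w i (Suc j) = exchange (i, 0) (0, Suc j) (i, Suc j) (sweep_column w i j)"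

primrec sweep :: "(nat \<times> nat \<Rightarrow> real) \<Rightarrow> nat \<Rightarrow> nat \<Rightarrow> (nat \<times> nat \<Rightarrow> real)" where
  "sweep w n 0 = w"
| "sweep w n (Suc i) = sweep_column (sweep w n i) (Suc i) n"

lemma sweep_column_other: "i' > i \<Longrightarrow> sweep_column v i j (i', j') = v (i', j')"
  by (induction j) (auto simp: exchange_def)

lemma sweep_other: "i' > i \<Longrightarrow> sweep w n i (i', j') = w (i', j')"
  by (induction i) (auto simp: sweep_column_other)

text \<open>
  Invariant inside a column: after \<open>k\<close> sites, slot \<open>(Suc i, 0)\<close> holds the horizontal increment at height \<open>k\<close>,
  the first \<open>k\<close> vertical slots are updated, and the weights further up are untouched.
\<close>

lemma sweep_eq_increments:
  "j < n \<Longrightarrow> sweep w n i (0, Suc j) = lpp w i (Suc j) - lpp w i j"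
proof (induction i arbitrary: j)
  case 0
  then show ?case by simp
next
  case (Suc i)
  let ?v = "sweep w n i"
  have v: "?v (Suc i, j) = w (Suc i, j)" for j by (rule sweep_other) simp
  have "sweep_column ?v (Suc i) k (Suc i, 0) = lpp w (Suc i) k - lpp w i k \<and>
    (\<forall>j<n. sweep_column ?v (Suc i) k (0, Suc j) = (if j < k then lpp w (Suc i) (Suc j) - lpp w (Suc i) j else ?v (0, Suc j))) \<and>
    (\<forall>j>k. sweep_column ?v (Suc i) k (Suc i, j) = w (Suc i, j))" if "k \<le> n" for k
    using that
  proof (induction k)
    case 0
    then show ?case by (simp add: v)
  next
    case (Suc k)
    let ?u = "sweep_column ?v (Suc i) k"
    have 1: "?u (Suc i, 0) = lpp w (Suc i) k - lpp w i k"
      and 2: "\<And>j. j < n \<Longrightarrow> ?u (0, Suc j) = (if j < k then lpp w (Suc i) (Suc j) - lpp w (Suc i) j else ?v (0, Suc j))"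
      and 3: "\<And>j. j > k \<Longrightarrow> ?u (Suc i, j) = w (Suc i, j)"
      using Suc by auto
    have 4: "?u (0, Suc k) = lpp w i (Suc k) - lpp w i k"
      using 2[of k] Suc.prems Suc.IH by (simp add: \<open>\<And>j. j < n \<Longrightarrow> ?v (0, Suc j) = lpp w i (Suc j) - lpp w i j\<close>)
    have 5: "?u (Suc i, Suc k) = w (Suc i, Suc k)" by (rule 3) simp
    show ?case
      using 1 2 3 4 5 by (auto simp: exchange_def max_def less_Suc_eq)
  qed
  from this[of n] Suc.prems show ?case by simp
qed

text \<open>
  The last-passage time telescopes along the bottom and the right side of the rectangle.
\<close>

lemma lpp_eq_boundary_plus_sweep:
  "lpp w m n = (\<Sum>i=1..m. w (i, 0)) + (\<Sum>j=1..n. sweep w n m (0, j))"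
proof -
  have "(\<Sum>j=1..n. sweep w n m (0, j)) = (\<Sum>j<n. lpp w m (Suc j) - lpp w m j)"
    by (simp add: sum.atLeast1_atMost_eq sweep_eq_increments)
  also have "\<dots> = lpp w m n - lpp w m 0"
    by (rule sum_lessThan_telescope)
  finally show ?thesis by (simp add: lpp_row)
qed

text \<open>
  Additivity of the rates is exactly what each exchange needs.
\<close>

lemma
  assumes r: "\<And>k. r k > 0" and rates: "\<And>i j. i \<ge> 1 \<Longrightarrow> j \<ge> 1 \<Longrightarrow> r (i, j) = r (i, 0) + r (0, j)"
  shows measurable_sweep: "(\<lambda>w. sweep w n m) \<in> measurable (expo_product r) (expo_product r)"
    and distr_sweep: "distr (expo_product r) (expo_product r) (\<lambda>w. sweep w n m) = expo_product r"
proof -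
  let ?N = "expo_product r"
  have col: "(\<lambda>w. sweep_column w (Suc i) j) \<in> measurable ?N ?N \<and> distr ?N ?N (\<lambda>w. sweep_column w (Suc i) j) = ?N" for i j
  proof (induction j)
    case 0
    then show ?case by (simp add: distr_id2)
  next
    case (Suc j)
    then have [measurable]: "(\<lambda>w. sweep_column w (Suc i) j) \<in> measurable ?N ?N" by simp
    have "distr ?N ?N (\<lambda>w. sweep_column w (Suc i) (Suc j)) =
        distr (distr ?N ?N (\<lambda>w. sweep_column w (Suc i) j)) ?N (exchange (Suc i, 0) (0, Suc j) (Suc i, Suc j))"
      by (subst distr_distr) (auto simp: comp_def)
    also have "\<dots> = ?N" using Suc by (simp add: distr_exchange r rates)
    finally show ?case by simp
  qed
  have "(\<lambda>w. sweep w n m) \<in> measurable ?N ?N \<and> distr ?N ?N (\<lambda>w. sweep w n m) = ?N"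
  proof (induction m)
    case 0
    then show ?case by (simp add: distr_id2)
  next
    case (Suc m)
    have [measurable]: "(\<lambda>w. sweep w n m) \<in> measurable ?N ?N" "(\<lambda>w. sweep_column w (Suc m) n) \<in> measurable ?N ?N"
      using Suc col by auto
    have "distr ?N ?N (\<lambda>w. sweep w n (Suc m)) = distr (distr ?N ?N (\<lambda>w. sweep w n m)) ?N (\<lambda>w. sweep_column w (Suc m) n)"
      by (subst distr_distr) (auto simp: comp_def)
    then show ?case using Suc col by simp
  qed
  then show "(\<lambda>w. sweep w n m) \<in> measurable ?N ?N" "distr ?N ?N (\<lambda>w. sweep w n m) = ?N" by auto
qed

lemma measurable_lpp [measurable (raw)]:
  assumes "\<And>i j. (\<lambda>x. W x (i, j)) \<in> borel_measurable M"
  shows "(\<lambda>x. lpp (W x) m n) \<in> borel_measurable M"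
proof (induction m n rule: grid_induct)
  case (bulk i j)
  note [measurable] = assms bulk
  show ?case unfolding lpp.simps by measurable
qed (use assms in auto)

lemma nn_integral_expo_moments:
  assumes "r > 0"
  shows "(\<integral>\<^sup>+x. ennreal x \<partial>expo r) = ennreal (1 / r)"
    and "(\<integral>\<^sup>+x. ennreal (x\<^sup>2) \<partial>expo r) = ennreal (2 / r\<^sup>2)"
  using nn_integral_erlang_ith_moment[OF assms, of 0 1] nn_integral_erlang_ith_moment[OF assms, of 0 2]
    erlang_density_nonneg[OF less_imp_le[OF assms], of 0]
  by (auto simp: nn_integral_expo ennreal_mult' fact_numeral)

lemma expo_product_moments:
  assumes r: "\<And>k. r k > 0"
  shows "(\<integral>\<^sup>+w. ennreal (w k) \<partial>expo_product r) = ennreal (1 / r k)"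
    and "(\<integral>\<^sup>+w. ennreal ((w k)\<^sup>2) \<partial>expo_product r) = ennreal (2 / (r k)\<^sup>2)"
proof -
  have d: "distr (expo_product r) (expo (r k)) (\<lambda>w. w k) = expo (r k)"
    by (rule distr_PiM_component) (auto intro: prob_space_expo r)
  have "(\<integral>\<^sup>+w. f (w k) \<partial>expo_product r) = (\<integral>\<^sup>+x. f x \<partial>expo (r k))" if "f \<in> borel_measurable borel" for f
    using that by (subst d[symmetric], subst nn_integral_distr) auto
  from this[of ennreal] this[of "\<lambda>x. ennreal (x\<^sup>2)"]
  show "(\<integral>\<^sup>+w. ennreal (w k) \<partial>expo_product r) = ennreal (1 / r k)"
    and "(\<integral>\<^sup>+w. ennreal ((w k)\<^sup>2) \<partial>expo_product r) = ennreal (2 / (r k)\<^sup>2)"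
    using nn_integral_expo_moments[OF r] by auto
qed

lemma AE_expo_product_nonneg:
  fixes r :: "'i :: countable \<Rightarrow> real"
  assumes "\<And>k. r k > 0"
  shows "AE w in expo_product r. \<forall>k. w k \<ge> 0"
  unfolding AE_all_countable
  by (intro allI AE_PiM_component[where P="\<lambda>x. 0 \<le> x"]) (auto intro: prob_space_expo assms AE_expo_nonneg)

text \<open>
  Both moments only involve the marginal laws of the boundary weights and of the increments along the
  right side, so that the dependence between the two sums is irrelevant.
\<close>

lemma
  assumes r: "\<And>k. r k > 0" and rates: "\<And>i j. i \<ge> 1 \<Longrightarrow> j \<ge> 1 \<Longrightarrow> r (i, j) = r (i, 0) + r (0, j)"
  shows lpp_expectation: "(\<integral>\<^sup>+w. ennreal (lpp w m n) \<partial>expo_product r)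
      = ennreal ((\<Sum>i=1..m. 1 / r (i, 0)) + (\<Sum>j=1..n. 1 / r (0, j)))"
    and lpp_second_moment: "\<rho> > 0 \<Longrightarrow> (\<And>k. k \<ge> 1 \<Longrightarrow> \<rho> \<le> r (k, 0) \<and> \<rho> \<le> r (0, k)) \<Longrightarrow>
      (\<integral>\<^sup>+w. ennreal ((lpp w m n)\<^sup>2) \<partial>expo_product r) \<le> ennreal (4 * (real (m + n))\<^sup>2 / \<rho>\<^sup>2)"
proof -
  let ?N = "expo_product r"
  have S [measurable]: "(\<lambda>w. sweep w n m) \<in> measurable ?N ?N" and D: "distr ?N ?N (\<lambda>w. sweep w n m) = ?N"
    using measurable_sweep distr_sweep r rates by auto
  have swap: "(\<integral>\<^sup>+w. f (sweep w n m) \<partial>?N) = (\<integral>\<^sup>+w. f w \<partial>?N)" if "f \<in> borel_measurable ?N" for f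
    using that by (subst (2) D[symmetric], subst nn_integral_distr) auto
  have nonneg: "AE w in ?N. \<forall>k. w k \<ge> 0" by (rule AE_expo_product_nonneg[OF r])
  have nonneg': "AE w in ?N. \<forall>k. sweep w n m k \<ge> 0"
    using AE_distrD[OF S, of "\<lambda>w. \<forall>k. w k \<ge> 0"] nonneg unfolding D by simp
  note [measurable] = measurable_expo_component
  have comp' [measurable]: "(\<lambda>w. sweep w n m k) \<in> borel_measurable ?N" for k
    using measurable_compose[OF S measurable_expo_component] .
  have "(\<integral>\<^sup>+w. ennreal (lpp w m n) \<partial>?N)
      = (\<integral>\<^sup>+w. (\<Sum>i=1..m. ennreal (w (i, 0))) + (\<Sum>j=1..n. ennreal (sweep w n m (0, j))) \<partial>?N)"
    using nonneg nonneg'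
    by (intro nn_integral_cong_AE) (auto simp: lpp_eq_boundary_plus_sweep sum_nonneg)
  also have "\<dots> = (\<Sum>i=1..m. (\<integral>\<^sup>+w. ennreal (w (i, 0)) \<partial>?N)) + (\<Sum>j=1..n. (\<integral>\<^sup>+w. ennreal (sweep w n m (0, j)) \<partial>?N))"
    by (simp add: nn_integral_add nn_integral_sum)
  also have "\<dots> = ennreal ((\<Sum>i=1..m. 1 / r (i, 0)) + (\<Sum>j=1..n. 1 / r (0, j)))"
    by (simp add: swap[of "\<lambda>w. ennreal (w k)" for k] expo_product_moments r less_imp_le sum_nonneg)
  finally show "(\<integral>\<^sup>+w. ennreal (lpp w m n) \<partial>?N) = \<dots>" .
  assume \<rho>: "\<rho> > 0" and le: "\<And>k. k \<ge> 1 \<Longrightarrow> \<rho> \<le> r (k, 0) \<and> \<rho> \<le> r (0, k)"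
  have sq: "(lpp w m n)\<^sup>2 \<le> 2 * real (m + n) * ((\<Sum>i=1..m. (w (i, 0))\<^sup>2) + (\<Sum>j=1..n. (sweep w n m (0, j))\<^sup>2))" for w
  proof -
    let ?x = "\<Sum>i=1..m. w (i, 0)" and ?y = "\<Sum>j=1..n. sweep w n m (0, j)"
    have "(?x + ?y)\<^sup>2 \<le> 2 * ?x\<^sup>2 + 2 * ?y\<^sup>2"
      using sum_squares_bound[of ?x ?y] by (simp add: power2_sum)
    moreover have "?x\<^sup>2 \<le> real (m + n) * (\<Sum>i=1..m. (w (i, 0))\<^sup>2)"
      by (rule order_trans[OF sum_squared_le_sum_of_squares]) (auto simp: algebra_simps intro!: mult_right_mono sum_nonneg mult_nonneg_nonneg)
    moreover have "?y\<^sup>2 \<le> real (m + n) * (\<Sum>j=1..n. (sweep w n m (0, j))\<^sup>2)"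
      by (rule order_trans[OF sum_squared_le_sum_of_squares]) (auto simp: algebra_simps intro!: mult_right_mono sum_nonneg mult_nonneg_nonneg)
    ultimately show ?thesis unfolding lpp_eq_boundary_plus_sweep by (simp add: algebra_simps)
  qed
  have inv: "2 / (r k)\<^sup>2 \<le> 2 / \<rho>\<^sup>2" if "\<rho> \<le> r k" for k
    using that \<rho> by (intro divide_left_mono power_mono) auto
  have "(\<integral>\<^sup>+w. ennreal ((lpp w m n)\<^sup>2) \<partial>?N) \<le> (\<integral>\<^sup>+w. ennreal (2 * real (m + n)) *
      ((\<Sum>i=1..m. ennreal ((w (i, 0))\<^sup>2)) + (\<Sum>j=1..n. ennreal ((sweep w n m (0, j))\<^sup>2))) \<partial>?N)"
    using sq by (intro nn_integral_mono)
      (simp add: ennreal_mult[symmetric] sum_nonneg ennreal_plus[symmetric] del: ennreal_plus)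
  also have "\<dots> = ennreal (2 * real (m + n)) * ((\<Sum>i=1..m. (\<integral>\<^sup>+w. ennreal ((w (i, 0))\<^sup>2) \<partial>?N))
      + (\<Sum>j=1..n. (\<integral>\<^sup>+w. ennreal ((sweep w n m (0, j))\<^sup>2) \<partial>?N)))"
    by (simp add: nn_integral_add nn_integral_sum nn_integral_cmult del: sum_ennreal)
  also have "\<dots> = ennreal (2 * real (m + n) * ((\<Sum>i=1..m. 2 / (r (i, 0))\<^sup>2) + (\<Sum>j=1..n. 2 / (r (0, j))\<^sup>2)))"
    by (simp add: swap[of "\<lambda>w. ennreal ((w k)\<^sup>2)" for k] expo_product_moments r sum_nonneg ennreal_mult)
  also have "\<dots> \<le> ennreal (2 * real (m + n) * ((\<Sum>i=1..m. 2 / \<rho>\<^sup>2) + (\<Sum>j=1..n. 2 / \<rho>\<^sup>2)))"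
    using le by (intro ennreal_leI mult_left_mono add_mono sum_mono inv) auto
  also have "2 * real (m + n) * ((\<Sum>i=1..m. 2 / \<rho>\<^sup>2) + (\<Sum>j=1..n. 2 / \<rho>\<^sup>2)) = 4 * (real (m + n))\<^sup>2 / \<rho>\<^sup>2"
    by (simp add: power2_eq_square add_divide_distrib[symmetric]) (simp add: algebra_simps)
  finally show "(\<integral>\<^sup>+w. ennreal ((lpp w m n)\<^sup>2) \<partial>?N) \<le> ennreal (4 * (real (m + n))\<^sup>2 / \<rho>\<^sup>2)" .
qed

section \<open>Birkhoff's theorem for bounded functions\<close>

text \<open>
  The maximum of the partial sums of length at most \<open>n\<close>, the empty sum included. Peeling off the first
  term makes it comparable with its own composition with \<open>T\<close>.
\<close>

primrec max_partial_sum :: "('a \<Rightarrow> 'a) \<Rightarrow> ('a \<Rightarrow> real) \<Rightarrow> nat \<Rightarrow> 'a \<Rightarrow> real" where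
  "max_partial_sum T f 0 x = 0"
| "max_partial_sum T f (Suc n) x = max 0 (f x + max_partial_sum T f n (T x))"

definition birkhoff_sum :: "('a \<Rightarrow> 'a) \<Rightarrow> ('a \<Rightarrow> real) \<Rightarrow> nat \<Rightarrow> 'a \<Rightarrow> real" where
  "birkhoff_sum T f n x = (\<Sum>i<n. f ((T ^^ i) x))"

lemma birkhoff_sum_Suc: "birkhoff_sum T f (Suc n) x = f x + birkhoff_sum T f n (T x)"
  by (simp add: birkhoff_sum_def sum.lessThan_Suc_shift funpow_swap1 del: sum.lessThan_Suc)

lemma max_partial_sum_nonneg: "max_partial_sum T f n x \<ge> 0"
  by (cases n) auto

lemma max_partial_sum_Suc_ge: "max_partial_sum T f n x \<le> max_partial_sum T f (Suc n) x"
proof (induction n arbitrary: x)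
  case (Suc n)
  from Suc[of "T x"] show ?case by (simp add: max_def) 
qed simp

lemma birkhoff_sum_le_max: "birkhoff_sum T f n x \<le> max_partial_sum T f n x"
proof (induction n arbitrary: x)
  case (Suc n)
  from Suc[of "T x"] show ?case by (simp add: birkhoff_sum_Suc)
qed (simp add: birkhoff_sum_def)

lemma max_partial_sum_le:
  assumes "\<And>x. x \<in> X \<Longrightarrow> T x \<in> X" and "\<And>x. x \<in> X \<Longrightarrow> \<bar>f x\<bar> \<le> C" and "x \<in> X"
  shows "max_partial_sum T f n x \<le> real n * C"
  using \<open>x \<in> X\<close>
proof (induction n arbitrary: x)
  case (Suc n)
  have "f x \<le> C" "C \<ge> 0" using assms(2)[OF Suc.prems] by auto
  then show ?case using Suc.IH[OF assms(1)[OF Suc.prems]] by (auto simp: algebra_simps)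
qed simp

context prob_space
begin

text \<open>
  Garsia's argument. Let \<open>P\<^sub>n\<close> be the maximal partial sum. Where \<open>P\<^sub>n\<^sub>+\<^sub>1 > 0\<close>, the recursion and monotonicity give
  \<open>f \<ge> P\<^sub>n\<^sub>+\<^sub>1 - P\<^sub>n\<^sub>+\<^sub>1 \<circ> T\<close>, and the integral of the right-hand side over that set is nonnegative by
  invariance. These sets increase to a set of full measure.
\<close>

lemma maximal_ergodic_inequality:
  assumes T: "stationary_under M T" and f [measurable]: "f \<in> borel_measurable M"
    and C: "\<And>x. x \<in> space M \<Longrightarrow> \<bar>f x\<bar> \<le> C"
    and pos: "AE x in M. \<exists>n. birkhoff_sum T f n x > 0"
  shows "(\<integral>x. f x \<partial>M) \<ge> 0"
proof -
  have T_meas [measurable]: "T \<in> measurable M M" and T_inv: "distr M M T = M"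
    using T by (auto simp: stationary_under_def)
  let ?P = "max_partial_sum T f"
  have P [measurable]: "?P n \<in> borel_measurable M" for n
    by (induction n) auto
  have T_space: "x \<in> space M \<Longrightarrow> T x \<in> space M" for x
    using measurable_space[OF T_meas] .
  have bound: "\<bar>?P n x\<bar> \<le> real n * C" if "x \<in> space M" for n x
    using max_partial_sum_le[of "space M" T f C x n] max_partial_sum_nonneg[of T f n x] T_space C that by auto
  have P_int: "integrable M (?P n)" for n
    by (rule integrable_const_bound[where B="real n * C"]) (use bound in auto)
  have f_int: "integrable M f"
    by (rule integrable_const_bound[where B=C]) (use C in auto)
  have PT_int: "integrable M (\<lambda>x. ?P n (T x))" for n
    by (rule integrable_const_bound[where B="real n * C"]) (use bound T_space in auto)
  have le: "(\<integral>x. f x * indicator {x. ?P (Suc n) x > 0} x \<partial>M) \<ge> 0" for n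
  proof -
    have "(\<integral>x. ?P (Suc n) (T x) \<partial>M) = (\<integral>x. ?P (Suc n) x \<partial>M)"
      by (subst (2) T_inv[symmetric], subst integral_distr) auto
    then have "0 = (\<integral>x. ?P (Suc n) x - ?P (Suc n) (T x) \<partial>M)"
      using P_int[of "Suc n"] PT_int[of "Suc n"] by (subst Bochner_Integration.integral_diff) (auto simp del: max_partial_sum.simps)
    also have "\<dots> \<le> (\<integral>x. f x * indicator {x. ?P (Suc n) x > 0} x \<partial>M)"
    proof (rule integral_mono)
      have "{x \<in> space M. ?P (Suc n) x > 0} \<in> sets M" by measurable
      then show "integrable M (\<lambda>x. f x * indicator {x. ?P (Suc n) x > 0} x)"
        by (intro integrable_const_bound[where B="\<bar>C\<bar>"])
          (use C in \<open>fastforce simp: abs_mult indicator_def\<close>, 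
           subst measurable_cong[where g="\<lambda>x. f x * indicator {x \<in> space M. ?P (Suc n) x > 0} x"], auto simp: indicator_def)
      show "integrable M (\<lambda>x. ?P (Suc n) x - ?P (Suc n) (T x))"
        using P_int PT_int by (rule Bochner_Integration.integrable_diff)
      show "?P (Suc n) x - ?P (Suc n) (T x) \<le> f x * indicator {x. ?P (Suc n) x > 0} x" for x
        using max_partial_sum_Suc_ge[of T f n "T x"] max_partial_sum_nonneg[of T f "Suc n" "T x"]
        by (cases "?P (Suc n) x > 0") (auto simp: indicator_def max_def split: if_splits)
    qed
    finally show ?thesis .
  qed
  have mono: "?P m x \<le> ?P n x" if "m \<le> n" for m n x
    using that by (rule lift_Suc_mono_le[rotated]) (rule max_partial_sum_Suc_ge)
  have "(\<lambda>n. \<integral>x. f x * indicator {x. ?P (Suc n) x > 0} x \<partial>M) \<longlonglongrightarrow> (\<integral>x. f x \<partial>M)"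
  proof (rule integral_dominated_convergence[where w="\<lambda>_. \<bar>C\<bar>"])
    show "AE x in M. (\<lambda>n. f x * indicator {x. ?P (Suc n) x > 0} x) \<longlonglongrightarrow> f x"
      using pos
    proof eventually_elim
      case (elim x)
      then obtain m where "birkhoff_sum T f m x > 0" by blast
      then have "?P m x > 0" using birkhoff_sum_le_max[of T f m x] by linarith
      then have "\<forall>\<^sub>F n in sequentially. f x * indicator {x. ?P (Suc n) x > 0} x = f x"
        using mono[of m] by (intro eventually_sequentiallyI[of m]) (auto simp: indicator_def less_le_trans simp del: max_partial_sum.simps)
      then show ?case by (rule tendsto_eventually)
    qed
    show "(\<lambda>x. f x * indicator {x. ?P (Suc n) x > 0} x) \<in> borel_measurable M" for n
    proof -
      have "{x \<in> space M. ?P (Suc n) x > 0} \<in> sets M" by measurable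
      then show ?thesis
        by (subst measurable_cong[where g="\<lambda>x. f x * indicator {x \<in> space M. ?P (Suc n) x > 0} x"]) (auto simp: indicator_def)
    qed
    show "AE x in M. norm (f x * indicator {x. ?P (Suc n) x > 0} x) \<le> \<bar>C\<bar>" for n
      using C by (intro AE_I2) (fastforce simp: indicator_def)
  qed auto
  then show ?thesis by (rule LIMSEQ_le_const) (use le in auto)
qed

text \<open>
  The upper limit \<open>L\<close> of the averages of a bounded function is strictly invariant, so by ergodicity \<open>L > c\<close> has
  probability zero or one. Probability one is impossible for \<open>c\<close> above the mean, by the maximal inequality
  for \<open>f - c\<close>.
\<close>

lemma birkhoff_limsup_le:
  assumes erg: "ergodic_under M T" and f [measurable]: "f \<in> borel_measurable M"
    and C: "\<And>x. x \<in> space M \<Longrightarrow> \<bar>f x\<bar> \<le> C"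
  shows "AE x in M. limsup (\<lambda>n. ereal (birkhoff_sum T f n x / real n)) \<le> ereal (\<integral>x. f x \<partial>M)"
proof -
  have st: "stationary_under M T" using erg by (simp add: ergodic_under_def)
  then have T_meas [measurable]: "T \<in> measurable M M" by (simp add: stationary_under_def)
  have T_space: "x \<in> space M \<Longrightarrow> T x \<in> space M" for x
    using measurable_space[OF T_meas] .
  have pow [measurable]: "(T ^^ i) \<in> measurable M M" for i
    by (induction i) auto
  have S [measurable]: "birkhoff_sum T f n \<in> borel_measurable M" for n
    unfolding birkhoff_sum_def by measurable
  define L where "L x = limsup (\<lambda>n. ereal (birkhoff_sum T f n x / real n))" for x
  have L [measurable]: "L \<in> borel_measurable M"
    unfolding L_def by measurable
  have L_inv: "L (T x) = L x" if x: "x \<in> space M" for x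
  proof -
    have diff: "\<bar>birkhoff_sum T f n (T x) - birkhoff_sum T f n x\<bar> \<le> 2 * C" for n
    proof -
      have "(T ^^ n) x \<in> space M" using measurable_space[OF pow x] .
      moreover have "birkhoff_sum T f n (T x) - birkhoff_sum T f n x = f ((T ^^ n) x) - f x"
        using birkhoff_sum_Suc[of T f n x] by (simp add: birkhoff_sum_def)
      ultimately show ?thesis using C[of x] C[of "(T ^^ n) x"] x by linarith
    qed
    have "(\<lambda>n. (birkhoff_sum T f n (T x) - birkhoff_sum T f n x) / real n) \<longlonglongrightarrow> 0"
    proof (rule Lim_null_comparison)
      show "\<forall>\<^sub>F n in sequentially. norm ((birkhoff_sum T f n (T x) - birkhoff_sum T f n x) / real n) \<le> 2 * C / real n"
        using diff by (intro always_eventually) (auto simp: divide_right_mono)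
    qed real_asymp
    then have "(\<lambda>n. ereal ((birkhoff_sum T f n (T x) - birkhoff_sum T f n x) / real n)) \<longlonglongrightarrow> ereal 0"
      by simp
    from ereal_limsup_lim_add[OF this, of "\<lambda>n. ereal (birkhoff_sum T f n x / real n)"]
    show ?thesis unfolding L_def by (simp add: diff_divide_distrib)
  qed
  have step: "AE x in M. L x \<le> ereal ((\<integral>x. f x \<partial>M) + e)" if "e > 0" for e
  proof -
    define c where "c = (\<integral>x. f x \<partial>M) + e"
    define A where "A = {x \<in> space M. L x > ereal c}"
    have A [measurable]: "A \<in> sets M" unfolding A_def by measurable
    have "T -` A \<inter> space M = A" unfolding A_def using L_inv T_space by auto
    then have "emeasure M A = 0 \<or> emeasure M A = 1"
      using erg A unfolding ergodic_under_def by blast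
    moreover have "emeasure M A \<noteq> 1"
    proof
      assume "emeasure M A = 1"
      then have "AE x in M. x \<in> A" by (simp add: emeasure_eq_measure AE_in_set_eq_1)
      then have "AE x in M. \<exists>n. birkhoff_sum T (\<lambda>x. f x - c) n x > 0"
      proof eventually_elim
        case (elim x)
        then have "ereal c < limsup (\<lambda>n. ereal (birkhoff_sum T f n x / real n))" by (simp add: A_def L_def)
        then have "\<exists>\<^sub>F n in sequentially. ereal c < ereal (birkhoff_sum T f n x / real n)"
          unfolding frequently_def using Limsup_bounded[of "\<lambda>n. ereal (birkhoff_sum T f n x / real n)" "ereal c" sequentially]
          by (auto simp: not_less)
        then obtain n where n: "n \<ge> 1" "c < birkhoff_sum T f n x / real n"
          unfolding frequently_sequentially by (metis less_ereal.simps(1))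
        then have "birkhoff_sum T (\<lambda>x. f x - c) n x > 0"
          by (simp add: birkhoff_sum_def sum_subtractf field_simps)
        then show ?case ..
      qed
      moreover have "\<bar>f x - c\<bar> \<le> C + \<bar>c\<bar>" if "x \<in> space M" for x
        using C[OF that] by linarith
      ultimately have "(\<integral>x. f x - c \<partial>M) \<ge> 0"
        by (intro maximal_ergodic_inequality[OF st, where C="C + \<bar>c\<bar>"]) auto
      moreover have "integrable M f"
        by (rule integrable_const_bound[where B=C]) (use C in auto)
      ultimately show False using \<open>e > 0\<close> by (simp add: c_def prob_space)
    qed
    ultimately have "A \<in> null_sets M" by auto
    then have "AE x in M. x \<notin> A" by (rule AE_not_in)
    with AE_space show ?thesis by eventually_elim (auto simp: A_def c_def not_less)
  qed
  have "AE x in M. \<forall>k. L x \<le> ereal ((\<integral>x. f x \<partial>M) + 1 / real (Suc k))"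
    unfolding AE_all_countable using step by auto
  then show ?thesis
  proof eventually_elim
    case (elim x)
    have "(\<lambda>k. ereal ((\<integral>x. f x \<partial>M) + 1 / real (Suc k))) \<longlonglongrightarrow> ereal (\<integral>x. f x \<partial>M)"
      using LIMSEQ_inverse_real_of_nat_add[of "\<integral>x. f x \<partial>M"] by (simp add: inverse_eq_divide)
    then show ?case unfolding L_def[symmetric] by (rule LIMSEQ_le_const) (use elim in auto)
  qed
qed

theorem birkhoff_bounded:
  assumes erg: "ergodic_under M T" and f [measurable]: "f \<in> borel_measurable M"
    and C: "\<And>x. x \<in> space M \<Longrightarrow> \<bar>f x\<bar> \<le> C"
  shows "AE x in M. (\<lambda>n. birkhoff_sum T f n x / real n) \<longlonglongrightarrow> (\<integral>x. f x \<partial>M)"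
proof -
  have "AE x in M. limsup (\<lambda>n. ereal (birkhoff_sum T (\<lambda>x. - f x) n x / real n)) \<le> ereal (\<integral>x. - f x \<partial>M)"
    using birkhoff_limsup_le[OF erg, of "\<lambda>x. - f x" C] C by auto
  moreover have "AE x in M. limsup (\<lambda>n. ereal (birkhoff_sum T f n x / real n)) \<le> ereal (\<integral>x. f x \<partial>M)"
    by (rule birkhoff_limsup_le[OF erg f C])
  ultimately show ?thesis
  proof eventually_elim
    case (elim x)
    let ?u = "\<lambda>n. birkhoff_sum T f n x / real n"
    have "limsup (\<lambda>n. - ereal (?u n)) \<le> - ereal (\<integral>x. f x \<partial>M)"
      using elim(1) by (simp add: birkhoff_sum_def sum_negf)
    then have "ereal (\<integral>x. f x \<partial>M) \<le> liminf (\<lambda>n. ereal (?u n))"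
      unfolding ereal_Limsup_uminus ereal_minus_le_minus .
    with elim(2) show ?case by (intro limsup_le_liminf_real)
  qed
qed

end

section \<open>Products of exponential laws and convergence in probability\<close>

lemma expo_moments:
  assumes "r > 0"
  shows "integrable (expo r) (\<lambda>x. x)" "(\<integral>x. x \<partial>expo r) = 1 / r"
    "integrable (expo r) (\<lambda>x. x\<^sup>2)" "(\<integral>x. x\<^sup>2 \<partial>expo r) = 2 / r\<^sup>2"
proof -
  show "integrable (expo r) (\<lambda>x. x)" "integrable (expo r) (\<lambda>x. x\<^sup>2)"
    using nn_integral_expo_moments[OF assms] AE_expo_nonneg by (auto intro!: integrableI_nonneg)
  show "(\<integral>x. x \<partial>expo r) = 1 / r" "(\<integral>x. x\<^sup>2 \<partial>expo r) = 2 / r\<^sup>2"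
    using nn_integral_expo_moments[OF assms] AE_expo_nonneg assms
    by (auto simp: integral_eq_nn_integral)
qed

lemma distr_expo_scale:
  assumes r: "r > 0"
  shows "distr (expo 1) (expo r) (\<lambda>x. x / r) = expo r"
proof (rule measure_eqI)
  fix A assume "A \<in> sets (distr (expo 1) (expo r) (\<lambda>x. x / r))"
  then have A [measurable]: "A \<in> sets borel" by simp
  let ?f = "indicator A :: real \<Rightarrow> ennreal"
  have "emeasure (distr (expo 1) (expo r) (\<lambda>x. x / r)) A = (\<integral>\<^sup>+x. ?f (x / r) \<partial>expo 1)"
    by (subst nn_integral_indicator[symmetric], simp, subst nn_integral_distr) auto
  also have "\<dots> = (\<integral>\<^sup>+x. ennreal (exponential_density 1 x) * ?f (x / r) \<partial>lborel)"
    by (rule nn_integral_expo) measurable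
  also have "\<dots> = ennreal \<bar>r\<bar> * (\<integral>\<^sup>+x. ennreal (exponential_density 1 (0 + r * x)) * ?f ((0 + r * x) / r) \<partial>lborel)"
    using r by (intro nn_integral_real_affine) auto
  also have "\<dots> = (\<integral>\<^sup>+x. ennreal \<bar>r\<bar> * (ennreal (exponential_density 1 (0 + r * x)) * ?f ((0 + r * x) / r)) \<partial>lborel)"
    by (rule nn_integral_cmult[symmetric]) measurable
  also have "\<dots> = (\<integral>\<^sup>+x. ennreal (exponential_density r x) * ?f x \<partial>lborel)"
    using r by (intro nn_integral_cong)
      (auto simp: exponential_density_def ennreal_mult'[symmetric] mult.assoc[symmetric] mult_less_0_iff mult.commute)
  also have "\<dots> = (\<integral>\<^sup>+x. ?f x \<partial>expo r)"
    by (rule nn_integral_expo[symmetric]) measurable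
  also have "\<dots> = emeasure (expo r) A" by simp
  finally show "emeasure (distr (expo 1) (expo r) (\<lambda>x. x / r)) A = emeasure (expo r) A" .
qed simp

text \<open>
  Selecting coordinates of a product along an injection \<open>\<pi>\<close> and transforming each of them separately. It
  covers restriction to fewer coordinates, translation of the index set, and rescaling.
\<close>

lemma distr_PiM_transform:
  assumes M: "\<And>i. i \<in> K \<Longrightarrow> prob_space (M i)"
    and \<pi>: "inj_on \<pi> J" "\<pi> \<in> J \<rightarrow> K"
    and f: "\<And>j. j \<in> J \<Longrightarrow> f j \<in> measurable (M (\<pi> j)) (M' j)"
    and f_distr: "\<And>j. j \<in> J \<Longrightarrow> distr (M (\<pi> j)) (M' j) (f j) = M' j"
  shows "(\<lambda>u. \<lambda>j\<in>J. f j (u (\<pi> j))) \<in> measurable (PiM K M) (PiM J M')"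
    and "distr (PiM K M) (PiM J M') (\<lambda>u. \<lambda>j\<in>J. f j (u (\<pi> j))) = PiM J M'"
proof -
  let ?t = "\<lambda>u. \<lambda>j\<in>J. f j (u (\<pi> j))"
  show t [measurable]: "?t \<in> measurable (PiM K M) (PiM J M')"
  proof (rule measurable_restrict)
    fix j assume j: "j \<in> J"
    then have "\<pi> j \<in> K" using \<pi>(2) by auto
    from measurable_compose[OF measurable_component_singleton[OF this, of M] f[OF j]]
    show "(\<lambda>u. f j (u (\<pi> j))) \<in> measurable (PiM K M) (M' j)" .
  qed
  have M': "prob_space (M' j)" if "j \<in> J" for j
    using prob_space.prob_space_distr[OF M f[OF that]] f_distr[OF that] \<pi>(2) that by auto
  show "distr (PiM K M) (PiM J M') ?t = PiM J M'"
  proof (rule measure_eqI_PiM_infinite[symmetric, OF refl])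
    interpret prob_space "PiM J M'" using M' by (rule prob_space_PiM)
    show "finite_measure (PiM J M')" by unfold_locales
    fix A L assume L: "finite L" "L \<subseteq> J" and A: "\<And>i. i \<in> L \<Longrightarrow> A i \<in> sets (M' i)"
    have inv [simp]: "i \<in> L \<Longrightarrow> the_inv_into J \<pi> (\<pi> i) = i" for i
      using L \<pi> by (intro the_inv_into_f_f) auto
    define B where "B k = (let j = the_inv_into J \<pi> k in f j -` A j \<inter> space (M k))" for k
    have B: "B (\<pi> j) = f j -` A j \<inter> space (M (\<pi> j))" if "j \<in> L" for j
      using that by (simp add: B_def Let_def)
    have B_sets: "B (\<pi> j) \<in> sets (M (\<pi> j))" if "j \<in> L" for j
      unfolding B[OF that] using measurable_sets[OF f A] that L by auto
    have "PiM J M' (prod_emb J M' L (Pi\<^sub>E L A)) = (\<Prod>j\<in>L. M' j (A j))"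
      using L A by (intro emeasure_PiM_emb M') auto
    also have "\<dots> = (\<Prod>j\<in>L. M (\<pi> j) (B (\<pi> j)))"
    proof (intro prod.cong refl)
      fix j assume j: "j \<in> L"
      then have "emeasure (M' j) (A j) = emeasure (distr (M (\<pi> j)) (M' j) (f j)) (A j)"
        using f_distr L by auto
      also have "\<dots> = M (\<pi> j) (B (\<pi> j))"
        unfolding B[OF j] using j L A f by (intro emeasure_distr) auto
      finally show "emeasure (M' j) (A j) = M (\<pi> j) (B (\<pi> j))" .
    qed
    also have "\<dots> = (\<Prod>k\<in>\<pi> ` L. M k (B k))"
      using \<pi> L by (subst prod.reindex) (auto intro: inj_on_subset)
    also have "\<dots> = PiM K M (prod_emb K M (\<pi> ` L) (Pi\<^sub>E (\<pi> ` L) B))"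
      using \<pi> L B_sets by (intro emeasure_PiM_emb[symmetric] M) auto
    also have "prod_emb K M (\<pi> ` L) (Pi\<^sub>E (\<pi> ` L) B) = ?t -` prod_emb J M' L (Pi\<^sub>E L A) \<inter> space (PiM K M)"
    proof (rule set_eqI)
      fix u
      have "u \<in> prod_emb K M (\<pi> ` L) (Pi\<^sub>E (\<pi> ` L) B) \<longleftrightarrow> u \<in> space (PiM K M) \<and> (\<forall>j\<in>L. u (\<pi> j) \<in> B (\<pi> j))"
        by (auto simp: prod_emb_def space_PiM)
      also have "\<dots> \<longleftrightarrow> u \<in> space (PiM K M) \<and> (\<forall>j\<in>L. f j (u (\<pi> j)) \<in> A j)"
      proof (intro conj_cong refl ball_cong)
        fix j assume u: "u \<in> space (PiM K M)" and j: "j \<in> L"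
        then have "u (\<pi> j) \<in> space (M (\<pi> j))" using L \<pi>(2) by (auto simp: space_PiM)
        then show "u (\<pi> j) \<in> B (\<pi> j) \<longleftrightarrow> f j (u (\<pi> j)) \<in> A j" by (simp add: B[OF j])
      qed
      also have "\<dots> \<longleftrightarrow> u \<in> ?t -` prod_emb J M' L (Pi\<^sub>E L A) \<inter> space (PiM K M)"
      proof -
        have "?t u \<in> (\<Pi>\<^sub>E i\<in>J. space (M' i))" if "u \<in> space (PiM K M)"
          using measurable_space[OF t that] by (simp add: space_PiM)
        moreover have "J \<inter> L = L" using L by auto
        ultimately show ?thesis by (auto simp: prod_emb_def)
      qed
      finally show "u \<in> prod_emb K M (\<pi> ` L) (Pi\<^sub>E (\<pi> ` L) B)
        \<longleftrightarrow> u \<in> ?t -` prod_emb J M' L (Pi\<^sub>E L A) \<inter> space (PiM K M)" .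
    qed
    also have "PiM K M \<dots> = distr (PiM K M) (PiM J M') ?t (prod_emb J M' L (Pi\<^sub>E L A))"
      using L A by (intro emeasure_distr[symmetric] t sets_PiM_I) auto
    finally show "PiM J M' (prod_emb J M' L (Pi\<^sub>E L A)) = distr (PiM K M) (PiM J M') ?t (prod_emb J M' L (Pi\<^sub>E L A))" .
  qed simp
qed

lemma nn_integral_expo_affine_square:
  "(\<integral>\<^sup>+x. ennreal ((u + (x - 1) * c)\<^sup>2) \<partial>expo 1) = ennreal (u\<^sup>2 + c\<^sup>2)"
proof -
  interpret prob_space "expo 1" by (rule prob_space_expo) simp
  note int = expo_moments[of 1, simplified]
  have eq: "(u + (x - 1) * c)\<^sup>2 = (u - c)\<^sup>2 + 2 * (u - c) * c * x + c\<^sup>2 * x\<^sup>2" for x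
    by (simp add: power2_eq_square algebra_simps)
  have i: "integrable (expo 1) (\<lambda>x. (u + (x - 1) * c)\<^sup>2)"
    unfolding eq by (intro Bochner_Integration.integrable_add integrable_mult_right int integrable_const)
  have "(\<integral>x. (u + (x - 1) * c)\<^sup>2 \<partial>expo 1) = (u - c)\<^sup>2 + 2 * (u - c) * c * 1 + c\<^sup>2 * 2"
    unfolding eq using int prob_space by (simp add: Bochner_Integration.integral_add)
  also have "\<dots> = u\<^sup>2 + c\<^sup>2" by (simp add: power2_eq_square algebra_simps)
  finally show ?thesis using nn_integral_eq_integral[OF i] by simp
qed

text \<open>
  Orthogonality of centred independent variables; resampling the last coordinate exposes its
  contribution.
\<close>

lemma expo_centred_sum_second_moment:
  fixes \<iota> :: "nat \<Rightarrow> 'i"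
  assumes \<iota>: "inj \<iota>"
  shows "(\<integral>\<^sup>+e. ennreal ((\<Sum>i<k. (e (\<iota> i) - 1) * c i)\<^sup>2) \<partial>expo_product (\<lambda>_ :: 'i. 1)) = ennreal (\<Sum>i<k. (c i)\<^sup>2)"
proof (induction k)
  case (Suc k)
  let ?N = "expo_product (\<lambda>_ :: 'i. 1)"
  let ?S = "\<lambda>k e. \<Sum>i<k. (e (\<iota> i) - 1) * c i"
  interpret prob_space "expo 1" by (rule prob_space_expo) simp
  note [measurable] = measurable_expo_component
  have S_upd: "?S k (e(\<iota> k := x)) = ?S k e" for e x
    using \<iota> by (intro sum.cong) (auto simp: inj_def)
  have "(\<integral>\<^sup>+e. ennreal ((?S (Suc k) e)\<^sup>2) \<partial>?N) = (\<integral>\<^sup>+e. \<integral>\<^sup>+x. ennreal ((?S (Suc k) (e(\<iota> k := x)))\<^sup>2) \<partial>expo 1 \<partial>?N)"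
    by (rule nn_integral_resample) (auto intro: prob_space_expo)
  also have "\<dots> = (\<integral>\<^sup>+e. \<integral>\<^sup>+x. ennreal ((?S k e + (x - 1) * c k)\<^sup>2) \<partial>expo 1 \<partial>?N)"
    by (simp only: sum.lessThan_Suc S_upd fun_upd_same)
  also have "\<dots> = (\<integral>\<^sup>+e. ennreal ((?S k e)\<^sup>2) + ennreal ((c k)\<^sup>2) \<partial>?N)"
    by (simp add: nn_integral_expo_affine_square)
  also have "\<dots> = (\<integral>\<^sup>+e. ennreal ((?S k e)\<^sup>2) \<partial>?N) + ennreal ((c k)\<^sup>2)"
    using prob_space.emeasure_space_1[OF prob_space_expo_product[of "\<lambda>_ :: 'i. 1"]] by (simp add: nn_integral_add)
  also have "\<dots> = ennreal (\<Sum>i<Suc k. (c i)\<^sup>2)"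
    by (simp add: Suc.IH sum_nonneg del: sum_ennreal)
  finally show ?case .
qed simp

context prob_space
begin

definition tends_prob :: "(nat \<Rightarrow> 'a \<Rightarrow> real) \<Rightarrow> real \<Rightarrow> bool" where
  "tends_prob X c \<longleftrightarrow> (\<forall>n. X n \<in> borel_measurable M) \<and>
     (\<forall>e>0. (\<lambda>n. prob {x \<in> space M. e < \<bar>X n x - c\<bar>}) \<longlonglongrightarrow> 0)"

lemma tends_prob_measurable: "tends_prob X c \<Longrightarrow> X n \<in> borel_measurable M"
  by (simp add: tends_prob_def)

lemma tends_prob_AE:
  assumes X [measurable]: "\<And>n. X n \<in> borel_measurable M" and lim: "AE x in M. (\<lambda>n. X n x) \<longlonglongrightarrow> c"
  shows "tends_prob X c"
  unfolding tends_prob_def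
proof (intro conjI allI impI X)
  fix e :: real assume e: "e > 0"
  let ?A = "\<lambda>n. {x \<in> space M. e < \<bar>X n x - c\<bar>}"
  have "(\<lambda>n. \<integral>x. (indicator (?A n) x :: real) \<partial>M) \<longlonglongrightarrow> (\<integral>x. 0 \<partial>M)"
  proof (rule integral_dominated_convergence[where w="\<lambda>_. 1"])
    show "AE x in M. (\<lambda>n. indicator (?A n) x :: real) \<longlonglongrightarrow> 0"
      using lim
    proof eventually_elim
      case (elim x)
      then have "\<forall>\<^sub>F n in sequentially. dist (X n x) c < e" using e by (rule tendstoD)
      then have "\<forall>\<^sub>F n in sequentially. indicator (?A n) x = (0 :: real)"
        by eventually_elim (auto simp: dist_real_def)
      then show ?case by (rule tendsto_eventually)
    qed
  qed (auto simp: indicator_def)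
  then show "(\<lambda>n. prob (?A n)) \<longlonglongrightarrow> 0" by simp
qed

lemma tends_prob_add:
  assumes X: "tends_prob X c" and Y: "tends_prob Y d"
  shows "tends_prob (\<lambda>n x. X n x + Y n x) (c + d)"
  unfolding tends_prob_def
proof (intro conjI allI impI)
  note [measurable] = tends_prob_measurable[OF X] tends_prob_measurable[OF Y]
  show "(\<lambda>x. X n x + Y n x) \<in> borel_measurable M" for n by measurable
  fix e :: real assume e: "e > 0"
  let ?A = "\<lambda>n. {x \<in> space M. e / 2 < \<bar>X n x - c\<bar>}" and ?B = "\<lambda>n. {x \<in> space M. e / 2 < \<bar>Y n x - d\<bar>}"
  show "(\<lambda>n. prob {x \<in> space M. e < \<bar>X n x + Y n x - (c + d)\<bar>}) \<longlonglongrightarrow> 0"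
  proof (rule Lim_null_comparison)
    show "\<forall>\<^sub>F n in sequentially. norm (prob {x \<in> space M. e < \<bar>X n x + Y n x - (c + d)\<bar>}) \<le> prob (?A n) + prob (?B n)"
    proof (intro always_eventually allI)
      fix n
      have "prob {x \<in> space M. e < \<bar>X n x + Y n x - (c + d)\<bar>} \<le> prob (?A n \<union> ?B n)"
      proof (rule finite_measure_mono)
        show "{x \<in> space M. e < \<bar>X n x + Y n x - (c + d)\<bar>} \<subseteq> ?A n \<union> ?B n"
        proof
          fix x assume x: "x \<in> {x \<in> space M. e < \<bar>X n x + Y n x - (c + d)\<bar>}"
          then have "e / 2 < \<bar>X n x - c\<bar> \<or> e / 2 < \<bar>Y n x - d\<bar>"
            unfolding mem_Collect_eq by linarith
          with x show "x \<in> ?A n \<union> ?B n" by blast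
        qed
      qed auto
      also have "\<dots> \<le> prob (?A n) + prob (?B n)" by (intro measure_Un_le) auto
      finally show "norm (prob {x \<in> space M. e < \<bar>X n x + Y n x - (c + d)\<bar>}) \<le> prob (?A n) + prob (?B n)" by simp
    qed
    show "(\<lambda>n. prob (?A n) + prob (?B n)) \<longlonglongrightarrow> 0"
      by (intro tendsto_add_zero X[unfolded tends_prob_def, THEN conjunct2, rule_format, OF half_gt_zero[OF e]]
        Y[unfolded tends_prob_def, THEN conjunct2, rule_format, OF half_gt_zero[OF e]])
  qed
qed

lemma tends_prob_cong_AE:
  assumes X: "tends_prob X c" and Y [measurable]: "\<And>n. Y n \<in> borel_measurable M"
    and eq: "\<And>n. AE x in M. X n x = Y n x"
  shows "tends_prob Y c"
  unfolding tends_prob_def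
proof (intro conjI allI impI Y)
  note [measurable] = tends_prob_measurable[OF X]
  fix e :: real assume e: "e > 0"
  have "prob {x \<in> space M. e < \<bar>X n x - c\<bar>} = prob {x \<in> space M. e < \<bar>Y n x - c\<bar>}" for n
    by (rule finite_measure_eq_AE) (use eq[of n] in \<open>auto elim!: eventually_mono\<close>)
  then show "(\<lambda>n. prob {x \<in> space M. e < \<bar>Y n x - c\<bar>}) \<longlonglongrightarrow> 0"
    using X[unfolded tends_prob_def, THEN conjunct2, rule_format, OF e] by (simp only:)
qed

text \<open>
  An inequality between two sequences on one event of positive probability suffices, because the limits
  are constants.
\<close>

lemma tends_prob_le_on_event:
  assumes X: "tends_prob X c" and Y: "tends_prob Y d"
    and E [measurable]: "E \<in> events" and E_pos: "prob E > 0"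
    and le: "\<forall>\<^sub>F n in sequentially. AE x in M. x \<in> E \<longrightarrow> X n x \<le> Y n x"
  shows "c \<le> d"
proof (rule ccontr)
  note [measurable] = tends_prob_measurable[OF X] tends_prob_measurable[OF Y]
  assume "\<not> c \<le> d"
  define e where "e = (c - d) / 3"
  have e: "e > 0" using \<open>\<not> c \<le> d\<close> by (simp add: e_def)
  let ?A = "\<lambda>n. {x \<in> space M. e < \<bar>X n x - c\<bar>}" and ?B = "\<lambda>n. {x \<in> space M. e < \<bar>Y n x - d\<bar>}"
  have "\<forall>\<^sub>F n in sequentially. prob E \<le> prob (?A n) + prob (?B n)"
    using le
  proof eventually_elim
    case (elim n)
    have "prob E \<le> prob (?A n \<union> ?B n)"
    proof (rule finite_measure_mono_AE)
      show "AE x in M. x \<in> E \<longrightarrow> x \<in> ?A n \<union> ?B n"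
        using elim AE_space
      proof eventually_elim
        case (elim x)
        show ?case
        proof
          assume "x \<in> E"
          then have "X n x \<le> Y n x" using elim by simp
          moreover have "3 * e = c - d" by (simp add: e_def)
          ultimately have "e < \<bar>X n x - c\<bar> \<or> e < \<bar>Y n x - d\<bar>"
            using e by linarith
          then show "x \<in> ?A n \<union> ?B n" using elim by blast
        qed
      qed
    qed measurable
    also have "\<dots> \<le> prob (?A n) + prob (?B n)" by (intro measure_Un_le) auto
    finally show ?case .
  qed
  moreover have "(\<lambda>n. prob (?A n) + prob (?B n)) \<longlonglongrightarrow> 0"
    by (intro tendsto_add_zero X[unfolded tends_prob_def, THEN conjunct2, rule_format, OF e]
        Y[unfolded tends_prob_def, THEN conjunct2, rule_format, OF e])
  ultimately have "prob E \<le> 0" by (intro tendsto_lowerbound) auto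
  with E_pos show False by simp
qed

lemma tends_prob_second_moment:
  assumes X [measurable]: "\<And>n. X n \<in> borel_measurable M"
    and le: "\<And>n. (\<integral>\<^sup>+x. ennreal ((X n x)\<^sup>2) \<partial>M) \<le> ennreal (b n)" and b: "b \<longlonglongrightarrow> 0" "\<And>n. b n \<ge> 0"
  shows "tends_prob X 0"
  unfolding tends_prob_def
proof (intro conjI allI impI X)
  fix e :: real assume e: "e > 0"
  show "(\<lambda>n. prob {x \<in> space M. e < \<bar>X n x - 0\<bar>}) \<longlonglongrightarrow> 0"
  proof (rule Lim_null_comparison)
    show "\<forall>\<^sub>F n in sequentially. norm (prob {x \<in> space M. e < \<bar>X n x - 0\<bar>}) \<le> b n / e\<^sup>2"
    proof (intro always_eventually allI)
      fix n
      let ?A = "{x \<in> space M. e < \<bar>X n x - 0\<bar>}"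
      have "ennreal (e\<^sup>2 * prob ?A) = (\<integral>\<^sup>+x. ennreal (e\<^sup>2) * indicator ?A x \<partial>M)"
        by (simp add: nn_integral_cmult_indicator emeasure_eq_measure ennreal_mult)
      also have "\<dots> \<le> (\<integral>\<^sup>+x. ennreal ((X n x)\<^sup>2) \<partial>M)"
        using e by (intro nn_integral_mono) (auto simp: indicator_def intro!: ennreal_leI abs_le_square_iff[THEN iffD1])
      also have "\<dots> \<le> ennreal (b n)" by (rule le)
      finally have "e\<^sup>2 * prob ?A \<le> b n" using b by simp
      then show "norm (prob ?A) \<le> b n / e\<^sup>2" using e by (simp add: pos_le_divide_eq mult.commute)
    qed
    show "(\<lambda>n. b n / e\<^sup>2) \<longlonglongrightarrow> 0" using tendsto_divide_zero[OF b(1)] .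
  qed
qed

text \<open>
  Bounded second moments make the sequence uniformly integrable, so that its mean cannot exceed an
  asymptotic bound in probability. The inequality used is
  \<open>X \<le> c + K \<cdot> 1(X > c) + X\<^sup>2 / K\<close>, which avoids the Cauchy-Schwarz inequality.
\<close>

lemma mean_limit_le:
  assumes X: "\<And>n. X n \<in> borel_measurable M" "\<And>n. AE x in M. X n x \<ge> 0"
    and second: "\<And>n. (\<integral>\<^sup>+x. ennreal ((X n x)\<^sup>2) \<partial>M) \<le> ennreal C"
    and mean: "\<And>n. (\<integral>\<^sup>+x. ennreal (X n x) \<partial>M) = ennreal (m n)" "m \<longlonglongrightarrow> l" "\<And>n. m n \<ge> 0"
    and upper: "(\<lambda>n. prob {x \<in> space M. c < X n x}) \<longlonglongrightarrow> 0" and "c \<ge> 0" "C \<ge> 0"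
  shows "l \<le> c"
proof (rule field_le_epsilon)
  note [measurable] = X(1)
  fix e :: real assume e: "e > 0"
  define K where "K = C / e + 1"
  have K: "K > 0" "C / K \<le> e" using e \<open>C \<ge> 0\<close> by (auto simp: K_def field_simps add_pos_nonneg intro!: add_nonneg_pos)
  let ?A = "\<lambda>n. {x \<in> space M. c < X n x}"
  have "m n \<le> c + K * prob (?A n) + C / K" for n
  proof -
    have "ennreal (m n) = (\<integral>\<^sup>+x. ennreal (X n x) \<partial>M)" by (simp add: mean)
    also have "\<dots> \<le> (\<integral>\<^sup>+x. (ennreal c + ennreal K * indicator (?A n) x) + ennreal (1 / K) * ennreal ((X n x)\<^sup>2) \<partial>M)"
    proof (rule nn_integral_mono_AE)
      show "AE x in M. ennreal (X n x) \<le> (ennreal c + ennreal K * indicator (?A n) x) + ennreal (1 / K) * ennreal ((X n x)\<^sup>2)"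
        using X(2)[of n] AE_space
      proof eventually_elim
        case (elim x)
        have "X n x \<le> K + 1 / K * (X n x)\<^sup>2"
        proof -
          have "2 * K * X n x \<le> K\<^sup>2 + (X n x)\<^sup>2" using sum_squares_bound[of K "X n x"] by simp
          moreover have "K * X n x \<le> 2 * K * X n x" using K elim by simp
          ultimately have "K * X n x \<le> K\<^sup>2 + (X n x)\<^sup>2" by linarith
          then show ?thesis using K by (simp add: field_simps power2_eq_square)
        qed
        moreover have "0 \<le> 1 / K * (X n x)\<^sup>2" using K by simp
        ultimately have "X n x \<le> c + K * indicator (?A n) x + 1 / K * (X n x)\<^sup>2"
          using elim \<open>c \<ge> 0\<close> by (cases "c < X n x") (auto simp: indicator_def)
        then have "ennreal (X n x) \<le> ennreal (c + K * indicator (?A n) x + 1 / K * (X n x)\<^sup>2)"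
          by (rule ennreal_leI)
        also have "\<dots> = (ennreal c + ennreal K * indicator (?A n) x) + ennreal (1 / K) * ennreal ((X n x)\<^sup>2)"
          using K \<open>c \<ge> 0\<close> by (subst ennreal_mult'[symmetric], simp) (auto simp: indicator_def ennreal_plus[symmetric] simp del: ennreal_plus)
        finally show ?case .
      qed
    qed
    also have "\<dots> = ennreal c + ennreal K * emeasure M (?A n) + ennreal (1 / K) * (\<integral>\<^sup>+x. ennreal ((X n x)\<^sup>2) \<partial>M)"
      by (simp add: nn_integral_add nn_integral_cmult emeasure_space_1)
    also have "\<dots> \<le> ennreal c + ennreal K * emeasure M (?A n) + ennreal (1 / K) * ennreal C"
      by (intro add_left_mono mult_left_mono second) auto
    also have "\<dots> = ennreal (c + K * prob (?A n) + 1 / K * C)"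
      using K \<open>c \<ge> 0\<close> \<open>C \<ge> 0\<close> by (simp add: emeasure_eq_measure ennreal_mult'[symmetric] ennreal_plus[symmetric] del: ennreal_plus)
    finally show ?thesis using K \<open>c \<ge> 0\<close> \<open>C \<ge> 0\<close> by (subst (asm) ennreal_le_iff) auto
  qed
  moreover have "(\<lambda>n. c + K * prob (?A n) + C / K) \<longlonglongrightarrow> c + K * 0 + C / K"
    by (intro tendsto_intros upper)
  ultimately have "l \<le> c + K * 0 + C / K" using mean(2) by (intro LIMSEQ_le) auto
  then show "l \<le> c + e" using K by simp
qed

end

section \<open>Shifted reciprocal moments\<close>

text \<open>
  Reciprocal moments \<open>E[(X + z)\<^sup>-\<^sup>k]\<close> for a random variable bounded below by \<open>x0\<close>, as functions of \<open>z \<ge> -x0\<close>. The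
  value \<open>z = -x0\<close> is delicate, since \<open>X + z\<close> may vanish there or have infinite reciprocal moments.
\<close>

locale bounded_below = prob_space M for M :: "'a measure" +
  fixes X :: "'a \<Rightarrow> real" and x0 :: real
  assumes X_meas [measurable]: "X \<in> borel_measurable M"
    and X_ge: "AE x in M. x0 \<le> X x"
begin

definition emoment :: "nat \<Rightarrow> real \<Rightarrow> ennreal" where
  "emoment k z = (\<integral>\<^sup>+x. 1 / ennreal (X x + z) ^ k \<partial>M)"

definition moment :: "nat \<Rightarrow> real \<Rightarrow> real" where
  "moment k z = (\<integral>x. 1 / (X x + z) ^ k \<partial>M)"

text \<open>
  Finiteness of the second moment also forces \<open>X + z > 0\<close> almost surely and finiteness of the first.
\<close>

definition admissible :: "real \<Rightarrow> bool" where
  "admissible z \<longleftrightarrow> - x0 \<le> z \<and> emoment 2 z < \<infinity>"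

lemma inverse_power_ennreal: "y > 0 \<Longrightarrow> 1 / ennreal y ^ k = ennreal (1 / y ^ k)"
  by (simp add: divide_ennreal[symmetric] ennreal_power)

lemma admissible_interior:
  assumes "z > - x0"
  shows "admissible z"
proof -
  have "emoment 2 z \<le> (\<integral>\<^sup>+x. ennreal (1 / (x0 + z) ^ 2) \<partial>M)"
    unfolding emoment_def
  proof (rule nn_integral_mono_AE)
    show "AE x in M. 1 / ennreal (X x + z) ^ 2 \<le> ennreal (1 / (x0 + z) ^ 2)"
      using X_ge
    proof eventually_elim
      case (elim x)
      then have "0 < x0 + z" "x0 + z \<le> X x + z" using assms by auto
      then show ?case by (subst inverse_power_ennreal) (auto intro!: ennreal_leI divide_left_mono power_mono)
    qed
  qed
  also have "\<dots> < \<infinity>" by (simp add: emeasure_space_1)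
  finally show ?thesis using assms by (simp add: admissible_def)
qed

lemma admissible_positive:
  assumes "admissible z"
  shows "AE x in M. X x + z > 0"
proof -
  have "AE x in M. 1 / ennreal (X x + z) ^ 2 \<noteq> \<infinity>"
    using assms by (intro nn_integral_noteq_infinite) (auto simp: admissible_def emoment_def)
  then show ?thesis
    using X_ge
  proof eventually_elim
    case (elim x)
    have "X x + z \<noteq> 0" using elim(1) by auto
    moreover have "X x + z \<ge> 0" using elim(2) assms by (simp add: admissible_def)
    ultimately show ?case by simp
  qed
qed

lemma integrable_inverse:
  assumes z: "admissible z" and k: "k = 1 \<or> k = 2"
  shows "integrable M (\<lambda>x. 1 / (X x + z) ^ k)"
proof -
  have 2: "integrable M (\<lambda>x. 1 / (X x + z) ^ 2)"
  proof (rule integrableI_nonneg)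
    have "(\<integral>\<^sup>+x. ennreal (1 / (X x + z) ^ 2) \<partial>M) = emoment 2 z"
      unfolding emoment_def using admissible_positive[OF z]
      by (intro nn_integral_cong_AE) (auto simp: inverse_power_ennreal)
    then show "(\<integral>\<^sup>+x. ennreal (1 / (X x + z) ^ 2) \<partial>M) < \<infinity>" using z by (simp add: admissible_def)
  qed auto
  have "integrable M (\<lambda>x. 1 / (X x + z) ^ 1)"
  proof (rule Bochner_Integration.integrable_bound)
    show "integrable M (\<lambda>x. 1 + 1 / (X x + z) ^ 2)" using 2 by auto
    show "AE x in M. norm (1 / (X x + z) ^ 1) \<le> norm (1 + 1 / (X x + z) ^ 2)"
    proof (rule AE_I2)
      fix x
      let ?u = "1 / (X x + z)"
      have "\<bar>?u\<bar> \<le> 1 + ?u\<^sup>2" using sum_squares_bound[of 1 "\<bar>?u\<bar>"] abs_ge_zero[of ?u]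
        by (simp only: power2_abs mult_1_right one_power2)
      then show "norm (1 / (X x + z) ^ 1) \<le> norm (1 + 1 / (X x + z) ^ 2)" by (simp add: power_one_over)
    qed
  qed auto
  with 2 k show ?thesis by auto
qed

lemma emoment_eq_moment:
  assumes z: "admissible z" and k: "k = 1 \<or> k = 2"
  shows "emoment k z = ennreal (moment k z)"
proof -
  have "emoment k z = (\<integral>\<^sup>+x. ennreal (1 / (X x + z) ^ k) \<partial>M)"
    unfolding emoment_def using admissible_positive[OF z]
    by (intro nn_integral_cong_AE) (auto simp: inverse_power_ennreal)
  also have "\<dots> = ennreal (moment k z)"
    unfolding moment_def using admissible_positive[OF z]
    by (intro nn_integral_eq_integral integrable_inverse assms) auto
  finally show ?thesis .
qed

lemma moment_pos:
  assumes z: "admissible z" and k: "k = 1 \<or> k = 2"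
  shows "moment k z > 0"
proof -
  have "(\<integral>x. 0 \<partial>M) < (\<integral>x. 1 / (X x + z) ^ k \<partial>M)"
    by (rule integral_less_AE_space)
      (use admissible_positive[OF z] integrable_inverse[OF assms] in \<open>auto simp: emeasure_space_1\<close>)
  then show ?thesis by (simp add: moment_def)
qed

lemma admissible_mono: "admissible z \<Longrightarrow> z \<le> w \<Longrightarrow> admissible w"
  using admissible_interior[of w] by (cases "z = w") (auto simp: admissible_def)

lemma moment_antimono:
  assumes z: "admissible z" and "z \<le> w" and k: "k = 1 \<or> k = 2"
  shows "moment k w \<le> moment k z"
  unfolding moment_def
proof (rule integral_mono_AE)
  show "AE x in M. 1 / (X x + w) ^ k \<le> 1 / (X x + z) ^ k"
    by (rule eventually_mono[OF admissible_positive[OF z]]) (use \<open>z \<le> w\<close> in \<open>auto intro!: divide_left_mono power_mono\<close>)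
qed (use assms admissible_mono integrable_inverse in auto)

text \<open>
  The tangent line of the strictly convex function \<open>z \<mapsto> 1 / (x + z)\<close>, integrated. Expressing convexity in this way
  avoids differentiation under the integral and remains valid at the end point.
\<close>

lemma moment_tangent:
  assumes z: "admissible z" and w: "admissible w" and neq: "z \<noteq> w"
  shows "moment 1 z - (w - z) * moment 2 z < moment 1 w"
proof -
  have int: "integrable M (\<lambda>x. 1 / (X x + z) ^ 1)" "integrable M (\<lambda>x. 1 / (X x + z) ^ 2)" "integrable M (\<lambda>x. 1 / (X x + w) ^ 1)"
    by (rule integrable_inverse; use z w in simp)+
  have "(\<integral>x. 1 / (X x + z) ^ 1 - (w - z) * (1 / (X x + z) ^ 2) \<partial>M) < (\<integral>x. 1 / (X x + w) ^ 1 \<partial>M)"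
  proof (rule integral_less_AE_space)
    show "AE x in M. 1 / (X x + z) ^ 1 - (w - z) * (1 / (X x + z) ^ 2) < 1 / (X x + w) ^ 1"
      using admissible_positive[OF z] admissible_positive[OF w]
    proof eventually_elim
      case (elim x)
      let ?p = "X x + z" and ?q = "X x + w"
      have "1 / q - (1 / p - (q - p) / p ^ 2) = (q - p) ^ 2 / (q * p ^ 2)" if "p > 0" "q > 0" for p q :: real
        using that by (simp add: field_simps power2_eq_square)
      from this[OF elim] have "1 / ?q - (1 / ?p - (?q - ?p) / ?p ^ 2) = (?q - ?p) ^ 2 / (?q * ?p ^ 2)" .
      moreover have "(?q - ?p) ^ 2 / (?q * ?p ^ 2) > 0" using elim neq by simp
      ultimately show ?case by simp
    qed
    show "integrable M (\<lambda>x. 1 / (X x + z) ^ 1 - (w - z) * (1 / (X x + z) ^ 2))"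
      by (intro Bochner_Integration.integrable_diff integrable_mult_right int)
  qed (use int in \<open>auto simp: emeasure_space_1\<close>)
  also have "(\<integral>x. 1 / (X x + z) ^ 1 - (w - z) * (1 / (X x + z) ^ 2) \<partial>M)
      = (\<integral>x. 1 / (X x + z) ^ 1 \<partial>M) - (\<integral>x. (w - z) * (1 / (X x + z) ^ 2) \<partial>M)"
    by (intro Bochner_Integration.integral_diff integrable_mult_right int)
  also have "(\<integral>x. (w - z) * (1 / (X x + z) ^ 2) \<partial>M) = (w - z) * (\<integral>x. 1 / (X x + z) ^ 2 \<partial>M)"
    by (rule integral_mult_right_zero)
  finally show ?thesis by (simp only: moment_def)
qed

text \<open>
  A convergent sequence together with its limit has a smallest element \<open>m\<close>, and the integrand at \<open>m\<close> dominates
  all others; \<open>m\<close> is admissible even if it is the end point.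
\<close>

lemma moment_continuous:
  assumes k: "k = 1 \<or> k = 2"
  shows "continuous_on {z. admissible z} (moment k)"
  unfolding continuous_on_sequentially
proof (intro allI ballI impI)
  fix u z assume z: "z \<in> {z. admissible z}" and u: "(\<forall>n. u n \<in> {z. admissible z}) \<and> u \<longlonglongrightarrow> z"
  have "compact (insert z (range u))" using u by (intro compact_sequence_with_limit) auto
  then obtain m where m: "m \<in> insert z (range u)" "\<And>y. y \<in> insert z (range u) \<Longrightarrow> m \<le> y"
    using compact_attains_inf[of "insert z (range u)"] by auto
  have gm: "admissible m" using m(1) z u by auto
  have "(\<lambda>n. \<integral>x. 1 / (X x + u n) ^ k \<partial>M) \<longlonglongrightarrow> (\<integral>x. 1 / (X x + z) ^ k \<partial>M)"
  proof (rule integral_dominated_convergence[where w="\<lambda>x. 1 / (X x + m) ^ k"])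
    show "integrable M (\<lambda>x. 1 / (X x + m) ^ k)" by (rule integrable_inverse[OF gm k])
    show "AE x in M. (\<lambda>n. 1 / (X x + u n) ^ k) \<longlonglongrightarrow> 1 / (X x + z) ^ k"
      using admissible_positive[of z] z u by (auto intro!: tendsto_intros)
    show "AE x in M. norm (1 / (X x + u n) ^ k) \<le> 1 / (X x + m) ^ k" for n
    proof -
      have mu: "m \<le> u n" using m(2) by auto
      show ?thesis
        by (rule eventually_mono[OF admissible_positive[OF gm]]) (use mu in \<open>auto intro!: divide_left_mono power_mono\<close>)
    qed
  qed auto
  then show "(moment k \<circ> u) \<longlonglongrightarrow> moment k z" by (simp add: moment_def comp_def)
qed

lemma moment_tendsto:
  assumes "\<And>n. admissible (u n)" "admissible z" "u \<longlonglongrightarrow> z" "k = 1 \<or> k = 2"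
  shows "(\<lambda>n. moment k (u n)) \<longlonglongrightarrow> moment k z"
  by (rule continuous_on_tendsto_compose[OF moment_continuous[OF assms(4)] assms(3)]) (use assms in auto)

text \<open>
  Fatou's lemma at the end point.
\<close>

lemma second_moment_blows_up:
  assumes bad: "\<not> admissible (- x0)" and d: "d > 0"
  shows "\<exists>z>-x0. z < - x0 + d \<and> K < moment 2 z"
proof (rule ccontr)
  assume none: "\<not> ?thesis"
  define u where "u n = - x0 + d / real (n + 2)" for n :: nat
  have lim: "u \<longlonglongrightarrow> - x0" unfolding u_def by real_asymp
  have u: "- x0 < u n" "u n < - x0 + d" for n
    using d mult_pos_pos[OF d, of "real (n + 1)"] by (auto simp: u_def field_simps)
  have "emoment 2 (- x0) = (\<integral>\<^sup>+x. liminf (\<lambda>n. 1 / ennreal (X x + u n) ^ 2) \<partial>M)"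
    unfolding emoment_def
  proof (intro nn_integral_cong)
    fix x
    have "(\<lambda>n. ennreal (X x + u n)) \<longlonglongrightarrow> ennreal (X x + - x0)"
      by (intro tendsto_ennrealI tendsto_intros lim)
    then have "(\<lambda>n. inverse (ennreal (X x + u n))) \<longlonglongrightarrow> inverse (ennreal (X x + - x0))"
      using continuous_on_inverse_ennreal[OF continuous_on_id, of UNIV]
      by (auto simp: continuous_on_eq_continuous_at intro: isCont_tendsto_compose)
    then have "(\<lambda>n. (inverse (ennreal (X x + u n)))\<^sup>2) \<longlonglongrightarrow> (inverse (ennreal (X x + - x0)))\<^sup>2"
      unfolding power2_eq_square
      by (intro tendsto_mult_ennreal) auto
    then have "(\<lambda>n. 1 / ennreal (X x + u n) ^ 2) \<longlonglongrightarrow> 1 / ennreal (X x + - x0) ^ 2"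
      by (simp add: divide_ennreal_def ennreal_inverse_power)
    then show "1 / ennreal (X x + - x0) ^ 2 = liminf (\<lambda>n. 1 / ennreal (X x + u n) ^ 2)"
      by (intro lim_imp_Liminf[symmetric]) auto
  qed
  also have "\<dots> \<le> liminf (\<lambda>n. emoment 2 (u n))"
    unfolding emoment_def by (rule nn_integral_liminf) measurable
  also have "\<dots> \<le> ennreal \<bar>K\<bar>"
  proof -
    have "emoment 2 (u n) \<le> ennreal \<bar>K\<bar>" for n
    proof -
      have "moment 2 (u n) \<le> K" using none u[of n] by (meson not_le)
      then show ?thesis
        using emoment_eq_moment[OF admissible_interior[OF u(1)], of 2 n] by (auto intro!: ennreal_leI)
    qed
    then have "liminf (\<lambda>n. emoment 2 (u n)) \<le> liminf (\<lambda>n. ennreal \<bar>K\<bar>)"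
      by (intro Liminf_mono always_eventually allI)
    then show ?thesis by (simp add: Liminf_const)
  qed
  also have "\<dots> < \<infinity>" by simp
  finally show False using bad by (simp add: admissible_def)
qed

end

section \<open>Minimising a two-parameter convex trade-off\<close>

text \<open>
  The minimisation of \<open>s A(z) + t B(z)\<close> over an interval \<open>Z\<close>, where \<open>A\<close> and \<open>B\<close> are strictly convex with derivatives
  \<open>-A2 < 0\<close> and \<open>B2 > 0\<close>, given in terms of supporting lines. The assumptions \<open>low\<close> and \<open>high\<close> say that an end
  of \<open>Z\<close> either belongs to \<open>Z\<close> or repels minimisers.
\<close>

locale slope_optimiser =
  fixes Z :: "real set" and A A2 B B2 :: "real \<Rightarrow> real"
  assumes nonempty: "Z \<noteq> {}"
    and interval: "\<And>x y z. x \<in> Z \<Longrightarrow> z \<in> Z \<Longrightarrow> x \<le> y \<Longrightarrow> y \<le> z \<Longrightarrow> y \<in> Z"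
    and pos: "\<And>z. z \<in> Z \<Longrightarrow> A2 z > 0" "\<And>z. z \<in> Z \<Longrightarrow> B2 z > 0"
    and cont: "continuous_on Z A" "continuous_on Z B" "continuous_on Z A2" "continuous_on Z B2"
    and tangent: "\<And>z w. z \<in> Z \<Longrightarrow> w \<in> Z \<Longrightarrow> z \<noteq> w \<Longrightarrow> A z - (w - z) * A2 z < A w"
      "\<And>z w. z \<in> Z \<Longrightarrow> w \<in> Z \<Longrightarrow> z \<noteq> w \<Longrightarrow> B z + (w - z) * B2 z < B w"
    and low: "(\<exists>m\<in>Z. \<forall>z\<in>Z. m \<le> z) \<or> (\<forall>r>0. \<exists>z\<in>Z. B2 z < r * A2 z)"
    and high: "(\<exists>m\<in>Z. \<forall>z\<in>Z. z \<le> m) \<or> (\<forall>r>0. \<exists>z\<in>Z. r * A2 z < B2 z)"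
begin

text \<open>
  The first-order condition for the minimisation with slope \<open>r = s / t\<close>, allowing for end points: the
  derivative at \<open>z\<close> points upwards in every direction available in \<open>Z\<close>.
\<close>

definition optimal :: "real \<Rightarrow> real \<Rightarrow> bool" where
  "optimal r z \<longleftrightarrow> z \<in> Z \<and> (\<forall>w\<in>Z. (w - z) * (B2 z - r * A2 z) \<ge> 0)"

definition minimiser :: "real \<Rightarrow> real" where
  "minimiser r = (THE z. optimal r z)"

definition optimum :: "real \<Rightarrow> real \<Rightarrow> real" where
  "optimum s t = s * A (minimiser (s / t)) + t * B (minimiser (s / t))"

lemma moment_monotone:
  assumes "z \<in> Z" "w \<in> Z" "z < w"
  shows "A2 w < A2 z" and "B2 z < B2 w"
proof -
  have "0 < (w - z) * (A2 z - A2 w)"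
    using tangent(1)[of z w] tangent(1)[of w z] assms by (simp add: algebra_simps)
  then show "A2 w < A2 z" using assms by (simp add: zero_less_mult_iff)
  have "0 < (w - z) * (B2 w - B2 z)"
    using tangent(2)[of z w] tangent(2)[of w z] assms by (simp add: algebra_simps)
  then show "B2 z < B2 w" using assms by (simp add: zero_less_mult_iff)
qed

lemma slope_defect_increasing:
  assumes "r > 0" "z \<in> Z" "w \<in> Z" "z < w"
  shows "B2 z - r * A2 z < B2 w - r * A2 w"
  using moment_monotone[OF assms(2-4)] mult_strict_left_mono[OF moment_monotone(1)[OF assms(2-4)] \<open>r > 0\<close>]
  by linarith

lemma optimal_unique:
  assumes "r > 0" "optimal r z" "optimal r w"
  shows "z = w"
proof -
  have False if "z < w" "optimal r z" "optimal r w" for z w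
  proof -
    have "(w - z) * (B2 z - r * A2 z) \<ge> 0" "(z - w) * (B2 w - r * A2 w) \<ge> 0"
      using that by (auto simp: optimal_def)
    then have "B2 z - r * A2 z \<ge> 0" "B2 w - r * A2 w \<le> 0"
      using \<open>z < w\<close> by (auto simp: zero_le_mult_iff)
    with slope_defect_increasing[OF \<open>r > 0\<close>, of z w] that show False by (auto simp: optimal_def)
  qed
  from this[of z w] this[of w z] assms show ?thesis by (cases z w rule: linorder_cases) auto
qed

lemma optimal_exists:
  assumes r: "r > 0"
  shows "\<exists>z. optimal r z"
proof -
  let ?D = "\<lambda>z. B2 z - r * A2 z"
  consider (nonneg) "\<forall>z\<in>Z. ?D z \<ge> 0" | (nonpos) "\<forall>z\<in>Z. ?D z \<le> 0"
    | (sign) x y where "x \<in> Z" "y \<in> Z" "?D x < 0" "?D y > 0"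
    using not_le by blast
  then show ?thesis
  proof cases
    case nonneg
    then have "\<not> (\<exists>z\<in>Z. B2 z < r * A2 z)" by (auto simp: not_less)
    then have "\<not> (\<forall>r>0. \<exists>z\<in>Z. B2 z < r * A2 z)" using r by blast
    then obtain m where m: "m \<in> Z" "\<forall>z\<in>Z. m \<le> z" using low by metis
    then have "optimal r m" using nonneg by (auto simp: optimal_def)
    then show ?thesis ..
  next
    case nonpos
    then have "\<not> (\<exists>z\<in>Z. r * A2 z < B2 z)" by (auto simp: not_less)
    then have "\<not> (\<forall>r>0. \<exists>z\<in>Z. r * A2 z < B2 z)" using r by blast
    then obtain m where m: "m \<in> Z" "\<forall>z\<in>Z. z \<le> m" using high by metis
    then have "optimal r m" using nonpos by (auto simp: optimal_def intro!: mult_nonpos_nonpos)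
    then show ?thesis ..
  next
    case sign
    have "x < y"
    proof (rule ccontr)
      assume "\<not> x < y"
      then have "y < x \<or> x = y" by linarith
      then show False using slope_defect_increasing[OF r sign(2,1)] sign(3,4) by auto
    qed
    have sub: "{x..y} \<subseteq> Z" using interval[OF sign(1,2)] by auto
    have "continuous_on Z ?D" by (intro continuous_intros cont)
    then have "continuous_on {x..y} ?D" using sub by (rule continuous_on_subset)
    from IVT'[OF _ _ _ this, of 0] sign(3,4) \<open>x < y\<close>
    obtain z where "x \<le> z" "z \<le> y" "?D z = 0" by auto
    then have "z \<in> Z" using sub by auto
    with \<open>?D z = 0\<close> have "optimal r z" by (simp add: optimal_def)
    then show ?thesis ..
  qed
qed

lemma optimal_minimiser:
  assumes "r > 0"
  shows "optimal r (minimiser r)"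
proof -
  obtain z where z: "optimal r z" using optimal_exists[OF assms] ..
  show ?thesis
    unfolding minimiser_def by (rule theI[of _ z]) (auto intro: z optimal_unique[OF assms _ z])
qed

lemma minimiser_eqI: "r > 0 \<Longrightarrow> optimal r z \<Longrightarrow> minimiser r = z"
  by (rule optimal_unique[OF _ optimal_minimiser])

lemma minimiser_in: "r > 0 \<Longrightarrow> minimiser r \<in> Z"
  using optimal_minimiser by (simp add: optimal_def)

lemma minimiser_ratio:
  assumes "z \<in> Z"
  shows "minimiser (B2 z / A2 z) = z"
  using pos[OF assms] assms by (intro minimiser_eqI) (auto simp: optimal_def)

text \<open>
  Add the two supporting lines at the minimiser and use the first-order condition.
\<close>

lemma optimum_less:
  assumes st: "s > 0" "t > 0" and w: "w \<in> Z" "w \<noteq> minimiser (s / t)"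
  shows "optimum s t < s * A w + t * B w"
proof -
  let ?z = "minimiser (s / t)"
  have z: "?z \<in> Z" using st by (intro minimiser_in) simp
  have r: "s / t > 0" using st by simp
  have opt: "(w - ?z) * (B2 ?z - s / t * A2 ?z) \<ge> 0"
    using optimal_minimiser[OF r] w(1) unfolding optimal_def by blast
  have "t * ((w - ?z) * (B2 ?z - s / t * A2 ?z)) \<ge> 0"
    by (rule mult_nonneg_nonneg[OF less_imp_le[OF st(2)] opt])
  moreover have "t * (x * (b - s / t * a)) = x * (t * b - s * a)" for x a b :: real
    using st(2) by (simp add: right_diff_distrib mult_ac)
  ultimately have "(w - ?z) * (t * B2 ?z - s * A2 ?z) \<ge> 0" by metis
  moreover have "s * (A ?z - (w - ?z) * A2 ?z) < s * A w"
    by (rule mult_strict_left_mono[OF tangent(1)[OF z w(1) w(2)[symmetric]] st(1)])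
  moreover have "t * (B ?z + (w - ?z) * B2 ?z) < t * B w"
    by (rule mult_strict_left_mono[OF tangent(2)[OF z w(1) w(2)[symmetric]] st(2)])
  ultimately show ?thesis unfolding optimum_def by (simp add: algebra_simps)
qed

lemma optimum_le:
  assumes "s > 0" "t > 0" "w \<in> Z"
  shows "optimum s t \<le> s * A w + t * B w"
  using optimum_less[OF assms] by (cases "w = minimiser (s / t)") (auto simp: optimum_def)

lemma minimiser_mono:
  assumes "0 < r" "r \<le> q"
  shows "minimiser r \<le> minimiser q"
proof (rule ccontr)
  assume "\<not> minimiser r \<le> minimiser q"
  then have lt: "minimiser q < minimiser r" by simp
  have in_Z: "minimiser q \<in> Z" "minimiser r \<in> Z" using assms by (auto intro: minimiser_in)
  have "(minimiser q - minimiser r) * (B2 (minimiser r) - r * A2 (minimiser r)) \<ge> 0"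
    using optimal_minimiser[OF \<open>0 < r\<close>] in_Z(1) unfolding optimal_def by blast
  then have "B2 (minimiser r) - r * A2 (minimiser r) \<le> 0"
    using lt by (simp add: zero_le_mult_iff)
  moreover have "(minimiser r - minimiser q) * (B2 (minimiser q) - q * A2 (minimiser q)) \<ge> 0"
    using optimal_minimiser[of q] assms in_Z(2) unfolding optimal_def by simp
  then have "B2 (minimiser q) - q * A2 (minimiser q) \<ge> 0"
    using lt by (simp add: zero_le_mult_iff)
  moreover have "B2 (minimiser q) - q * A2 (minimiser q) < B2 (minimiser r) - q * A2 (minimiser r)"
    using slope_defect_increasing[of q, OF _ in_Z lt] assms by simp
  moreover have "r * A2 (minimiser r) \<le> q * A2 (minimiser r)"
    using assms pos(1)[OF in_Z(2)] by (intro mult_right_mono) auto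
  ultimately show False by linarith
qed

text \<open>
  The minimiser is monotone in the slope, and by \<open>minimiser_ratio\<close> every point of \<open>Z\<close> is a value. Hence a neighbour \<open>w\<close>
  of the minimiser, itself attained at the slope \<open>B2 w / A2 w\<close>, bounds the minimiser for all slopes on one side of
  that slope.
\<close>

lemma minimiser_continuous: "continuous_on {0<..} minimiser"
proof (rule continuous_at_imp_continuous_on, intro ballI)
  fix r :: real assume "r \<in> {0<..}"
  then have r: "r > 0" by simp
  note opt = optimal_minimiser[OF r]
  have z: "minimiser r \<in> Z" using r by (rule minimiser_in)
  have upper: "\<exists>q>r. \<forall>x. 0 < x \<and> x < q \<longrightarrow> minimiser x < minimiser r + e" if e: "e > 0" for e
  proof (cases "\<exists>w\<in>Z. minimiser r < w")
    case False
    then have "minimiser x < minimiser r + e" if "0 < x" for x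
      using False minimiser_in[OF that] e by force
    then show ?thesis by (intro exI[of _ "r + 1"]) auto
  next
    case True
    then obtain w0 where w0: "w0 \<in> Z" "minimiser r < w0" by blast
    define w where "w = min w0 (minimiser r + e / 2)"
    have w: "w \<in> Z" "minimiser r < w" "w < minimiser r + e"
      using interval[OF z w0(1), of w] w0 e by (auto simp: w_def)
    have "(w - minimiser r) * (B2 (minimiser r) - r * A2 (minimiser r)) \<ge> 0"
      using opt w by (auto simp: optimal_def)
    then have "B2 (minimiser r) - r * A2 (minimiser r) \<ge> 0" using w by (simp add: zero_le_mult_iff)
    then have "r * A2 w < B2 w" using slope_defect_increasing[OF r z w(1,2)] by simp
    then have "r < B2 w / A2 w" using pos[OF w(1)] by (simp add: field_simps)
    moreover have "minimiser x < minimiser r + e" if "0 < x \<and> x < B2 w / A2 w" for x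
      using minimiser_mono[of x "B2 w / A2 w"] minimiser_ratio[OF w(1)] w that by auto
    ultimately show ?thesis by blast
  qed
  have lower: "\<exists>q<r. \<forall>x. 0 < x \<and> q < x \<longrightarrow> minimiser x > minimiser r - e" if e: "e > 0" for e
  proof (cases "\<exists>w\<in>Z. w < minimiser r")
    case False
    then have "minimiser x > minimiser r - e" if "0 < x" for x
      using False minimiser_in[OF that] e by force
    then show ?thesis by (intro exI[of _ "r - 1"]) auto
  next
    case True
    then obtain w0 where w0: "w0 \<in> Z" "w0 < minimiser r" by blast
    define w where "w = max w0 (minimiser r - e / 2)"
    have w: "w \<in> Z" "w < minimiser r" "minimiser r - e < w"
      using interval[OF w0(1) z, of w] w0 e by (auto simp: w_def)
    have "(w - minimiser r) * (B2 (minimiser r) - r * A2 (minimiser r)) \<ge> 0"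
      using opt w by (auto simp: optimal_def)
    then have "B2 (minimiser r) - r * A2 (minimiser r) \<le> 0" using w by (simp add: zero_le_mult_iff)
    then have "B2 w < r * A2 w" using slope_defect_increasing[OF r w(1) z w(2)] by simp
    then have "B2 w / A2 w < r" using pos[OF w(1)] by (simp add: field_simps)
    moreover have "minimiser x > minimiser r - e" if "0 < x \<and> B2 w / A2 w < x" for x
      using minimiser_mono[of "B2 w / A2 w" x] minimiser_ratio[OF w(1)] w pos[OF w(1)] that by auto
    ultimately show ?thesis by blast
  qed
  show "isCont minimiser r"
    unfolding continuous_at tendsto_iff
  proof (intro allI impI)
    fix e :: real assume e: "e > 0"
    obtain q1 where q1: "q1 > r" "\<And>x. 0 < x \<and> x < q1 \<Longrightarrow> minimiser x < minimiser r + e" using upper[OF e] by blast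
    obtain q2 where q2: "q2 < r" "\<And>x. 0 < x \<and> q2 < x \<Longrightarrow> minimiser x > minimiser r - e" using lower[OF e] by blast
    have "\<forall>\<^sub>F x in at r. x \<in> {max 0 q2<..<q1}"
      using r q1 q2 by (intro eventually_at_in_open') auto
    then show "\<forall>\<^sub>F x in at r. dist (minimiser x) (minimiser r) < e"
    proof eventually_elim
      case (elim x)
      then show ?case using q1(2)[of x] q2(2)[of x] by (auto simp: dist_real_def)
    qed
  qed
qed

text \<open>
  The minimiser of the combined direction is a suboptimal choice for at least one of the two
  directions.
\<close>

lemma optimum_strictly_concave:
  assumes "0 < c" "c < 1" "s1 > 0" "s2 > 0" "t1 > 0" "t2 > 0" and "minimiser (s1 / t1) \<noteq> minimiser (s2 / t2)"
  shows "c * optimum s1 t1 + (1 - c) * optimum s2 t2 < optimum (c * s1 + (1 - c) * s2) (c * t1 + (1 - c) * t2)"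
proof -
  let ?s = "c * s1 + (1 - c) * s2" and ?t = "c * t1 + (1 - c) * t2"
  have "?s > 0" "?t > 0" using assms by (auto intro!: add_pos_pos)
  define z where "z = minimiser (?s / ?t)"
  have z: "z \<in> Z" using \<open>?s > 0\<close> \<open>?t > 0\<close> by (auto simp: z_def intro!: minimiser_in)
  let ?v1 = "s1 * A z + t1 * B z" and ?v2 = "s2 * A z + t2 * B z"
  have le: "optimum s1 t1 \<le> ?v1" "optimum s2 t2 \<le> ?v2" by (rule optimum_le; fact assms z)+
  have "z \<noteq> minimiser (s1 / t1) \<or> z \<noteq> minimiser (s2 / t2)" using assms by auto
  then have "optimum s1 t1 < ?v1 \<or> optimum s2 t2 < ?v2" using optimum_less[OF \<open>s1 > 0\<close> \<open>t1 > 0\<close> z] optimum_less[OF \<open>s2 > 0\<close> \<open>t2 > 0\<close> z] by blast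
  then have "c * optimum s1 t1 + (1 - c) * optimum s2 t2 < c * ?v1 + (1 - c) * ?v2"
  proof
    assume "optimum s1 t1 < ?v1"
    then show ?thesis using le assms by (intro add_less_le_mono mult_strict_left_mono mult_left_mono) auto
  next
    assume "optimum s2 t2 < ?v2"
    then show ?thesis using le assms by (intro add_le_less_mono mult_strict_left_mono mult_left_mono) auto
  qed
  also have "\<dots> = optimum ?s ?t" by (simp add: optimum_def z_def algebra_simps)
  finally show ?thesis .
qed

text \<open>
  Envelope theorem. Comparing each of two points \<open>p\<close> and \<open>q\<close> with the minimiser of the other one bounds the error of
  the linear approximation from both sides, by the norm of \<open>q - p\<close> times the oscillation of \<open>A\<close> and \<open>B\<close> at the minimisers.
\<close>

lemma optimum_C1: "continuously_differentiable_on (\<lambda>(s, t). optimum s t) ({0<..} \<times> {0<..})"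
proof -
  let ?Q = "{0<..} \<times> {0<..} :: (real \<times> real) set"
  define \<phi> where "\<phi> p = minimiser (fst p / snd p)" for p :: "real \<times> real"
  define D :: "real \<times> real \<Rightarrow> (real \<times> real) \<Rightarrow>\<^sub>L real" where "D p = A (\<phi> p) *\<^sub>R fst_blinfun + B (\<phi> p) *\<^sub>R snd_blinfun" for p
  have D_apply: "blinfun_apply (D p) v = A (\<phi> p) * fst v + B (\<phi> p) * snd v" for p v
    by (simp add: D_def blinfun.bilinear_simps)
  have "continuous_on ?Q (\<lambda>p. minimiser (fst p / snd p))"
    by (rule continuous_on_compose2[OF minimiser_continuous]) (auto intro!: continuous_intros)
  then have \<phi>: "continuous_on ?Q \<phi>" by (simp add: \<phi>_def[abs_def])
  have \<phi>_in: "\<phi> p \<in> Z" if "p \<in> ?Q" for p using that by (auto simp: \<phi>_def intro!: minimiser_in)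
  have A\<phi>: "continuous_on ?Q (\<lambda>p. A (\<phi> p))" and B\<phi>: "continuous_on ?Q (\<lambda>p. B (\<phi> p))"
    by (auto intro!: continuous_on_compose2[OF cont(1) \<phi>] continuous_on_compose2[OF cont(2) \<phi>] \<phi>_in)
  have optimum_eq: "optimum s t = s * A (\<phi> (s, t)) + t * B (\<phi> (s, t))" for s t
    by (simp add: optimum_def \<phi>_def)
  have deriv: "((\<lambda>(s, t). optimum s t) has_derivative blinfun_apply (D p)) (at p)" if p: "p \<in> ?Q" for p
  proof -
    let ?H = "\<lambda>q. \<bar>A (\<phi> q) - A (\<phi> p)\<bar> + \<bar>B (\<phi> q) - B (\<phi> p)\<bar>"
    have Q: "open ?Q" by (intro open_Times) auto
    have at: "at p within ?Q = at p" using p Q by (rule at_within_open)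
    have "((\<lambda>(s, t). optimum s t) has_derivative blinfun_apply (D p)) (at p within ?Q)"
    proof (rule has_derivativeI_sandwich[of 1 _ _ _ _ ?H])
      show "bounded_linear (blinfun_apply (D p))" by (rule blinfun.bounded_linear_right)
      have "(?H \<longlongrightarrow> \<bar>A (\<phi> p) - A (\<phi> p)\<bar> + \<bar>B (\<phi> p) - B (\<phi> p)\<bar>) (at p within ?Q)"
        using A\<phi> B\<phi> p by (intro tendsto_intros) (auto simp: continuous_on)
      then show "(?H \<longlongrightarrow> 0) (at p within ?Q)" by simp
      fix q assume q: "q \<in> ?Q" "q \<noteq> p"
      obtain s t s' t' where st: "p = (s, t)" "q = (s', t')" by (cases p; cases q)
      have "optimum s' t' \<le> s' * A (\<phi> p) + t' * B (\<phi> p)" "optimum s t \<le> s * A (\<phi> q) + t * B (\<phi> q)"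
        using p q st \<phi>_in by (auto intro!: optimum_le)
      moreover define err where "err = optimum s' t' - optimum s t - (A (\<phi> p) * (s' - s) + B (\<phi> p) * (t' - t))"
      ultimately have "err \<le> 0" "err \<ge> (s' - s) * (A (\<phi> q) - A (\<phi> p)) + (t' - t) * (B (\<phi> q) - B (\<phi> p))"
        by (auto simp: err_def optimum_eq st algebra_simps)
      then have "\<bar>err\<bar> \<le> \<bar>(s' - s) * (A (\<phi> q) - A (\<phi> p)) + (t' - t) * (B (\<phi> q) - B (\<phi> p))\<bar>" by linarith
      also have "\<dots> \<le> \<bar>s' - s\<bar> * \<bar>A (\<phi> q) - A (\<phi> p)\<bar> + \<bar>t' - t\<bar> * \<bar>B (\<phi> q) - B (\<phi> p)\<bar>"
        by (metis abs_mult abs_triangle_ineq)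
      also have "\<dots> \<le> norm (q - p) * \<bar>A (\<phi> q) - A (\<phi> p)\<bar> + norm (q - p) * \<bar>B (\<phi> q) - B (\<phi> p)\<bar>"
        using norm_fst_le[of "s' - s" "t' - t"] norm_snd_le[of "t' - t" "s' - s"]
        by (intro add_mono mult_right_mono) (auto simp: st)
      finally have "\<bar>err\<bar> \<le> norm (q - p) * ?H q" by (simp add: distrib_left)
      then show "norm ((case q of (s, t) \<Rightarrow> optimum s t) - (case p of (s, t) \<Rightarrow> optimum s t) - blinfun_apply (D p) (q - p)) / norm (q - p) \<le> ?H q"
        using q by (simp add: st err_def D_apply divide_le_eq mult.commute)
    qed auto
    then show ?thesis by (simp add: at)
  qed
  moreover have "continuous_on ?Q D"
    unfolding D_def by (intro continuous_intros A\<phi> B\<phi>)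
  ultimately show ?thesis unfolding continuously_differentiable_on_def by blast
qed

end

section \<open>The environment and the coupling with unit exponentials\<close>

text \<open>
  The complement of the support is a union of open null sets, of which countably many suffice
  (Lindelof).
\<close>

lemma measure_support_of_nonneg:
  fixes \<nu> :: "real measure"
  assumes "prob_space \<nu>" and [measurable_cong]: "sets \<nu> = sets borel" and nonneg: "AE x in \<nu>. x \<ge> 0"
  shows "AE x in \<nu>. Inf (measure_support \<nu>) \<le> x"
    and "d > 0 \<Longrightarrow> emeasure \<nu> {..<Inf (measure_support \<nu>) + d} > 0"
proof -
  interpret prob_space \<nu> by fact
  let ?S = "measure_support \<nu>"
  have sp: "space \<nu> = UNIV" using sets_eq_imp_space_eq[OF assms(2)] by simp
  define F where "F = {U :: real set. open U \<and> emeasure \<nu> U = 0}"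
  obtain F' where F': "F' \<subseteq> F" "countable F'" "\<Union>F' = \<Union>F"
    using Lindelof[of F] by (auto simp: F_def)
  have compl: "- ?S = \<Union>F" by (auto simp: F_def measure_support_def not_less)
  have "\<Union>F' \<in> null_sets \<nu>"
  proof (rule null_sets_UN'[where N="\<lambda>x. x", simplified, OF F'(2)])
    fix U assume "U \<in> F'"
    then show "U \<in> null_sets \<nu>" using F' by (auto simp: F_def null_sets_def assms(2))
  qed
  then have AE_S: "AE x in \<nu>. x \<in> ?S"
    using AE_not_in[of "\<Union>F'" \<nu>] compl F'(3) by (auto elim!: eventually_mono)
  have "?S \<subseteq> {0..}"
  proof
    fix x assume x: "x \<in> ?S"
    have neg: "{..<0} \<in> sets \<nu>" by (simp add: assms(2))
    have "AE x in \<nu>. x \<notin> {..<0}" by (rule eventually_mono[OF nonneg]) simp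
    then have "{..<0} \<in> null_sets \<nu>" by (rule AE_iff_null_sets[OF neg, THEN iffD2])
    then have null: "emeasure \<nu> {..<0} = 0" by (rule null_setsD1)
    have "\<not> x < 0"
    proof
      assume "x < 0"
      then have "0 < emeasure \<nu> {..<0}" using x unfolding measure_support_def by simp
      then show False using null by simp
    qed
    then show "x \<in> {0..}" by simp
  qed
  then have bdd: "bdd_below ?S" by (intro bdd_belowI[of _ 0]) auto
  show "AE x in \<nu>. Inf ?S \<le> x"
    using AE_S by eventually_elim (rule cInf_lower[OF _ bdd])
  have ne: "?S \<noteq> {}"
  proof
    assume "?S = {}"
    with AE_S have "AE x in \<nu>. False" by simp
    then show False by simp
  qed
  show "emeasure \<nu> {..<Inf ?S + d} > 0" if d: "d > 0"
  proof -
    obtain x where "x \<in> ?S" "x < Inf ?S + d" using cInf_lessD[OF ne, of "Inf ?S + d"] d by auto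
    then show ?thesis by (auto simp: measure_support_def)
  qed
qed

type_synonym env = "(nat \<Rightarrow> real) \<times> (nat \<Rightarrow> real)"

lemma shift_shift: "shift k (shift l c) = shift (k + l) c"
  by (auto simp: shift_def add_ac)

lemma shift_apply: "i \<ge> 1 \<Longrightarrow> shift k c i = c (i + k)"
  by (simp add: shift_def)

lemma measurable_shift [measurable]: "shift k \<in> measurable pos_seq_space pos_seq_space"
  unfolding shift_def[abs_def] pos_seq_space_def
proof (rule measurable_restrict)
  fix n :: nat assume "n \<in> {1..}"
  then show "(\<lambda>c. c (n + k)) \<in> measurable (PiM {1..} (\<lambda>_. restrict_space borel {0<..})) (restrict_space borel {0<..})"
    by (intro measurable_component_singleton) auto
qed

text \<open>
  Rates of the stationary model with parameter \<open>z\<close>. The value 1 at the origin keeps all rates positive,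
  so that the weights of all sites have a joint exponential product law.
\<close>

definition rate :: "real \<Rightarrow> env \<Rightarrow> nat \<times> nat \<Rightarrow> real" where
  "rate z ab = (\<lambda>(i, j). if i = 0 then (if j = 0 then 1 else snd ab j - z)
     else if j = 0 then fst ab i + z else fst ab i + snd ab j)"

definition weight :: "real \<Rightarrow> env \<times> (nat \<times> nat \<Rightarrow> real) \<Rightarrow> nat \<times> nat \<Rightarrow> real" where
  "weight z x k = snd x k / rate z (fst x) k"

abbreviation unit_weights :: "(nat \<times> nat \<Rightarrow> real) measure" where
  "unit_weights \<equiv> expo_product (\<lambda>_. 1)"

text \<open>
  Here 0 stands for any parameter of the stationary model, because \<open>bulk\<close> only looks at sites off the
  axes (\<open>passage_weight\<close>).
\<close>

definition passage :: "nat \<Rightarrow> nat \<Rightarrow> env \<times> (nat \<times> nat \<Rightarrow> real) \<Rightarrow> nat \<Rightarrow> nat \<Rightarrow> real" where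
  "passage k l x = lpp (bulk k l (weight 0 x))"

lemma bulk_weight: "bulk k l (weight z x) = bulk k l (weight z' x)"
  by (auto simp: bulk_def weight_def rate_def)

definition space_shift :: "nat \<Rightarrow> nat \<Rightarrow> env \<times> (nat \<times> nat \<Rightarrow> real) \<Rightarrow> env \<times> (nat \<times> nat \<Rightarrow> real)" where
  "space_shift k l = map_prod (map_prod (shift k) (shift l)) (\<lambda>e (i, j). e (i + k, j + l))"

lemma passage_space_shift: "passage 0 0 (space_shift k l x) = passage k l x"
proof -
  have "bulk 0 0 (weight 0 (space_shift k l x)) = bulk k l (weight 0 x)"
    by (auto simp: bulk_def weight_def rate_def space_shift_def shift_apply map_prod_def split: prod.splits)
  then show ?thesis by (simp add: passage_def)
qed

abbreviation grid :: "nat \<Rightarrow> real \<Rightarrow> nat" where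
  "grid n s \<equiv> nat \<lfloor>real n * s\<rfloor>"

lemma floor_ratio: "s \<ge> 0 \<Longrightarrow> (\<lambda>n. real (grid n s) / real n) \<longlonglongrightarrow> s"
  by (cases "s = 0") (simp, real_asymp)

lemma exists_crossing:
  fixes f :: "nat \<Rightarrow> nat"
  assumes "f 0 \<le> k" "k < f L"
  shows "\<exists>l<L. f l \<le> k \<and> k < f (Suc l)"
  using assms
proof (induction L)
  case (Suc L)
  show ?case
  proof (cases "k < f L")
    case True
    then show ?thesis using Suc.IH Suc.prems by (auto intro: less_SucI)
  next
    case False
    then show ?thesis using Suc.prems by (intro exI[of _ L]) auto
  qed
qed simp

lemma floor_gap_ratio:
  assumes "0 \<le> u" "u \<le> s"
  shows "(\<lambda>n. real (grid n s - grid n u) / real n) \<longlonglongrightarrow> s - u"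
proof -
  have "grid n u \<le> grid n s" for n
    using assms by (intro nat_mono floor_mono mult_left_mono) auto
  then have "real (grid n s - grid n u) / real n
      = real (grid n s) / real n - real (grid n u) / real n" for n
    by (simp add: of_nat_diff diff_divide_distrib)
  then show ?thesis
    using tendsto_diff[OF floor_ratio[of s] floor_ratio[of u]] assms by simp
qed

lemma filterlim_of_ratio:
  fixes k :: "nat \<Rightarrow> nat"
  assumes lim: "(\<lambda>n. real (k n) / real n) \<longlonglongrightarrow> c" and c: "c > 0"
  shows "filterlim k at_top sequentially"
proof -
  have "filterlim (\<lambda>n. (real (k n) / real n) * real n) at_top sequentially"
    by (rule filterlim_tendsto_pos_mult_at_top[OF lim c filterlim_real_sequentially])
  moreover have "\<forall>\<^sub>F n in sequentially. (real (k n) / real n) * real n = real (k n)"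
    using eventually_gt_at_top[of 0] by eventually_elim simp
  ultimately have "filterlim (\<lambda>n. real (k n)) at_top sequentially"
    by (rule filterlim_cong[THEN iffD1, OF refl refl, rotated])
  then show ?thesis by (simp add: filterlim_sequentially_iff_filterlim_real)
qed

locale corner_growth =
  fixes \<mu> :: "env measure" and g :: "real \<Rightarrow> real \<Rightarrow> ennreal"
  assumes model: "exponential_model \<mu>"
    and shape: "is_shape_function \<mu> g"
    and pos: "alpha_inf \<mu> + beta_inf \<mu> > 0"
begin

abbreviation "\<alpha> \<equiv> alpha_inf \<mu>"
abbreviation "\<beta> \<equiv> beta_inf \<mu>"
abbreviation "\<Omega> \<equiv> \<mu> \<Otimes>\<^sub>M unit_weights"

sublocale env: prob_space \<mu>
  using model by (simp add: exponential_model_def)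

sublocale unit: prob_space unit_weights
  by (rule prob_space_expo_product) simp

sublocale prod: pair_prob_space \<mu> unit_weights ..

lemma sets_\<mu> [measurable_cong]: "sets \<mu> = sets (pos_seq_space \<Otimes>\<^sub>M pos_seq_space)"
  using model by (simp add: exponential_model_def)

lemma space_\<mu>: "space \<mu> = space pos_seq_space \<times> space pos_seq_space"
  using sets_eq_imp_space_eq[OF sets_\<mu>] by (simp add: space_pair_measure)

lemma env_coordinates_pos:
  assumes "ab \<in> space \<mu>" "i \<ge> 1"
  shows "fst ab i > 0" "snd ab i > 0"
  using assms by (auto simp: space_\<mu> pos_seq_space_def space_PiM PiE_iff space_restrict_space)

lemma measurable_coordinate [measurable]: "(\<lambda>c. c i) \<in> borel_measurable pos_seq_space"
proof (cases "i \<ge> 1")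
  case True
  then have 1: "(\<lambda>c. c i) \<in> measurable pos_seq_space (restrict_space borel {0<..})"
    unfolding pos_seq_space_def by (intro measurable_component_singleton) auto
  have 2: "(\<lambda>x::real. x) \<in> measurable (restrict_space borel {0<..}) borel"
    by (intro measurable_restrict_space1 measurable_ident_sets) simp
  show ?thesis by (rule measurable_compose[OF 1 2])
next
  case False
  then have "c i = undefined" if "c \<in> space pos_seq_space" for c
    using that by (auto simp: pos_seq_space_def space_PiM PiE_iff extensional_def)
  then show ?thesis by (subst measurable_cong[where g="\<lambda>_. undefined"]) auto
qed

lemma measurable_env [measurable]:
  "(\<lambda>ab. fst ab i) \<in> borel_measurable \<mu>" "(\<lambda>ab. snd ab i) \<in> borel_measurable \<mu>"
  by measurable

declare measurable_expo_component [measurable]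

lemma measurable_map_shift [measurable]: "map_prod (shift k) (shift l) \<in> measurable \<mu> \<mu>"
  unfolding map_prod_def case_prod_beta by measurable

text \<open>
  Total ergodicity only speaks of positive shifts in both coordinates. Precomposing with the diagonal
  shift reduces the remaining cases to these.
\<close>

lemma distr_map_shift: "distr \<mu> \<mu> (map_prod (shift k) (shift l)) = \<mu>"
proof -
  have st: "distr \<mu> \<mu> (map_prod (shift (Suc k)) (shift (Suc l))) = \<mu>" for k l
    using model unfolding exponential_model_def totally_ergodic_def ergodic_under_def stationary_under_def
    by (metis le_add1 plus_1_eq_Suc)
  have "distr \<mu> \<mu> (map_prod (shift k) (shift l)) = distr (distr \<mu> \<mu> (map_prod (shift (Suc 0)) (shift (Suc 0)))) \<mu> (map_prod (shift k) (shift l))"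
    by (simp only: st)
  also have "\<dots> = distr \<mu> \<mu> (map_prod (shift k) (shift l) \<circ> map_prod (shift (Suc 0)) (shift (Suc 0)))"
    by (rule distr_distr) measurable
  also have "map_prod (shift k) (shift l) \<circ> map_prod (shift (Suc 0)) (shift (Suc 0)) = map_prod (shift (Suc k)) (shift (Suc l))"
    by (auto simp: shift_shift)
  also have "distr \<mu> \<mu> \<dots> = \<mu>" by (rule st)
  finally show ?thesis .
qed

lemma ergodic_diagonal: "ergodic_under \<mu> (map_prod (shift 1) (shift 1))"
  using model unfolding exponential_model_def totally_ergodic_def by auto

lemma funpow_shift: "n \<ge> 1 \<or> ab \<in> space \<mu> \<Longrightarrow> (map_prod (shift 1) (shift 1) ^^ n) ab = map_prod (shift n) (shift n) ab"
proof (induction n)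
  case 0
  then have ab: "ab \<in> space \<mu>" by simp
  have "shift 0 c = c" if "c \<in> space pos_seq_space" for c
    using that by (auto simp: shift_def pos_seq_space_def space_PiM PiE_iff extensional_def fun_eq_iff restrict_def)
  then show ?case using ab by (cases ab) (auto simp: space_\<mu>)
next
  case (Suc n)
  show ?case
  proof (cases "n = 0")
    case False
    then show ?thesis using Suc.IH by (cases ab) (simp add: shift_shift)
  qed simp
qed

lemma alpha_dist_eq: "alpha_dist \<mu> = distr \<mu> borel (\<lambda>ab. fst ab 1)"
  and beta_dist_eq: "beta_dist \<mu> = distr \<mu> borel (\<lambda>ab. snd ab 1)"
  by (simp_all add: alpha_dist_def beta_dist_def case_prod_beta')

lemma AE_alpha_le: "AE ab in \<mu>. \<alpha> \<le> fst ab 1"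
  and alpha_near: "d > 0 \<Longrightarrow> measure \<mu> {ab \<in> space \<mu>. fst ab 1 < \<alpha> + d} > 0"
proof -
  let ?\<nu> = "distr \<mu> borel (\<lambda>ab. fst ab 1)"
  have p: "prob_space ?\<nu>" by (rule env.prob_space_distr) measurable
  have nonneg: "AE x in ?\<nu>. x \<ge> 0"
    using env_coordinates_pos(1)[of _ 1] by (subst AE_distr_iff) (auto intro!: AE_I2 less_imp_le)
  note * = measure_support_of_nonneg[OF p _ nonneg, simplified]
  show "AE ab in \<mu>. \<alpha> \<le> fst ab 1"
    using *(1) by (subst (asm) AE_distr_iff) (auto simp: alpha_inf_def alpha_dist_eq)
  show "measure \<mu> {ab \<in> space \<mu>. fst ab 1 < \<alpha> + d} > 0" if "d > 0"
    using *(2)[OF that]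
    by (subst (asm) emeasure_distr) (auto simp: alpha_inf_def alpha_dist_eq env.emeasure_eq_measure vimage_def Int_def conj_commute)
qed

lemma AE_beta_le: "AE ab in \<mu>. \<beta> \<le> snd ab 1"
  and beta_near: "d > 0 \<Longrightarrow> measure \<mu> {ab \<in> space \<mu>. snd ab 1 < \<beta> + d} > 0"
proof -
  let ?\<nu> = "distr \<mu> borel (\<lambda>ab. snd ab 1)"
  have p: "prob_space ?\<nu>" by (rule env.prob_space_distr) measurable
  have nonneg: "AE x in ?\<nu>. x \<ge> 0"
    using env_coordinates_pos(2)[of _ 1] by (subst AE_distr_iff) (auto intro!: AE_I2 less_imp_le)
  note * = measure_support_of_nonneg[OF p _ nonneg, simplified]
  show "AE ab in \<mu>. \<beta> \<le> snd ab 1"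
    using *(1) by (subst (asm) AE_distr_iff) (auto simp: beta_inf_def beta_dist_eq)
  show "measure \<mu> {ab \<in> space \<mu>. snd ab 1 < \<beta> + d} > 0" if "d > 0"
    using *(2)[OF that]
    by (subst (asm) emeasure_distr) (auto simp: beta_inf_def beta_dist_eq env.emeasure_eq_measure vimage_def Int_def conj_commute)
qed

definition regular_env :: "env \<Rightarrow> bool" where
  "regular_env ab \<longleftrightarrow> (\<forall>i\<ge>1. \<alpha> \<le> fst ab i \<and> \<beta> \<le> snd ab i)"

lemma AE_regular_env: "AE ab in \<mu>. regular_env ab"
proof -
  have "AE ab in \<mu>. \<alpha> \<le> fst ab (Suc i) \<and> \<beta> \<le> snd ab (Suc i)" for i
  proof -
    let ?T = "map_prod (shift i) (shift i)"
    have "AE ab in distr \<mu> \<mu> ?T. \<alpha> \<le> fst ab 1 \<and> \<beta> \<le> snd ab 1"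
      unfolding distr_map_shift using AE_alpha_le AE_beta_le by auto
    then have "AE ab in \<mu>. \<alpha> \<le> fst (?T ab) 1 \<and> \<beta> \<le> snd (?T ab) 1"
      by (rule AE_distrD[rotated]) measurable
    then show ?thesis by (simp add: shift_apply)
  qed
  then have "AE ab in \<mu>. \<forall>i. \<alpha> \<le> fst ab (Suc i) \<and> \<beta> \<le> snd ab (Suc i)"
    unfolding AE_all_countable by blast
  then show ?thesis
    by eventually_elim (metis regular_env_def Suc_le_D One_nat_def)
qed

lemma AE_\<Omega>_env: "AE ab in \<mu>. P ab \<Longrightarrow> AE x in \<Omega>. P (fst x)"
  by (rule AE_distrD[OF measurable_fst]) (simp only: unit.distr_pair_fst)

lemma AE_\<Omega>_nonneg: "AE x in \<Omega>. \<forall>k. snd x k \<ge> 0"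
proof -
  have "AE e in unit_weights. \<forall>k. e k \<ge> 0" by (rule AE_expo_product_nonneg) simp
  then have "AE x in \<mu>. AE e in unit_weights. \<forall>k. snd (x, e) k \<ge> 0" by simp
  then show ?thesis by (intro prod.AE_pair_measure) auto
qed

lemma rate_pos:
  assumes "regular_env ab" "- \<alpha> < z" "z < \<beta>"
  shows "rate z ab k > 0"
proof -
  have "\<alpha> \<le> fst ab i" "\<beta> \<le> snd ab i" if "i > 0" for i
    using assms that by (auto simp: regular_env_def)
  from this[of "fst k"] this[of "snd k"] assms pos show ?thesis
    by (auto simp: rate_def split: prod.split)
qed

lemma rate_additive: "i \<ge> 1 \<Longrightarrow> j \<ge> 1 \<Longrightarrow> rate z ab (i, j) = rate z ab (i, 0) + rate z ab (0, j)"
  by (simp add: rate_def)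

lemma measurable_weight [measurable]: "(\<lambda>x. weight z x k) \<in> borel_measurable \<Omega>"
  unfolding weight_def rate_def by (cases k) (simp split: if_split, measurable)

lemma measurable_passage [measurable]: "(\<lambda>x. passage k l x m n) \<in> borel_measurable \<Omega>"
  unfolding passage_def bulk_def by (intro measurable_lpp) auto

lemma quenched_law:
  assumes "\<And>k. rate z ab k > 0"
  shows "(\<lambda>e. weight z (ab, e)) \<in> measurable unit_weights (expo_product (rate z ab))"
    and "distr unit_weights (expo_product (rate z ab)) (\<lambda>e. weight z (ab, e)) = expo_product (rate z ab)"
proof -
  have eq: "(\<lambda>e. weight z (ab, e)) = (\<lambda>u. \<lambda>j\<in>UNIV. u j / rate z ab j)"
    by (simp add: fun_eq_iff weight_def)
  have d: "distr (expo 1) (expo (rate z ab j)) (\<lambda>x. x / rate z ab j) = expo (rate z ab j)" for j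
    by (rule distr_expo_scale) (rule assms)
  note t = distr_PiM_transform[of UNIV "\<lambda>_. expo 1" "\<lambda>j. j" UNIV "\<lambda>j x. x / rate z ab j" "\<lambda>j. expo (rate z ab j)"]
  show "(\<lambda>e. weight z (ab, e)) \<in> measurable unit_weights (expo_product (rate z ab))"
    and "distr unit_weights (expo_product (rate z ab)) (\<lambda>e. weight z (ab, e)) = expo_product (rate z ab)"
    unfolding eq by (rule t; simp add: prob_space_expo d)+
qed

lemma measurable_space_shift [measurable]: "space_shift k l \<in> measurable \<Omega> \<Omega>"
  and distr_space_shift: "distr \<Omega> \<Omega> (space_shift k l) = \<Omega>"
proof -
  let ?s = "\<lambda>e p. e (fst p + k, snd p + l) :: real"
  have shift_eq: "space_shift k l = (\<lambda>(x, y). (map_prod (shift k) (shift l) x, ?s y))"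
    by (auto simp: space_shift_def fun_eq_iff)
  have eq: "?s = (\<lambda>u. \<lambda>p\<in>UNIV. u (fst p + k, snd p + l))"
    by (auto simp: fun_eq_iff)
  note t = distr_PiM_transform[of UNIV "\<lambda>_. expo 1" "\<lambda>p. (fst p + k, snd p + l)" UNIV "\<lambda>j x. x" "\<lambda>j. expo 1"]
  have s [measurable]: "?s \<in> measurable unit_weights unit_weights"
    unfolding eq by (rule t; simp add: prob_space_expo inj_on_def prod_eq_iff distr_id2)
  have d: "distr unit_weights unit_weights ?s = unit_weights"
    unfolding eq by (rule t; simp add: prob_space_expo inj_on_def prod_eq_iff distr_id2)
  show "space_shift k l \<in> measurable \<Omega> \<Omega>"
    unfolding shift_eq case_prod_beta
    by (intro measurable_Pair measurable_compose[OF measurable_fst measurable_map_shift] measurable_compose[OF measurable_snd s])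
  have "distr \<mu> \<mu> (map_prod (shift k) (shift l)) \<Otimes>\<^sub>M distr unit_weights unit_weights ?s
      = distr \<Omega> \<Omega> (\<lambda>(x, y). (map_prod (shift k) (shift l) x, ?s y))"
    by (rule pair_measure_distr) (simp_all add: d unit.sigma_finite_measure_axioms s)
  then show "distr \<Omega> \<Omega> (space_shift k l) = \<Omega>"
    by (simp only: d distr_map_shift shift_eq)
qed

text \<open>
  The mixture of the conditional weight laws is the law of the rescaled unit exponentials, so that
  almost sure statements transfer to the coupling.
\<close>

lemma weight_law_eq:
  "weight_law \<mu> = distr \<Omega> (PiM ({1..} \<times> {1..}) (\<lambda>_. borel)) (\<lambda>x. restrict (weight 0 x) ({1..} \<times> {1..}))"
proof (rule measure_eqI)
  let ?I = "{1..} \<times> {1..} :: (nat \<times> nat) set"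
  let ?B = "PiM ?I (\<lambda>_. borel) :: (nat \<times> nat \<Rightarrow> real) measure"
  let ?W = "\<lambda>x. restrict (weight 0 x) ?I"
  have "conditional_weight_law \<in> measurable \<mu> (prob_algebra ?B)"
    using conditional_weight_law_measurable by (simp cong: measurable_cong_sets add: sets_\<mu>)
  then have K: "conditional_weight_law \<in> measurable \<mu> (subprob_algebra ?B)"
    by (rule measurable_prob_algebraD)
  have W [measurable]: "?W \<in> measurable \<Omega> ?B" by (rule measurable_restrict) measurable
  have sets_law: "sets (weight_law \<mu>) = sets ?B"
    unfolding weight_law_def using sets_bind[OF sets_kernel[OF K]] env.not_empty by simp
  then show "sets (weight_law \<mu>) = sets (distr \<Omega> ?B ?W)" by simp
  fix A assume "A \<in> sets (weight_law \<mu>)"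
  then have A [measurable]: "A \<in> sets ?B" by (simp only: sets_law)
  have cond: "emeasure (conditional_weight_law ab) A = emeasure unit_weights (Pair ab -` (?W -` A \<inter> space \<Omega>))"
    if ab: "ab \<in> space \<mu>" for ab
  proof -
    have r: "rate 0 ab k > 0" if "k \<in> ?I" for k
      using that env_coordinates_pos[OF ab] by (auto simp: rate_def add_pos_pos)
    have law: "conditional_weight_law ab = PiM ?I (\<lambda>k. expo (rate 0 ab k))"
      unfolding conditional_weight_law_def expo_def by (auto simp: rate_def case_prod_beta intro!: PiM_cong)
    have d: "distr (expo 1) (expo (rate 0 ab j)) (\<lambda>x. x / rate 0 ab j) = expo (rate 0 ab j)" if "j \<in> ?I" for j
      by (rule distr_expo_scale) (rule r[OF that])
    note t = distr_PiM_transform[of UNIV "\<lambda>_. expo 1" "\<lambda>j. j" ?I "\<lambda>j x. x / rate 0 ab j" "\<lambda>j. expo (rate 0 ab j)"]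
    have eq: "(\<lambda>u. \<lambda>j\<in>?I. u j / rate 0 ab j) = (\<lambda>e. ?W (ab, e))"
      by (simp add: fun_eq_iff weight_def restrict_def)
    have m: "(\<lambda>e. ?W (ab, e)) \<in> measurable unit_weights (PiM ?I (\<lambda>k. expo (rate 0 ab k)))"
      unfolding eq[symmetric] by (rule t(1)) (auto simp: prob_space_expo d)
    have "distr unit_weights (PiM ?I (\<lambda>k. expo (rate 0 ab k))) (\<lambda>e. ?W (ab, e)) = PiM ?I (\<lambda>k. expo (rate 0 ab k))"
      unfolding eq[symmetric] by (rule t(2)) (auto simp: prob_space_expo d)
    then have "emeasure (conditional_weight_law ab) A = emeasure (distr unit_weights (PiM ?I (\<lambda>k. expo (rate 0 ab k))) (\<lambda>e. ?W (ab, e))) A"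
      by (simp only: law)
    also have "\<dots> = emeasure unit_weights ((\<lambda>e. ?W (ab, e)) -` A \<inter> space unit_weights)"
    proof (rule emeasure_distr[OF m])
      have "sets (PiM ?I (\<lambda>k. expo (rate 0 ab k))) = sets ?B" by (intro sets_PiM_cong) auto
      then show "A \<in> sets (PiM ?I (\<lambda>k. expo (rate 0 ab k)))" using A by simp
    qed
    also have "(\<lambda>e. ?W (ab, e)) -` A \<inter> space unit_weights = Pair ab -` (?W -` A \<inter> space \<Omega>)"
      using ab by (auto simp: space_pair_measure)
    finally show ?thesis .
  qed
  have "emeasure (weight_law \<mu>) A = (\<integral>\<^sup>+ab. emeasure (conditional_weight_law ab) A \<partial>\<mu>)"
    unfolding weight_law_def by (rule emeasure_bind[OF env.not_empty K A])
  also have "\<dots> = (\<integral>\<^sup>+ab. emeasure unit_weights (Pair ab -` (?W -` A \<inter> space \<Omega>)) \<partial>\<mu>)"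
    by (intro nn_integral_cong cond)
  also have "\<dots> = emeasure \<Omega> (?W -` A \<inter> space \<Omega>)"
    by (rule unit.emeasure_pair_measure_alt[symmetric]) measurable
  also have "\<dots> = emeasure (distr \<Omega> ?B ?W) A"
    by (rule emeasure_distr[symmetric]) measurable
  finally show "emeasure (weight_law \<mu>) A = emeasure (distr \<Omega> ?B ?W) A" .
qed

lemma nat_floor_at_top: "s > 0 \<Longrightarrow> filterlim (\<lambda>n. grid n s) at_top sequentially"
  by real_asymp

text \<open>
  Nonnegativity of the weights identifies the maximum over paths with the recursion.
\<close>

lemma shape_on_\<Omega>:
  assumes s: "s > 0" and t: "t > 0"
  shows "AE x in \<Omega>. (\<lambda>n. ennreal (passage 0 0 x (grid n s) (grid n t) / real n)) \<longlonglongrightarrow> g s t"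
proof -
  let ?I = "{1..} \<times> {1..} :: (nat \<times> nat) set"
  let ?B = "PiM ?I (\<lambda>_. borel) :: (nat \<times> nat \<Rightarrow> real) measure"
  let ?W = "\<lambda>x. restrict (weight 0 x) ?I"
  have W [measurable]: "?W \<in> measurable \<Omega> ?B" by (rule measurable_restrict) measurable
  have "AE w in distr \<Omega> ?B ?W. (\<lambda>n. ennreal (last_passage_time w (grid n s) (grid n t) / real n)) \<longlonglongrightarrow> g s t"
    using shape s t unfolding is_shape_function_def weight_law_eq by (auto elim!: eventually_mono)
  then have "AE x in \<Omega>. (\<lambda>n. ennreal (last_passage_time (?W x) (grid n s) (grid n t) / real n)) \<longlonglongrightarrow> g s t"
    by (rule AE_distrD[OF W])
  with AE_\<Omega>_nonneg AE_\<Omega>_env[OF AE_regular_env] show ?thesis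
  proof eventually_elim
    case (elim x)
    have "weight 0 x (i, j) \<ge> 0" if "i \<ge> 1" "j \<ge> 1" for i j
    proof -
      have "\<alpha> \<le> fst (fst x) i" "\<beta> \<le> snd (fst x) j" using elim(2) that by (auto simp: regular_env_def)
      then show ?thesis using elim(1) that pos by (simp add: weight_def rate_def)
    qed
    then have w: "?W x (i, j) \<ge> 0" if "i \<ge> 1" "j \<ge> 1" for i j using that by simp
    have b: "bulk 0 0 (?W x) = bulk 0 0 (weight 0 x)" by (auto simp: bulk_def)
    have eq: "last_passage_time (?W x) m n = passage 0 0 x m n" if "m \<ge> 1" "n \<ge> 1" for m n
      unfolding passage_def b[symmetric] by (rule last_passage_time_eq_lpp) (use w that in auto)
    have ev: "\<forall>\<^sub>F n in sequentially. grid n s \<ge> 1 \<and> grid n t \<ge> 1"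
      using nat_floor_at_top[OF s] nat_floor_at_top[OF t] unfolding filterlim_at_top
      by (intro eventually_conj) blast+
    have "\<forall>\<^sub>F n in sequentially. ennreal (last_passage_time (?W x) (grid n s) (grid n t) / real n)
        = ennreal (passage 0 0 x (grid n s) (grid n t) / real n)"
      using ev
    proof eventually_elim
      case (elim n)
      show ?case by (simp only: eq[OF conjunct1[OF elim] conjunct2[OF elim]])
    qed
    from Lim_transform_eventually[OF elim(3) this] show ?case .
  qed
qed

section \<open>The stationary model bounds the shape function from above\<close>

definition a1 :: "env \<Rightarrow> real" where "a1 ab = fst ab 1"
definition b1 :: "env \<Rightarrow> real" where "b1 ab = snd ab 1"

sublocale SA: bounded_below \<mu> a1 \<alpha>
  using AE_alpha_le measurable_env(1)[of 1] by unfold_locales (simp_all add: a1_def[abs_def])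

sublocale SB: bounded_below \<mu> b1 \<beta>
  using AE_beta_le measurable_env(2)[of 1] by unfold_locales (simp_all add: b1_def[abs_def])

text \<open>
  Negating the parameter of the moments of \<open>b\<^sub>1\<close> lets a single \<open>z\<close> between \<open>-\<alpha>\<close> and \<open>\<beta>\<close> serve both axes. The
  derivatives of \<open>A\<close> and \<open>B\<close> are \<open>-A2\<close> and \<open>B2\<close>.
\<close>

definition "A z = SA.moment 1 z"
definition "A2 z = SA.moment 2 z"
definition "B z = SB.moment 1 (- z)"
definition "B2 z = SB.moment 2 (- z)"

lemma A_pos: "- \<alpha> < z \<Longrightarrow> A z > 0"
  unfolding A_def by (intro SA.moment_pos SA.admissible_interior) auto

lemma B_pos: "z < \<beta> \<Longrightarrow> B z > 0"
  unfolding B_def by (intro SB.moment_pos SB.admissible_interior) auto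

lemma a_moment_eq: "a_moment \<mu> z k = SA.emoment k z"
  and b_moment_eq: "b_moment \<mu> z k = SB.emoment k z"
  by (simp_all add: a_moment_def b_moment_def SA.emoment_def SB.emoment_def case_prod_beta' a1_def b1_def)

lemma nn_integral_shift:
  assumes "f \<in> borel_measurable \<mu>"
  shows "(\<integral>\<^sup>+ab. f (map_prod (shift k) (shift l) ab) \<partial>\<mu>) = (\<integral>\<^sup>+ab. f ab \<partial>\<mu>)"
  using assms by (subst (2) distr_map_shift[of k l, symmetric], subst nn_integral_distr) auto

lemma mean_reciprocal_a:
  assumes i: "i \<ge> 1" and z: "- \<alpha> < z"
  shows "(\<integral>\<^sup>+ab. ennreal (1 / (fst ab i + z)) \<partial>\<mu>) = ennreal (A z)"
proof -
  have g: "SA.admissible z" using z by (rule SA.admissible_interior)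
  have "(\<integral>\<^sup>+ab. ennreal (1 / (fst ab i + z)) \<partial>\<mu>) = (\<integral>\<^sup>+ab. ennreal (1 / (fst (map_prod (shift (i - 1)) (shift 0) ab) 1 + z)) \<partial>\<mu>)"
    using i by (simp add: shift_apply)
  also have "\<dots> = (\<integral>\<^sup>+ab. ennreal (1 / (fst ab 1 + z)) \<partial>\<mu>)"
    by (rule nn_integral_shift) measurable
  also have "\<dots> = (\<integral>\<^sup>+ab. ennreal (1 / (a1 ab + z) ^ 1) \<partial>\<mu>)"
    by (simp add: a1_def)
  also have "\<dots> = ennreal (\<integral>ab. 1 / (a1 ab + z) ^ 1 \<partial>\<mu>)"
    by (intro nn_integral_eq_integral SA.integrable_inverse[OF g] eventually_mono[OF SA.admissible_positive[OF g]]) auto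
  finally show ?thesis unfolding A_def SA.moment_def .
qed

lemma mean_reciprocal_b:
  assumes j: "j \<ge> 1" and z: "z < \<beta>"
  shows "(\<integral>\<^sup>+ab. ennreal (1 / (snd ab j - z)) \<partial>\<mu>) = ennreal (B z)"
proof -
  have g: "SB.admissible (- z)" using z by (intro SB.admissible_interior) simp
  have "(\<integral>\<^sup>+ab. ennreal (1 / (snd ab j - z)) \<partial>\<mu>) = (\<integral>\<^sup>+ab. ennreal (1 / (snd (map_prod (shift 0) (shift (j - 1)) ab) 1 - z)) \<partial>\<mu>)"
    using j by (simp add: shift_apply)
  also have "\<dots> = (\<integral>\<^sup>+ab. ennreal (1 / (snd ab 1 - z)) \<partial>\<mu>)"
    by (rule nn_integral_shift) measurable
  also have "\<dots> = (\<integral>\<^sup>+ab. ennreal (1 / (b1 ab + - z) ^ 1) \<partial>\<mu>)"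
    by (simp add: b1_def)
  also have "\<dots> = ennreal (\<integral>ab. 1 / (b1 ab + - z) ^ 1 \<partial>\<mu>)"
    by (intro nn_integral_eq_integral SB.integrable_inverse[OF g] eventually_mono[OF SB.admissible_positive[OF g]]) auto
  finally show ?thesis unfolding B_def SB.moment_def .
qed

lemma nn_integral_quenched:
  assumes "\<And>k. rate z ab k > 0" and [measurable]: "f \<in> borel_measurable (expo_product (rate z ab))"
  shows "(\<integral>\<^sup>+e. f (weight z (ab, e)) \<partial>unit_weights) = (\<integral>\<^sup>+w. f w \<partial>expo_product (rate z ab))"
proof -
  note [measurable] = quenched_law(1)[of z ab, OF assms(1)]
  have "(\<integral>\<^sup>+w. f w \<partial>expo_product (rate z ab)) = (\<integral>\<^sup>+w. f w \<partial>distr unit_weights (expo_product (rate z ab)) (\<lambda>e. weight z (ab, e)))"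
    by (simp only: quenched_law(2)[of z ab, OF assms(1)])
  also have "\<dots> = (\<integral>\<^sup>+e. f (weight z (ab, e)) \<partial>unit_weights)"
    by (rule nn_integral_distr) measurable
  finally show ?thesis by (rule sym)
qed

lemma measurable_stationary_lpp [measurable]: "(\<lambda>x. lpp (weight z x) m n) \<in> borel_measurable \<Omega>"
  by (rule measurable_lpp) measurable

text \<open>
  The Burke property gives the conditional mean as a sum over the two axes, and stationarity of the
  environment integrates it exactly, without any limit.
\<close>

lemma stationary_mean:
  assumes z: "- \<alpha> < z" "z < \<beta>"
  shows "(\<integral>\<^sup>+x. ennreal (lpp (weight z x) m n) \<partial>\<Omega>) = ennreal (real m * A z + real n * B z)"
proof -
  have pos: "A z > 0" "B z > 0"
    using z by (auto intro: A_pos B_pos)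
  have "(\<integral>\<^sup>+x. ennreal (lpp (weight z x) m n) \<partial>\<Omega>) = (\<integral>\<^sup>+ab. \<integral>\<^sup>+e. ennreal (lpp (weight z (ab, e)) m n) \<partial>unit_weights \<partial>\<mu>)"
    by (rule unit.nn_integral_fst[symmetric]) measurable
  also have "\<dots> = (\<integral>\<^sup>+ab. (\<Sum>i=1..m. ennreal (1 / (fst ab i + z))) + (\<Sum>j=1..n. ennreal (1 / (snd ab j - z))) \<partial>\<mu>)"
  proof (intro nn_integral_cong_AE)
    show "AE ab in \<mu>. (\<integral>\<^sup>+e. ennreal (lpp (weight z (ab, e)) m n) \<partial>unit_weights)
      = (\<Sum>i=1..m. ennreal (1 / (fst ab i + z))) + (\<Sum>j=1..n. ennreal (1 / (snd ab j - z)))"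
      using AE_regular_env
    proof eventually_elim
      case (elim ab)
      note r = rate_pos[OF elim z]
      have "(\<integral>\<^sup>+e. ennreal (lpp (weight z (ab, e)) m n) \<partial>unit_weights) = (\<integral>\<^sup>+w. ennreal (lpp w m n) \<partial>expo_product (rate z ab))"
        by (rule nn_integral_quenched[OF r]) (intro measurable_compose[OF measurable_lpp measurable_ennreal] measurable_expo_component)
      also have "\<dots> = ennreal ((\<Sum>i=1..m. 1 / rate z ab (i, 0)) + (\<Sum>j=1..n. 1 / rate z ab (0, j)))"
        by (rule lpp_expectation[of "rate z ab", OF r rate_additive])
      also have "\<dots> = (\<Sum>i=1..m. ennreal (1 / rate z ab (i, 0))) + (\<Sum>j=1..n. ennreal (1 / rate z ab (0, j)))"
        using r by (simp add: less_imp_le sum_nonneg)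
      finally show ?case by (simp add: rate_def)
    qed
  qed
  also have "\<dots> = (\<Sum>i=1..m. (\<integral>\<^sup>+ab. ennreal (1 / (fst ab i + z)) \<partial>\<mu>)) + (\<Sum>j=1..n. (\<integral>\<^sup>+ab. ennreal (1 / (snd ab j - z)) \<partial>\<mu>))"
    by (simp add: nn_integral_add nn_integral_sum)
  also have "\<dots> = (\<Sum>i=1..m. ennreal (A z)) + (\<Sum>j=1..n. ennreal (B z))"
    using z by (intro arg_cong2[where f="(+)"] sum.cong refl mean_reciprocal_a mean_reciprocal_b) auto
  also have "\<dots> = ennreal (real m * A z + real n * B z)"
    using pos by (simp add: ennreal_mult ennreal_of_nat_eq_real_of_nat)
  finally show ?thesis .
qed

lemma stationary_second_moment:
  assumes z: "- \<alpha> < z" "z < \<beta>"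
  defines "\<rho> \<equiv> min (\<alpha> + z) (\<beta> - z)"
  shows "(\<integral>\<^sup>+x. ennreal ((lpp (weight z x) m n)\<^sup>2) \<partial>\<Omega>) \<le> ennreal (4 * (real (m + n))\<^sup>2 / \<rho>\<^sup>2)"
proof -
  have \<rho>: "\<rho> > 0" using z by (simp add: \<rho>_def)
  have "(\<integral>\<^sup>+x. ennreal ((lpp (weight z x) m n)\<^sup>2) \<partial>\<Omega>) = (\<integral>\<^sup>+ab. \<integral>\<^sup>+e. ennreal ((lpp (weight z (ab, e)) m n)\<^sup>2) \<partial>unit_weights \<partial>\<mu>)"
    by (rule unit.nn_integral_fst[symmetric]) measurable
  also have "\<dots> \<le> (\<integral>\<^sup>+ab. ennreal (4 * (real (m + n))\<^sup>2 / \<rho>\<^sup>2) \<partial>\<mu>)"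
  proof (intro nn_integral_mono_AE)
    show "AE ab in \<mu>. (\<integral>\<^sup>+e. ennreal ((lpp (weight z (ab, e)) m n)\<^sup>2) \<partial>unit_weights) \<le> ennreal (4 * (real (m + n))\<^sup>2 / \<rho>\<^sup>2)"
      using AE_regular_env
    proof eventually_elim
      case (elim ab)
      note r = rate_pos[OF elim z]
      have "(\<lambda>w. lpp w m n) \<in> borel_measurable (expo_product (rate z ab))"
        by (rule measurable_lpp) measurable
      then have "(\<integral>\<^sup>+e. ennreal ((lpp (weight z (ab, e)) m n)\<^sup>2) \<partial>unit_weights) = (\<integral>\<^sup>+w. ennreal ((lpp w m n)\<^sup>2) \<partial>expo_product (rate z ab))"
        by (intro nn_integral_quenched[OF r]) measurable
      also have "\<dots> \<le> ennreal (4 * (real (m + n))\<^sup>2 / \<rho>\<^sup>2)"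
      proof (rule lpp_second_moment[of "rate z ab" \<rho>, OF r rate_additive \<rho>])
        fix k :: nat assume "k \<ge> 1"
        then have "\<alpha> \<le> fst ab k" "\<beta> \<le> snd ab k" using elim by (auto simp: regular_env_def)
        then show "\<rho> \<le> rate z ab (k, 0) \<and> \<rho> \<le> rate z ab (0, k)"
          using \<open>k \<ge> 1\<close> by (simp add: rate_def \<rho>_def min_le_iff_disj)
      qed
      finally show ?case .
    qed
  qed
  also have "\<dots> = ennreal (4 * (real (m + n))\<^sup>2 / \<rho>\<^sup>2)"
    by (simp add: env.emeasure_space_1)
  finally show ?thesis .
qed

lemma AE_weight_nonneg:
  assumes z: "- \<alpha> < z" "z < \<beta>"
  shows "AE x in \<Omega>. \<forall>k. weight z x k \<ge> 0"
  using AE_\<Omega>_nonneg AE_\<Omega>_env[OF AE_regular_env]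
proof eventually_elim
  case (elim x)
  show ?case using elim(1) rate_pos[OF elim(2) z] by (simp add: weight_def less_imp_le)
qed

lemma passage_weight: "passage k l x = lpp (bulk k l (weight z x))"
  unfolding passage_def by (subst bulk_weight[of k l 0 x z]) simp

lemma AE_passage_le_stationary:
  assumes z: "- \<alpha> < z" "z < \<beta>"
  shows "AE x in \<Omega>. passage 0 0 x m n \<le> lpp (weight z x) m n"
  using AE_weight_nonneg[OF z]
proof eventually_elim
  case (elim x)
  show ?case unfolding passage_weight[of 0 0 x z]
    by (rule lpp_mono) (use elim in \<open>auto simp: bulk_def\<close>)
qed

lemma exists_interior: "\<exists>z. - \<alpha> < z \<and> z < \<beta>"
  using pos by (intro dense) simp

lemma AE_passage_nonneg: "AE x in \<Omega>. passage k l x m n \<ge> 0"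
proof -
  obtain z where z: "- \<alpha> < z" "z < \<beta>" using exists_interior by blast
  show ?thesis using AE_weight_nonneg[OF z]
  proof eventually_elim
    case (elim x)
    show ?case unfolding passage_weight[of k l x z]
      by (rule lpp_bulk_nonneg) (use elim in blast)
  qed
qed

text \<open>
  Fatou's lemma: \<open>g\<close> is deterministic, so it is its own integral.
\<close>

lemma g_le_stationary:
  assumes st: "s > 0" "t > 0" and z: "- \<alpha> < z" "z < \<beta>"
  shows "g s t \<le> ennreal (s * A z + t * B z)"
proof -
  let ?m = "\<lambda>n. grid n s" and ?k = "\<lambda>n. grid n t"
  have pos: "A z > 0" "B z > 0"
    using z by (auto intro: A_pos B_pos)
  have "g s t = (\<integral>\<^sup>+x. g s t \<partial>\<Omega>)" by (simp add: prod.P.emeasure_space_1)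
  also have "\<dots> = (\<integral>\<^sup>+x. liminf (\<lambda>n. ennreal (passage 0 0 x (?m n) (?k n) / real n)) \<partial>\<Omega>)"
    using shape_on_\<Omega>[OF st] by (intro nn_integral_cong_AE) (auto elim!: eventually_mono dest!: lim_imp_Liminf[rotated])
  also have "\<dots> \<le> liminf (\<lambda>n. \<integral>\<^sup>+x. ennreal (passage 0 0 x (?m n) (?k n) / real n) \<partial>\<Omega>)"
    by (rule nn_integral_liminf) measurable
  also have "\<dots> \<le> liminf (\<lambda>n. ennreal (real (?m n) / real n * A z + real (?k n) / real n * B z))"
  proof (intro Liminf_mono always_eventually allI)
    fix n
    have "(\<integral>\<^sup>+x. ennreal (passage 0 0 x (?m n) (?k n) / real n) \<partial>\<Omega>)
        \<le> (\<integral>\<^sup>+x. ennreal (1 / real n) * ennreal (lpp (weight z x) (?m n) (?k n)) \<partial>\<Omega>)"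
    proof (rule nn_integral_mono_AE)
      show "AE x in \<Omega>. ennreal (passage 0 0 x (?m n) (?k n) / real n) \<le> ennreal (1 / real n) * ennreal (lpp (weight z x) (?m n) (?k n))"
        using AE_passage_le_stationary[OF z]
        by eventually_elim (auto simp: ennreal_mult'[symmetric] intro!: ennreal_leI divide_right_mono)
    qed
    also have "\<dots> = ennreal (1 / real n) * ennreal (real (?m n) * A z + real (?k n) * B z)"
      by (subst nn_integral_cmult, measurable) (simp only: stationary_mean[OF z])
    also have "\<dots> = ennreal (real (?m n) / real n * A z + real (?k n) / real n * B z)"
      by (subst ennreal_mult'[symmetric]) (auto simp: field_simps add_divide_distrib)
    finally show "(\<integral>\<^sup>+x. ennreal (passage 0 0 x (?m n) (?k n) / real n) \<partial>\<Omega>) \<le> \<dots>" .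
  qed
  also have "\<dots> = ennreal (s * A z + t * B z)"
    using st by (intro lim_imp_Liminf tendsto_ennrealI tendsto_intros floor_ratio) auto
  finally show ?thesis .
qed

text \<open>
  The real value of the shape function; no information is lost since \<open>g\<close> is finite
  (\<open>g_eq_real_shape\<close>).
\<close>

definition real_shape :: "real \<Rightarrow> real \<Rightarrow> real" where
  "real_shape s t = enn2real (g s t)"

lemma g_eq_real_shape:
  assumes "s > 0" "t > 0"
  shows "g s t = ennreal (real_shape s t)"
proof -
  obtain z where z: "- \<alpha> < z" "z < \<beta>" using exists_interior by blast
  have "g s t < top" using g_le_stationary[OF assms z] by (rule le_less_trans) simp
  then show ?thesis by (simp add: real_shape_def)
qed

lemma real_shape_nonneg: "real_shape s t \<ge> 0"
  by (simp add: real_shape_def)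

lemma real_shape_le_stationary:
  assumes "s > 0" "t > 0" "- \<alpha> < z" "z < \<beta>"
  shows "real_shape s t \<le> s * A z + t * B z"
proof -
  have "A z > 0" "B z > 0"
    using assms by (auto intro: A_pos B_pos)
  then have "0 \<le> s * A z + t * B z" using assms by simp
  then show ?thesis using g_le_stationary[OF assms] by (simp add: g_eq_real_shape assms ennreal_le_iff)
qed

text \<open>
  Passage times from a moving starting point need not converge almost surely along with those from the
  origin. In probability they do, because shifts of environment and weights preserve the joint law.
\<close>

lemma passage_tends_prob:
  assumes st: "s > 0" "t > 0"
  shows "prod.P.tends_prob (\<lambda>n x. passage (k n) (l n) x (grid n s) (grid n t) / real n) (real_shape s t)"
proof -
  let ?X = "\<lambda>k l n x. passage k l x (grid n s) (grid n t) / real n"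
  have "prod.P.tends_prob (?X 0 0) (real_shape s t)"
  proof (rule prod.P.tends_prob_AE)
    have "AE x in \<Omega>. \<forall>n. ?X 0 0 n x \<ge> 0"
      unfolding AE_all_countable
    proof
      fix n
      show "AE x in \<Omega>. ?X 0 0 n x \<ge> 0"
        using AE_passage_nonneg[of 0 0 "grid n s" "grid n t"]
        by eventually_elim (rule divide_nonneg_nonneg[OF _ of_nat_0_le_iff])
    qed
    with shape_on_\<Omega>[OF st] show "AE x in \<Omega>. (\<lambda>n. ?X 0 0 n x) \<longlonglongrightarrow> real_shape s t"
    proof eventually_elim
      case (elim x)
      then show ?case unfolding g_eq_real_shape[OF st]
        by (subst (asm) tendsto_ennreal_iff) (auto simp: real_shape_nonneg)
    qed
  qed measurable
  then have lim: "(\<lambda>n. prod.P.prob {x \<in> space \<Omega>. e < \<bar>?X 0 0 n x - real_shape s t\<bar>}) \<longlonglongrightarrow> 0" if "e > 0" for e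
    using that by (simp add: prod.P.tends_prob_def)
  have eq: "prod.P.prob {x \<in> space \<Omega>. e < \<bar>?X k l n x - real_shape s t\<bar>} = prod.P.prob {x \<in> space \<Omega>. e < \<bar>?X 0 0 n x - real_shape s t\<bar>}" for k l n e
  proof -
    have "prod.P.prob {x \<in> space \<Omega>. e < \<bar>?X 0 0 n x - real_shape s t\<bar>} = measure (distr \<Omega> \<Omega> (space_shift k l)) {x \<in> space \<Omega>. e < \<bar>?X 0 0 n x - real_shape s t\<bar>}"
      by (simp only: distr_space_shift)
    also have "\<dots> = prod.P.prob (space_shift k l -` {x \<in> space \<Omega>. e < \<bar>?X 0 0 n x - real_shape s t\<bar>} \<inter> space \<Omega>)"
      by (rule measure_distr) measurable
    also have "space_shift k l -` {x \<in> space \<Omega>. e < \<bar>?X 0 0 n x - real_shape s t\<bar>} \<inter> space \<Omega> = {x \<in> space \<Omega>. e < \<bar>?X k l n x - real_shape s t\<bar>}"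
      using measurable_space[OF measurable_space_shift] by (auto simp: passage_space_shift)
    finally show ?thesis by simp
  qed
  show ?thesis
    unfolding prod.P.tends_prob_def
  proof (intro conjI allI impI)
    fix e :: real assume "e > 0"
    then show "(\<lambda>n. prod.P.prob {x \<in> space \<Omega>. e < \<bar>?X (k n) (l n) n x - real_shape s t\<bar>}) \<longlonglongrightarrow> 0"
      by (subst eq) (rule lim)
  qed measurable
qed

lemma real_shape_mono:
  assumes "0 < s'" "s' \<le> s" "0 < t'" "t' \<le> t"
  shows "real_shape s' t' \<le> real_shape s t"
proof -
  have "s > 0" "t > 0" using assms by auto
  note lims = passage_tends_prob[OF assms(1,3), of "\<lambda>_. 0" "\<lambda>_. 0"] passage_tends_prob[OF this, of "\<lambda>_. 0" "\<lambda>_. 0"]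
  obtain z where z: "- \<alpha> < z" "z < \<beta>" using exists_interior by blast
  have le: "grid n s' \<le> grid n s" "grid n t' \<le> grid n t" for n
    using assms by (auto intro!: nat_mono floor_mono mult_left_mono)
  have "\<forall>\<^sub>F n in sequentially. AE x in \<Omega>. x \<in> space \<Omega> \<longrightarrow>
      passage 0 0 x (grid n s') (grid n t') / real n \<le> passage 0 0 x (grid n s) (grid n t) / real n"
  proof (rule always_eventually, rule allI)
    fix n
    show "AE x in \<Omega>. x \<in> space \<Omega> \<longrightarrow>
      passage 0 0 x (grid n s') (grid n t') / real n \<le> passage 0 0 x (grid n s) (grid n t) / real n"
      using AE_weight_nonneg[OF z]
    proof eventually_elim
      case (elim x)
      have "passage 0 0 x (grid n s') (grid n t') \<le> passage 0 0 x (grid n s) (grid n t)"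
        unfolding passage_weight[of 0 0 x z] by (rule lpp_bulk_le) (use elim le in auto)
      then show ?case by (intro impI divide_right_mono of_nat_0_le_iff)
    qed
  qed
  then show ?thesis
    by (rule prod.P.tends_prob_le_on_event[OF lims sets.top, rotated]) (simp add: prod.P.prob_space)
qed

section \<open>Laws of large numbers and detours along an axis\<close>

abbreviation "diag_shift \<equiv> map_prod (shift 1) (shift 1) :: env \<Rightarrow> env"

lemma measurable_diag_shift_pow [measurable]: "(diag_shift ^^ i) \<in> measurable \<mu> \<mu>"
  by (induction i) (auto intro: measurable_comp)

text \<open>
  Split \<open>e = (e - 1) + 1\<close>. The centred part has second moment of order \<open>1/n\<close> after normalisation, conditionally on
  the environment; the rest is an ergodic average.
\<close>

lemma weighted_unit_lln:
  fixes F :: "env \<Rightarrow> real" and \<iota> :: "nat \<Rightarrow> nat \<times> nat" and k :: "nat \<Rightarrow> nat"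
  assumes F [measurable]: "F \<in> borel_measurable \<mu>" and C: "\<And>ab. ab \<in> space \<mu> \<Longrightarrow> \<bar>F ab\<bar> \<le> C"
    and \<iota>: "inj \<iota>" and k: "(\<lambda>n. real (k n) / real n) \<longlonglongrightarrow> c" and c: "c > 0"
  shows "prod.P.tends_prob (\<lambda>n x. (\<Sum>i<k n. snd x (\<iota> i) * F ((diag_shift ^^ i) (fst x))) / real n)
    (c * (\<integral>ab. F ab \<partial>\<mu>))"
proof -
  let ?T = "diag_shift"
  let ?S = "\<lambda>n x. (\<Sum>i<k n. (snd x (\<iota> i) - 1) * F ((?T ^^ i) (fst x))) / real n"
  let ?R = "\<lambda>n x. birkhoff_sum ?T F (k n) (fst x) / real n"
  have F_i [measurable]: "(\<lambda>x. F ((?T ^^ i) (fst x))) \<in> borel_measurable \<Omega>" for i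
    by measurable
  have C_nonneg: "C \<ge> 0"
  proof -
    obtain ab where "ab \<in> space \<mu>" using env.not_empty by blast
    then show ?thesis using C[of ab] by linarith
  qed
  have 1: "prod.P.tends_prob ?S 0"
  proof (rule prod.P.tends_prob_second_moment)
    show "?S n \<in> borel_measurable \<Omega>" for n by measurable
    show "(\<integral>\<^sup>+x. ennreal ((?S n x)\<^sup>2) \<partial>\<Omega>) \<le> ennreal (real (k n) / real n * (1 / real n) * C\<^sup>2)" for n
    proof -
      have "(\<integral>\<^sup>+x. ennreal ((?S n x)\<^sup>2) \<partial>\<Omega>) = (\<integral>\<^sup>+ab. \<integral>\<^sup>+e. ennreal ((?S n (ab, e))\<^sup>2) \<partial>unit_weights \<partial>\<mu>)"
        by (rule unit.nn_integral_fst[symmetric]) measurable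
      also have "\<dots> \<le> (\<integral>\<^sup>+ab. ennreal (real (k n) / real n * (1 / real n) * C\<^sup>2) \<partial>\<mu>)"
      proof (rule nn_integral_mono)
        fix ab assume ab: "ab \<in> space \<mu>"
        let ?c = "\<lambda>i. F ((?T ^^ i) ab)"
        have "(\<integral>\<^sup>+e. ennreal ((?S n (ab, e))\<^sup>2) \<partial>unit_weights)
            = (\<integral>\<^sup>+e. ennreal (1 / (real n)\<^sup>2) * ennreal ((\<Sum>i<k n. (e (\<iota> i) - 1) * ?c i)\<^sup>2) \<partial>unit_weights)"
          by (intro nn_integral_cong) (simp add: ennreal_mult'[symmetric] power_divide)
        also have "\<dots> = ennreal (1 / (real n)\<^sup>2) * ennreal (\<Sum>i<k n. (?c i)\<^sup>2)"
          by (subst nn_integral_cmult, measurable) (simp only: expo_centred_sum_second_moment[OF \<iota>])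
        also have "\<dots> \<le> ennreal (1 / (real n)\<^sup>2) * ennreal (\<Sum>i<k n. C\<^sup>2)"
        proof (intro mult_left_mono ennreal_leI sum_mono)
          fix i
          have "(?T ^^ i) ab \<in> space \<mu>" using measurable_space[OF measurable_diag_shift_pow ab] .
          then have "\<bar>?c i\<bar> \<le> \<bar>C\<bar>" using C C_nonneg by fastforce
          then show "(?c i)\<^sup>2 \<le> C\<^sup>2" by (simp only: abs_le_square_iff)
        qed simp
        also have "\<dots> = ennreal (real (k n) / real n * (1 / real n) * C\<^sup>2)"
          by (subst ennreal_mult'[symmetric]) (auto simp: power2_eq_square)
        finally show "(\<integral>\<^sup>+e. ennreal ((?S n (ab, e))\<^sup>2) \<partial>unit_weights) \<le> \<dots>" .
      qed
      also have "\<dots> = ennreal (real (k n) / real n * (1 / real n) * C\<^sup>2)"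
        by (simp add: env.emeasure_space_1)
      finally show ?thesis .
    qed
    have "(\<lambda>n. real (k n) / real n * (1 / real n) * C\<^sup>2) \<longlonglongrightarrow> c * 0 * C\<^sup>2"
      by (intro tendsto_intros k lim_1_over_n)
    then show "(\<lambda>n. real (k n) / real n * (1 / real n) * C\<^sup>2) \<longlonglongrightarrow> 0" by simp
  qed simp
  have 2: "prod.P.tends_prob ?R (c * (\<integral>ab. F ab \<partial>\<mu>))"
  proof (rule prod.P.tends_prob_AE)
    show "?R n \<in> borel_measurable \<Omega>" for n unfolding birkhoff_sum_def by measurable
    have "AE ab in \<mu>. (\<lambda>n. birkhoff_sum ?T F n ab / real n) \<longlonglongrightarrow> (\<integral>ab. F ab \<partial>\<mu>)"
      by (rule env.birkhoff_bounded[OF ergodic_diagonal F C])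
    from AE_\<Omega>_env[OF this] show "AE x in \<Omega>. (\<lambda>n. ?R n x) \<longlonglongrightarrow> c * (\<integral>ab. F ab \<partial>\<mu>)"
    proof eventually_elim
      case (elim x)
      have top: "filterlim k at_top sequentially" by (rule filterlim_of_ratio[OF k c])
      have "(\<lambda>n. real (k n) / real n * (birkhoff_sum ?T F (k n) (fst x) / real (k n))) \<longlonglongrightarrow> c * (\<integral>ab. F ab \<partial>\<mu>)"
        by (intro tendsto_mult k filterlim_compose[OF elim top])
      moreover have "\<forall>\<^sub>F n in sequentially. real (k n) / real n * (birkhoff_sum ?T F (k n) (fst x) / real (k n)) = ?R n x"
        using top[unfolded filterlim_at_top, rule_format, of 1] by eventually_elim simp
      ultimately show ?case by (rule Lim_transform_eventually)
    qed
  qed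
  have eq: "(\<Sum>i<k n. snd x (\<iota> i) * F ((?T ^^ i) (fst x))) / real n = ?S n x + ?R n x" for n x
    by (simp add: birkhoff_sum_def add_divide_distrib[symmetric] sum.distrib[symmetric] algebra_simps)
  show ?thesis using prod.P.tends_prob_add[OF 1 2] by (simp only: eq add_0)
qed

text \<open>
  The truncation in \<open>F\<close> makes it bounded on the whole space and changes it only on a null set.
\<close>

lemma row_lln:
  assumes z: "- \<alpha> < z" and k: "(\<lambda>n. real (k n) / real n) \<longlonglongrightarrow> c" and c: "c > 0"
  shows "prod.P.tends_prob (\<lambda>n x. (\<Sum>i=1..k n. snd x (i, p) / (fst (fst x) i + z)) / real n) (c * A z)"
proof -
  define F where "F ab = 1 / max (\<alpha> + z) (a1 ab + z)" for ab
  have F [measurable]: "F \<in> borel_measurable \<mu>" unfolding F_def by measurable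
  have bound: "\<bar>F ab\<bar> \<le> 1 / (\<alpha> + z)" for ab
    using z by (auto simp: F_def intro!: divide_left_mono)
  have "(\<integral>ab. F ab \<partial>\<mu>) = (\<integral>ab. 1 / (a1 ab + z) ^ 1 \<partial>\<mu>)"
    using SA.X_ge by (intro integral_cong_AE) (auto simp: F_def max_def)
  then have int: "(\<integral>ab. F ab \<partial>\<mu>) = A z" by (simp only: A_def SA.moment_def)
  have inj: "inj (\<lambda>i. (Suc i, p))" by (simp add: inj_def)
  note lln = weighted_unit_lln[OF F bound inj k c, unfolded int]
  show ?thesis
  proof (rule prod.P.tends_prob_cong_AE[OF lln])
    show "(\<lambda>x. (\<Sum>i=1..k n. snd x (i, p) / (fst (fst x) i + z)) / real n) \<in> borel_measurable \<Omega>" for n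
      by measurable
    fix n
    show "AE x in \<Omega>. (\<Sum>i<k n. snd x (Suc i, p) * F ((diag_shift ^^ i) (fst x))) / real n
        = (\<Sum>i=1..k n. snd x (i, p) / (fst (fst x) i + z)) / real n"
      using AE_\<Omega>_env[OF AE_regular_env] AE_space
    proof eventually_elim
      case (elim x)
      have sp: "fst x \<in> space \<mu>" using elim(2) by (auto simp: space_pair_measure)
      have "F ((diag_shift ^^ i) (fst x)) = 1 / (fst (fst x) (Suc i) + z)" for i
      proof -
        have "a1 ((diag_shift ^^ i) (fst x)) = fst (fst x) (Suc i)"
          unfolding a1_def by (subst funpow_shift) (auto simp: sp shift_apply)
        moreover have "\<alpha> \<le> fst (fst x) (Suc i)" using elim(1) by (simp add: regular_env_def)
        ultimately show ?thesis by (simp add: F_def max_def)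
      qed
      then show ?case by (simp add: sum.atLeast1_atMost_eq)
    qed
  qed
qed

lemma column_lln:
  assumes z: "z < \<beta>" and k: "(\<lambda>n. real (k n) / real n) \<longlonglongrightarrow> c" and c: "c > 0"
  shows "prod.P.tends_prob (\<lambda>n x. (\<Sum>j=1..k n. snd x (p, j) / (snd (fst x) j - z)) / real n) (c * B z)"
proof -
  define F where "F ab = 1 / max (\<beta> - z) (b1 ab - z)" for ab
  have F [measurable]: "F \<in> borel_measurable \<mu>" unfolding F_def by measurable
  have bound: "\<bar>F ab\<bar> \<le> 1 / (\<beta> - z)" for ab
    using z by (auto simp: F_def intro!: divide_left_mono)
  have "(\<integral>ab. F ab \<partial>\<mu>) = (\<integral>ab. 1 / (b1 ab + - z) ^ 1 \<partial>\<mu>)"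
    using SB.X_ge by (intro integral_cong_AE) (auto simp: F_def max_def)
  then have int: "(\<integral>ab. F ab \<partial>\<mu>) = B z" by (simp only: B_def SB.moment_def)
  have inj: "inj (\<lambda>j. (p, Suc j))" by (simp add: inj_def)
  note lln = weighted_unit_lln[OF F bound inj k c, unfolded int]
  show ?thesis
  proof (rule prod.P.tends_prob_cong_AE[OF lln])
    show "(\<lambda>x. (\<Sum>j=1..k n. snd x (p, j) / (snd (fst x) j - z)) / real n) \<in> borel_measurable \<Omega>" for n
      by measurable
    fix n
    show "AE x in \<Omega>. (\<Sum>j<k n. snd x (p, Suc j) * F ((diag_shift ^^ j) (fst x))) / real n
        = (\<Sum>j=1..k n. snd x (p, j) / (snd (fst x) j - z)) / real n"
      using AE_\<Omega>_env[OF AE_regular_env] AE_space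
    proof eventually_elim
      case (elim x)
      have sp: "fst x \<in> space \<mu>" using elim(2) by (auto simp: space_pair_measure)
      have "F ((diag_shift ^^ j) (fst x)) = 1 / (snd (fst x) (Suc j) - z)" for j
      proof -
        have "b1 ((diag_shift ^^ j) (fst x)) = snd (fst x) (Suc j)"
          unfolding b1_def by (subst funpow_shift) (auto simp: sp shift_apply)
        moreover have "\<beta> \<le> snd (fst x) (Suc j)" using elim(1) by (simp add: regular_env_def)
        ultimately show ?thesis by (simp add: F_def max_def)
      qed
      then show ?case by (simp add: sum.atLeast1_atMost_eq)
    qed
  qed
qed

lemma eventually_floor_ge_1: "s > 0 \<Longrightarrow> \<forall>\<^sub>F n in sequentially. grid n s \<ge> 1"
  using nat_floor_at_top[of s] unfolding filterlim_at_top by blast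

text \<open>
  On the event \<open>a\<^sub>1 < \<alpha> + d\<close>, climbing the first column collects at least \<open>e(1,j) / (b\<^sub>j + \<alpha> + d)\<close> at height
  \<open>j\<close>, a sum to which the law of large numbers applies regardless of the event. The event has fixed positive
  probability, and both limits are constants.
\<close>

lemma column_detour:
  assumes s: "s > 0" and y: "0 < y" "y < t" and d: "d > 0"
  shows "y * B (- (\<alpha> + d)) + real_shape s (t - y) \<le> real_shape s t"
proof -
  let ?k = "\<lambda>n. grid n t - grid n (t - y)"
  let ?m = "\<lambda>n. grid n s" and ?u = "\<lambda>n. grid n (t - y)"
  let ?E = "{x \<in> space \<Omega>. fst (fst x) 1 < \<alpha> + d}"
  have t: "t > 0" "t - y > 0" using y by auto
  have k: "(\<lambda>n. real (?k n) / real n) \<longlonglongrightarrow> y" using floor_gap_ratio[of "t - y" t] y by simp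
  have z: "- (\<alpha> + d) < \<beta>" using pos d by simp
  note lims = prod.P.tends_prob_add[OF column_lln[OF z k y(1), of 1] passage_tends_prob[OF s t(2), of "\<lambda>_. 0" ?k]]
    passage_tends_prob[OF s t(1), of "\<lambda>_. 0" "\<lambda>_. 0"]
  have E [measurable]: "?E \<in> prod.P.events" by measurable
  have "prod.P.prob ?E = measure (distr \<Omega> \<mu> fst) {ab \<in> space \<mu>. fst ab 1 < \<alpha> + d}"
    by (subst measure_distr) (auto simp: space_pair_measure intro!: arg_cong[where f=prod.P.prob])
  then have E_pos: "prod.P.prob ?E > 0"
    using alpha_near[OF d] by (simp only: unit.distr_pair_fst)
  obtain z0 where z0: "- \<alpha> < z0" "z0 < \<beta>" using exists_interior by blast
  show ?thesis
  proof (rule prod.P.tends_prob_le_on_event[OF lims E E_pos])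
    show "\<forall>\<^sub>F n in sequentially. AE x in \<Omega>. x \<in> ?E \<longrightarrow>
      (\<Sum>j=1..?k n. snd x (1, j) / (snd (fst x) j - - (\<alpha> + d))) / real n + passage 0 (?k n) x (?m n) (?u n) / real n
      \<le> passage 0 0 x (?m n) (grid n t) / real n"
      using eventually_floor_ge_1[OF s] eventually_floor_ge_1[OF t(2)]
    proof eventually_elim
      case (elim n)
      have sum: "?u n + ?k n = grid n t"
      proof -
        have "?u n \<le> grid n t" using y by (intro nat_mono floor_mono mult_left_mono) auto
        then show ?thesis by simp
      qed
      show ?case
        using AE_weight_nonneg[OF z0] AE_\<Omega>_env[OF AE_regular_env] AE_\<Omega>_nonneg
      proof eventually_elim
        case (elim x)
        show ?case
        proof
          assume x: "x \<in> ?E"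
          have w: "\<And>k. weight z0 x k \<ge> 0" using elim(1) by blast
          have "(\<Sum>j=1..?k n. snd x (1, j) / (snd (fst x) j - - (\<alpha> + d))) \<le> (\<Sum>j=1..?k n. weight z0 x (1, j))"
          proof (rule sum_mono)
            fix j assume j: "j \<in> {1..?k n}"
            have "\<beta> \<le> snd (fst x) j" "\<alpha> \<le> fst (fst x) 1" using elim(2) j by (auto simp: regular_env_def)
            moreover have "fst (fst x) 1 < \<alpha> + d" using x by simp
            ultimately have "0 < fst (fst x) 1 + snd (fst x) j" "fst (fst x) 1 + snd (fst x) j \<le> snd (fst x) j - - (\<alpha> + d)"
              using pos by linarith+
            moreover have "0 \<le> snd x (1, j)" using elim(3) by blast
            ultimately have "snd x (1, j) / (snd (fst x) j - - (\<alpha> + d)) \<le> snd x (1, j) / (fst (fst x) 1 + snd (fst x) j)"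
              by (intro frac_le order_refl)
            also have "\<dots> = weight z0 x (1, j)" using j by (simp add: weight_def rate_def)
            finally show "snd x (1, j) / (snd (fst x) j - - (\<alpha> + d)) \<le> weight z0 x (1, j)" .
          qed
          moreover have "(\<Sum>j=1..?k n. weight z0 x (1, j)) + passage 0 (?k n) x (?m n) (?u n) \<le> passage 0 0 x (?m n) (grid n t)"
            using first_column_then_bulk_le[of "weight z0 x" "?m n" "?u n" "?k n", OF w \<open>1 \<le> ?m n\<close> \<open>1 \<le> ?u n\<close>]
            unfolding passage_weight[of _ _ x z0] sum .
          ultimately have "(\<Sum>j=1..?k n. snd x (1, j) / (snd (fst x) j - - (\<alpha> + d))) + passage 0 (?k n) x (?m n) (?u n)
              \<le> passage 0 0 x (?m n) (grid n t)" by linarith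
          then show "(\<Sum>j=1..?k n. snd x (1, j) / (snd (fst x) j - - (\<alpha> + d))) / real n + passage 0 (?k n) x (?m n) (?u n) / real n
              \<le> passage 0 0 x (?m n) (grid n t) / real n"
            unfolding add_divide_distrib[symmetric] by (intro divide_right_mono of_nat_0_le_iff)
        qed
      qed
    qed
  qed
qed

lemma row_detour:
  assumes t: "t > 0" and y: "0 < y" "y < s" and d: "d > 0"
  shows "y * A (\<beta> + d) + real_shape (s - y) t \<le> real_shape s t"
proof -
  let ?k = "\<lambda>n. grid n s - grid n (s - y)"
  let ?m = "\<lambda>n. grid n t" and ?u = "\<lambda>n. grid n (s - y)"
  let ?E = "{x \<in> space \<Omega>. snd (fst x) 1 < \<beta> + d}"
  have s: "s > 0" "s - y > 0" using y by auto
  have k: "(\<lambda>n. real (?k n) / real n) \<longlonglongrightarrow> y" using floor_gap_ratio[of "s - y" s] y by simp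
  have z: "- \<alpha> < \<beta> + d" using pos d by simp
  note lims = prod.P.tends_prob_add[OF row_lln[OF z k y(1), of 1] passage_tends_prob[OF s(2) t, of ?k "\<lambda>_. 0"]]
    passage_tends_prob[OF s(1) t, of "\<lambda>_. 0" "\<lambda>_. 0"]
  have E [measurable]: "?E \<in> prod.P.events" by measurable
  have "prod.P.prob ?E = measure (distr \<Omega> \<mu> fst) {ab \<in> space \<mu>. snd ab 1 < \<beta> + d}"
    by (subst measure_distr) (auto simp: space_pair_measure intro!: arg_cong[where f=prod.P.prob])
  then have E_pos: "prod.P.prob ?E > 0"
    using beta_near[OF d] by (simp only: unit.distr_pair_fst)
  obtain z0 where z0: "- \<alpha> < z0" "z0 < \<beta>" using exists_interior by blast
  show ?thesis
  proof (rule prod.P.tends_prob_le_on_event[OF lims E E_pos])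
    show "\<forall>\<^sub>F n in sequentially. AE x in \<Omega>. x \<in> ?E \<longrightarrow>
      (\<Sum>i=1..?k n. snd x (i, 1) / (fst (fst x) i + (\<beta> + d))) / real n + passage (?k n) 0 x (?u n) (?m n) / real n
      \<le> passage 0 0 x (grid n s) (?m n) / real n"
      using eventually_floor_ge_1[OF t] eventually_floor_ge_1[OF s(2)]
    proof eventually_elim
      case (elim n)
      have sum: "?u n + ?k n = grid n s"
      proof -
        have "?u n \<le> grid n s" using y by (intro nat_mono floor_mono mult_left_mono) auto
        then show ?thesis by simp
      qed
      show ?case
        using AE_weight_nonneg[OF z0] AE_\<Omega>_env[OF AE_regular_env] AE_\<Omega>_nonneg
      proof eventually_elim
        case (elim x)
        show ?case
        proof
          assume x: "x \<in> ?E"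
          have w: "\<And>k. weight z0 x k \<ge> 0" using elim(1) by blast
          have "(\<Sum>i=1..?k n. snd x (i, 1) / (fst (fst x) i + (\<beta> + d))) \<le> (\<Sum>i=1..?k n. weight z0 x (i, 1))"
          proof (rule sum_mono)
            fix i assume i: "i \<in> {1..?k n}"
            have "\<alpha> \<le> fst (fst x) i" "\<beta> \<le> snd (fst x) 1" using elim(2) i by (auto simp: regular_env_def)
            moreover have "snd (fst x) 1 < \<beta> + d" using x by simp
            ultimately have "0 < fst (fst x) i + snd (fst x) 1" "fst (fst x) i + snd (fst x) 1 \<le> fst (fst x) i + (\<beta> + d)"
              using pos by linarith+
            moreover have "0 \<le> snd x (i, 1)" using elim(3) by blast
            ultimately have "snd x (i, 1) / (fst (fst x) i + (\<beta> + d)) \<le> snd x (i, 1) / (fst (fst x) i + snd (fst x) 1)"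
              by (intro frac_le order_refl)
            also have "\<dots> = weight z0 x (i, 1)" using i by (simp add: weight_def rate_def)
            finally show "snd x (i, 1) / (fst (fst x) i + (\<beta> + d)) \<le> weight z0 x (i, 1)" .
          qed
          moreover have "(\<Sum>i=1..?k n. weight z0 x (i, 1)) + passage (?k n) 0 x (?u n) (?m n) \<le> passage 0 0 x (grid n s) (?m n)"
            using first_row_then_bulk_le[of "weight z0 x" "?u n" "?m n" "?k n", OF w \<open>1 \<le> ?u n\<close> \<open>1 \<le> ?m n\<close>]
            unfolding passage_weight[of _ _ x z0] sum .
          ultimately have "(\<Sum>i=1..?k n. snd x (i, 1) / (fst (fst x) i + (\<beta> + d))) + passage (?k n) 0 x (?u n) (?m n)
              \<le> passage 0 0 x (grid n s) (?m n)" by linarith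
          then show "(\<Sum>i=1..?k n. snd x (i, 1) / (fst (fst x) i + (\<beta> + d))) / real n + passage (?k n) 0 x (?u n) (?m n) / real n
              \<le> passage 0 0 x (grid n s) (?m n) / real n"
            unfolding add_divide_distrib[symmetric] by (intro divide_right_mono of_nat_0_le_iff)
        qed
      qed
    qed
  qed
qed

section \<open>Exit points from the boundary\<close>

text \<open>
  Cut both axes into \<open>L\<close> equal pieces. If a maximal path of the stationary model leaves the horizontal axis in piece
  \<open>l\<close>, move the exit point to the right end of the piece in the boundary sum and to its left end in the passage time.
  This leaves finitely many candidates, each of which has a limit in probability. The stationary
  passage time is thus asymptotically bounded by the largest candidate, and so is its mean, which tends
  to \<open>s A(z) + t B(z)\<close>.
\<close>

lemma exit_inequality:
  assumes z: "- \<alpha> < z" "z < \<beta>" and st: "s > 0" "t > 0" and L: "L > 0"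
  shows "(\<exists>l<L. s * A z + t * B z \<le> real (Suc l) / real L * s * A z + real_shape (s - real l / real L * s) t)
       \<or> (\<exists>l<L. s * A z + t * B z \<le> real (Suc l) / real L * t * B z + real_shape s (t - real l / real L * t))"
proof -
  define x where "x l = real l / real L * s" for l
  define y where "y l = real l / real L * t" for l
  define vx where "vx l = x (Suc l) * A z + real_shape (s - x l) t" for l
  define vy where "vy l = y (Suc l) * B z + real_shape s (t - y l)" for l
  define c where "c = Max (vx ` {..<L} \<union> vy ` {..<L})"
  let ?m = "\<lambda>n. grid n s" and ?k = "\<lambda>n. grid n t"
  define mx where "mx l n = grid n (s - x l)" for l n
  define my where "my l n = grid n (t - y l)" for l n
  (* differences of integer parts, so that the number of remaining columns is exactly mx l n *)
  define kx where "kx l n = ?m n - mx l n" for l n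
  define ky where "ky l n = ?k n - my l n" for l n
  define Qx where "Qx l n u = (\<Sum>i=1..kx (Suc l) n. snd u (i, 0) / (fst (fst u) i + z)) / real n
      + passage (kx l n) 0 u (mx l n) (?k n) / real n" for l n u
  define Qy where "Qy l n u = (\<Sum>j=1..ky (Suc l) n. snd u (0, j) / (snd (fst u) j - z)) / real n
      + passage 0 (ky l n) u (?m n) (my l n) / real n" for l n u
  define X where "X n u = lpp (weight z u) (?m n) (?k n) / real n" for n u
  have AB: "A z > 0" "B z > 0" using z by (auto intro: A_pos B_pos)
  have frac: "0 \<le> real l / real L" "real l / real L < 1" "real (Suc l) / real L \<le> 1" "0 < real (Suc l) / real L" if "l < L" for l
    using that by auto
  have x: "0 \<le> x l" "x l < s" "x (Suc l) \<le> s" "0 < x (Suc l)" if "l < L" for l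
    unfolding x_def
    using mult_strict_right_mono[OF frac(2)[OF that] st(1)] mult_right_mono[OF frac(3)[OF that], of s]
      mult_pos_pos[OF frac(4)[OF that] st(1)] st by simp_all
  have y: "0 \<le> y l" "y l < t" "y (Suc l) \<le> t" "0 < y (Suc l)" if "l < L" for l
    unfolding y_def
    using mult_strict_right_mono[OF frac(2)[OF that] st(2)] mult_right_mono[OF frac(3)[OF that], of t]
      mult_pos_pos[OF frac(4)[OF that] st(2)] st by simp_all
  have v_le: "vx l \<le> c" "vy l \<le> c" if "l < L" for l
    using that by (auto simp: c_def intro!: Max_ge)
  have "0 \<le> vx 0" using x[OF L] AB real_shape_nonneg by (simp add: vx_def)
  then have c: "c \<ge> 0" using v_le(1)[OF L] by linarith
  have limx: "prod.P.tends_prob (Qx l) (vx l)" if l: "l < L" for l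
  proof -
    have "(\<lambda>n. real (kx (Suc l) n) / real n) \<longlonglongrightarrow> x (Suc l)"
      using floor_gap_ratio[of "s - x (Suc l)" s] x[OF l] by (simp add: kx_def mx_def)
    note row = row_lln[OF z(1) this x(4)[OF l], of 0]
    have "s - x l > 0" using x[OF l] by simp
    from prod.P.tends_prob_add[OF row passage_tends_prob[OF this st(2), of "kx l" "\<lambda>_. 0"]]
    show ?thesis by (simp only: Qx_def[abs_def] vx_def mx_def)
  qed
  have limy: "prod.P.tends_prob (Qy l) (vy l)" if l: "l < L" for l
  proof -
    have "(\<lambda>n. real (ky (Suc l) n) / real n) \<longlonglongrightarrow> y (Suc l)"
      using floor_gap_ratio[of "t - y (Suc l)" t] y[OF l] by (simp add: ky_def my_def)
    note column = column_lln[OF z(2) this y(4)[OF l], of 0]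
    have "t - y l > 0" using y[OF l] by simp
    from prod.P.tends_prob_add[OF column passage_tends_prob[OF st(1) this, of "\<lambda>_. 0" "ky l"]]
    show ?thesis by (simp only: Qy_def[abs_def] vy_def my_def)
  qed
  have bound: "\<exists>l<L. X n u \<le> Qx l n u \<or> X n u \<le> Qy l n u"
    if w: "\<And>k. weight z u k \<ge> 0" and mn: "?m n \<ge> 1" "?k n \<ge> 1" for n u
  proof -
    let ?w = "weight z u"
    have row: "snd u (i, 0) / (fst (fst u) i + z) = ?w (i, 0)" if "i \<in> {1..q}" for i q
      using that by (simp add: weight_def rate_def)
    have column: "snd u (0, j) / (snd (fst u) j - z) = ?w (0, j)" if "j \<in> {1..q}" for j q
      using that by (simp add: weight_def rate_def)
    obtain m' k' where m': "?m n = Suc m'" "?k n = Suc k'" using mn by (metis Suc_le_D One_nat_def)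
    consider (x) k where "k < ?m n" "lpp ?w (?m n) (?k n) \<le> (\<Sum>i=1..Suc k. ?w (i, 0)) + lpp (bulk k 0 ?w) (?m n - k) (?k n)"
      | (y) k where "k < ?k n" "lpp ?w (?m n) (?k n) \<le> (\<Sum>j=1..Suc k. ?w (0, j)) + lpp (bulk 0 k ?w) (?m n) (?k n - k)"
      using exit_point[of ?w m' k', OF w] unfolding m' by blast
    then show ?thesis
    proof cases
      case (x k)
      have ends: "kx 0 n = 0" "kx L n = ?m n" using L by (simp_all add: kx_def mx_def x_def)
      obtain l where l: "l < L" "kx l n \<le> k" "k < kx (Suc l) n"
        using exists_crossing[of "\<lambda>l. kx l n" k L] ends x(1) by auto
      have "mx l n \<le> ?m n" using \<open>\<And>l. l < L \<Longrightarrow> 0 \<le> x l\<close>[OF l(1)]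
        unfolding mx_def by (intro nat_mono floor_mono mult_left_mono) auto
      then have mx: "?m n - k + (k - kx l n) = mx l n" using l x(1) by (simp add: kx_def)
      have "(\<Sum>i=1..Suc k. ?w (i, 0)) \<le> (\<Sum>i=1..kx (Suc l) n. ?w (i, 0))"
        using l w by (intro sum_mono2) auto
      moreover have "lpp (bulk k 0 ?w) (?m n - k) (?k n) \<le> lpp (bulk (kx l n) 0 ?w) (mx l n) (?k n)"
        using lpp_bulk_drop_columns[of ?w "kx l n" k 0 "?m n - k" "?k n", OF w l(2)] by (simp only: mx)
      ultimately have "lpp ?w (?m n) (?k n) \<le> (\<Sum>i=1..kx (Suc l) n. ?w (i, 0)) + passage (kx l n) 0 u (mx l n) (?k n)"
        unfolding passage_weight[of _ _ u z] using x(2) by linarith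
      then have "X n u \<le> ((\<Sum>i=1..kx (Suc l) n. ?w (i, 0)) + passage (kx l n) 0 u (mx l n) (?k n)) / real n"
        unfolding X_def by (rule divide_right_mono[OF _ of_nat_0_le_iff])
      also have "\<dots> = Qx l n u"
        unfolding Qx_def add_divide_distrib by (simp only: row cong: sum.cong)
      finally show ?thesis using l(1) by blast
    next
      case (y k)
      have ends: "ky 0 n = 0" "ky L n = ?k n" using L by (simp_all add: ky_def my_def y_def)
      obtain l where l: "l < L" "ky l n \<le> k" "k < ky (Suc l) n"
        using exists_crossing[of "\<lambda>l. ky l n" k L] ends y(1) by auto
      have "my l n \<le> ?k n" using \<open>\<And>l. l < L \<Longrightarrow> 0 \<le> y l\<close>[OF l(1)]
        unfolding my_def by (intro nat_mono floor_mono mult_left_mono) auto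
      then have my: "?k n - k + (k - ky l n) = my l n" using l y(1) by (simp add: ky_def)
      have "(\<Sum>j=1..Suc k. ?w (0, j)) \<le> (\<Sum>j=1..ky (Suc l) n. ?w (0, j))"
        using l w by (intro sum_mono2) auto
      moreover have "lpp (bulk 0 k ?w) (?m n) (?k n - k) \<le> lpp (bulk 0 (ky l n) ?w) (?m n) (my l n)"
        using lpp_bulk_drop_rows[of ?w "ky l n" k 0 "?m n" "?k n - k", OF w l(2)] by (simp only: my)
      ultimately have "lpp ?w (?m n) (?k n) \<le> (\<Sum>j=1..ky (Suc l) n. ?w (0, j)) + passage 0 (ky l n) u (?m n) (my l n)"
        unfolding passage_weight[of _ _ u z] using y(2) by linarith
      then have "X n u \<le> ((\<Sum>j=1..ky (Suc l) n. ?w (0, j)) + passage 0 (ky l n) u (?m n) (my l n)) / real n"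
        unfolding X_def by (rule divide_right_mono[OF _ of_nat_0_le_iff])
      also have "\<dots> = Qy l n u"
        unfolding Qy_def add_divide_distrib by (simp only: column cong: sum.cong)
      finally show ?thesis using l(1) by blast
    qed
  qed
  have X_meas [measurable]: "X n \<in> borel_measurable \<Omega>" for n
    unfolding X_def by measurable
  have "s * A z + t * B z \<le> c"
  proof (rule field_le_epsilon)
    fix e :: real assume e: "e > 0"
    let ?bx = "\<lambda>l n. {u \<in> space \<Omega>. e < \<bar>Qx l n u - vx l\<bar>}" and ?by = "\<lambda>l n. {u \<in> space \<Omega>. e < \<bar>Qy l n u - vy l\<bar>}"
    define \<rho> where "\<rho> = min (\<alpha> + z) (\<beta> - z)"
    have \<rho>: "\<rho> > 0" using z by (simp add: \<rho>_def)
    show "s * A z + t * B z \<le> c + e"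
    proof (rule prod.P.mean_limit_le[where X=X and C="4 * (s + t)\<^sup>2 / \<rho>\<^sup>2" and m="\<lambda>n. real (?m n) / real n * A z + real (?k n) / real n * B z"])
      show "X n \<in> borel_measurable \<Omega>" for n by measurable
      show "AE u in \<Omega>. X n u \<ge> 0" for n
        using AE_weight_nonneg[OF z]
      proof eventually_elim
        case (elim u)
        have "lpp (weight z u) (?m n) (?k n) \<ge> 0" by (rule lpp_nonneg) (use elim in blast)
        then show ?case unfolding X_def by (rule divide_nonneg_nonneg[OF _ of_nat_0_le_iff])
      qed
      show "(\<integral>\<^sup>+u. ennreal ((X n u)\<^sup>2) \<partial>\<Omega>) \<le> ennreal (4 * (s + t)\<^sup>2 / \<rho>\<^sup>2)" for n
      proof -
        have "(\<integral>\<^sup>+u. ennreal ((X n u)\<^sup>2) \<partial>\<Omega>) = (\<integral>\<^sup>+u. ennreal (1 / (real n)\<^sup>2) * ennreal ((lpp (weight z u) (?m n) (?k n))\<^sup>2) \<partial>\<Omega>)"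
          by (intro nn_integral_cong) (simp add: X_def ennreal_mult'[symmetric] power_divide)
        also have "\<dots> = ennreal (1 / (real n)\<^sup>2) * (\<integral>\<^sup>+u. ennreal ((lpp (weight z u) (?m n) (?k n))\<^sup>2) \<partial>\<Omega>)"
          by (rule nn_integral_cmult) measurable
        also have "\<dots> \<le> ennreal (1 / (real n)\<^sup>2) * ennreal (4 * (real (?m n + ?k n))\<^sup>2 / \<rho>\<^sup>2)"
          unfolding \<rho>_def by (intro mult_left_mono stationary_second_moment[OF z]) simp
        also have "\<dots> = ennreal (4 * (real (?m n + ?k n) / real n)\<^sup>2 / \<rho>\<^sup>2)"
          by (subst ennreal_mult'[symmetric]) (auto simp: power_divide)
        also have "\<dots> \<le> ennreal (4 * (s + t)\<^sup>2 / \<rho>\<^sup>2)"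
        proof (intro ennreal_leI divide_right_mono mult_left_mono power_mono)
          have "real (?m n) \<le> real n * s" "real (?k n) \<le> real n * t" using st by auto
          then have "real (?m n + ?k n) \<le> real n * (s + t)" by (simp add: algebra_simps)
          then show "real (?m n + ?k n) / real n \<le> s + t"
            using st by (cases "n = 0") (auto simp: pos_divide_le_eq mult.commute)
        qed auto
        finally show ?thesis .
      qed
      show "(\<integral>\<^sup>+u. ennreal (X n u) \<partial>\<Omega>) = ennreal (real (?m n) / real n * A z + real (?k n) / real n * B z)" for n
      proof -
        have "(\<integral>\<^sup>+u. ennreal (X n u) \<partial>\<Omega>) = (\<integral>\<^sup>+u. ennreal (1 / real n) * ennreal (lpp (weight z u) (?m n) (?k n)) \<partial>\<Omega>)"
          by (intro nn_integral_cong) (simp add: X_def ennreal_mult'[symmetric])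
        also have "\<dots> = ennreal (1 / real n) * ennreal (real (?m n) * A z + real (?k n) * B z)"
          by (subst nn_integral_cmult, measurable) (simp only: stationary_mean[OF z])
        also have "\<dots> = ennreal (real (?m n) / real n * A z + real (?k n) / real n * B z)"
          by (subst ennreal_mult'[symmetric]) (auto simp: add_divide_distrib)
        finally show ?thesis .
      qed
      show "(\<lambda>n. real (?m n) / real n * A z + real (?k n) / real n * B z) \<longlonglongrightarrow> s * A z + t * B z"
        using st by (intro tendsto_intros floor_ratio) auto
      show "0 \<le> real (?m n) / real n * A z + real (?k n) / real n * B z" for n
        using AB by simp
      show "(\<lambda>n. prod.P.prob {u \<in> space \<Omega>. c + e < X n u}) \<longlonglongrightarrow> 0"
      proof (rule Lim_null_comparison)
        have meas: "?bx l n \<in> prod.P.events" "?by l n \<in> prod.P.events" if "l < L" for l n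
          using prod.P.tends_prob_measurable[OF limx[OF that], of n] prod.P.tends_prob_measurable[OF limy[OF that], of n] by measurable
        show "\<forall>\<^sub>F n in sequentially. norm (prod.P.prob {u \<in> space \<Omega>. c + e < X n u})
            \<le> (\<Sum>l<L. prod.P.prob (?bx l n) + prod.P.prob (?by l n))"
          using eventually_floor_ge_1[OF st(1)] eventually_floor_ge_1[OF st(2)]
        proof eventually_elim
          case (elim n)
          have "prod.P.prob {u \<in> space \<Omega>. c + e < X n u} \<le> prod.P.prob (\<Union>l\<in>{..<L}. ?bx l n \<union> ?by l n)"
          proof (rule prod.P.finite_measure_mono_AE)
            show "AE u in \<Omega>. u \<in> {u \<in> space \<Omega>. c + e < X n u} \<longrightarrow> u \<in> (\<Union>l\<in>{..<L}. ?bx l n \<union> ?by l n)"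
              using AE_weight_nonneg[OF z]
            proof eventually_elim
              case (elim u)
              show ?case
              proof
                assume u: "u \<in> {u \<in> space \<Omega>. c + e < X n u}"
                obtain l where l: "l < L" "X n u \<le> Qx l n u \<or> X n u \<le> Qy l n u"
                  using bound[of u n] elim \<open>1 \<le> ?m n\<close> \<open>1 \<le> ?k n\<close> by blast
                then have "e < \<bar>Qx l n u - vx l\<bar> \<or> e < \<bar>Qy l n u - vy l\<bar>"
                  using u v_le[OF l(1)] by auto
                then show "u \<in> (\<Union>l\<in>{..<L}. ?bx l n \<union> ?by l n)" using l(1) u by blast
              qed
            qed
            show "(\<Union>l\<in>{..<L}. ?bx l n \<union> ?by l n) \<in> prod.P.events"
              using meas by (intro sets.finite_UN) auto
          qed
          also have "\<dots> \<le> (\<Sum>l<L. prod.P.prob (?bx l n \<union> ?by l n))"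
            using meas by (intro measure_UNION_le) auto
          also have "\<dots> \<le> (\<Sum>l<L. prod.P.prob (?bx l n) + prod.P.prob (?by l n))"
            using meas by (intro sum_mono measure_Un_le) auto
          finally show ?case by simp
        qed
        show "(\<lambda>n. \<Sum>l<L. prod.P.prob (?bx l n) + prod.P.prob (?by l n)) \<longlonglongrightarrow> 0"
        proof (intro tendsto_null_sum tendsto_add_zero)
          fix l assume "l \<in> {..<L}"
          then have l: "l < L" by simp
          show "(\<lambda>n. prod.P.prob (?bx l n)) \<longlonglongrightarrow> 0"
            by (rule limx[OF l, unfolded prod.P.tends_prob_def, THEN conjunct2, rule_format, OF e])
          show "(\<lambda>n. prod.P.prob (?by l n)) \<longlonglongrightarrow> 0"
            by (rule limy[OF l, unfolded prod.P.tends_prob_def, THEN conjunct2, rule_format, OF e])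
        qed
      qed
      show "0 \<le> c + e" "0 \<le> 4 * (s + t)\<^sup>2 / \<rho>\<^sup>2" using c e by auto
    qed
  qed
  moreover have "c \<in> vx ` {..<L} \<union> vy ` {..<L}"
    unfolding c_def using L by (intro Max_in) auto
  ultimately show ?thesis unfolding vx_def vy_def x_def y_def by auto
qed

section \<open>Identification of the shape function\<close>

text \<open>
  The parameters over which the minimum is taken: all of \<open>(-\<alpha>, \<beta>)\<close>, and the end points with finite second
  reciprocal moments. At any other end point the derivative of \<open>s A(z) + t B(z)\<close> is infinite, so no minimum
  sits there.
\<close>

definition Z :: "real set" where
  "Z = {z. SA.admissible z \<and> SB.admissible (- z)}"

lemma interior_in_Z: "- \<alpha> < z \<Longrightarrow> z < \<beta> \<Longrightarrow> z \<in> Z"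
  unfolding Z_def using SA.admissible_interior[of z] SB.admissible_interior[of "- z"] by simp

lemma Z_bounds: "z \<in> Z \<Longrightarrow> - \<alpha> \<le> z \<and> z \<le> \<beta>"
  by (auto simp: Z_def SA.admissible_def SB.admissible_def)

lemma left_end_in_Z: "SA.admissible (- \<alpha>) \<Longrightarrow> - \<alpha> \<in> Z"
  unfolding Z_def using SB.admissible_interior[of \<alpha>] pos by simp

lemma right_end_in_Z: "SB.admissible (- \<beta>) \<Longrightarrow> \<beta> \<in> Z"
  unfolding Z_def using SA.admissible_interior[of \<beta>] pos by simp

sublocale opt: slope_optimiser Z A A2 B B2
proof
  obtain z0 where z0: "- \<alpha> < z0" "z0 < \<beta>" using exists_interior by blast
  then show "Z \<noteq> {}" using interior_in_Z by blast
  show "y \<in> Z" if "x \<in> Z" "z \<in> Z" "x \<le> y" "y \<le> z" for x y z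
    using that SA.admissible_mono[of x y] SB.admissible_mono[of "- z" "- y"] by (simp add: Z_def)
  show "0 < A2 z" if "z \<in> Z" for z
    unfolding A2_def using that by (intro SA.moment_pos) (auto simp: Z_def)
  show "0 < B2 z" if "z \<in> Z" for z
    unfolding B2_def using that by (intro SB.moment_pos) (auto simp: Z_def)
  have contA: "continuous_on Z (SA.moment k)" if "k = 1 \<or> k = 2" for k
    using SA.moment_continuous[OF that] by (rule continuous_on_subset) (auto simp: Z_def)
  have contB: "continuous_on Z (\<lambda>z. SB.moment k (- z))" if "k = 1 \<or> k = 2" for k
    by (rule continuous_on_compose2[OF SB.moment_continuous[OF that]]) (auto simp: Z_def intro!: continuous_intros)
  show "continuous_on Z A" "continuous_on Z A2" "continuous_on Z B" "continuous_on Z B2"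
    using contA[of 1] contA[of 2] contB[of 1] contB[of 2]
    by (simp_all add: A_def[abs_def] A2_def[abs_def] B_def[abs_def] B2_def[abs_def])
  show "A z - (w - z) * A2 z < A w" if "z \<in> Z" "w \<in> Z" "z \<noteq> w" for z w
    unfolding A_def A2_def using that by (intro SA.moment_tangent) (auto simp: Z_def)
  show "B z + (w - z) * B2 z < B w" if "z \<in> Z" "w \<in> Z" "z \<noteq> w" for z w
    using SB.moment_tangent[of "- z" "- w"] that by (simp add: Z_def B_def B2_def algebra_simps)
  show "(\<exists>m\<in>Z. \<forall>z\<in>Z. m \<le> z) \<or> (\<forall>r>0. \<exists>z\<in>Z. B2 z < r * A2 z)"
  proof (cases "SA.admissible (- \<alpha>)")
    case True
    then show ?thesis using left_end_in_Z Z_bounds by blast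
  next
    case False
    have "\<exists>z\<in>Z. B2 z < r * A2 z" if r: "r > 0" for r
    proof -
      obtain z where z: "- \<alpha> < z" "z < - \<alpha> + (z0 + \<alpha>)" "B2 z0 / r < SA.moment 2 z"
        using SA.second_moment_blows_up[OF False, of "z0 + \<alpha>" "B2 z0 / r"] z0 by auto
      have "SB.moment 2 (- z) \<le> SB.moment 2 (- z0)"
        using z z0 by (intro SB.moment_antimono SB.admissible_interior) auto
      then have "B2 z \<le> B2 z0" by (simp add: B2_def)
      also have "B2 z0 < r * A2 z" using z(3) r by (simp add: A2_def pos_divide_less_eq mult.commute)
      finally show ?thesis using interior_in_Z[of z] z z0 by auto
    qed
    then show ?thesis by blast
  qed
  show "(\<exists>m\<in>Z. \<forall>z\<in>Z. z \<le> m) \<or> (\<forall>r>0. \<exists>z\<in>Z. r * A2 z < B2 z)"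
  proof (cases "SB.admissible (- \<beta>)")
    case True
    then show ?thesis using right_end_in_Z Z_bounds by blast
  next
    case False
    have "\<exists>z\<in>Z. r * A2 z < B2 z" if r: "r > 0" for r
    proof -
      obtain u where u: "- \<beta> < u" "u < - \<beta> + (\<beta> - z0)" "r * A2 z0 < SB.moment 2 u"
        using SB.second_moment_blows_up[OF False, of "\<beta> - z0" "r * A2 z0"] z0 by auto
      have "SA.moment 2 (- u) \<le> SA.moment 2 z0"
        using u z0 by (intro SA.moment_antimono SA.admissible_interior) auto
      then have "r * A2 (- u) \<le> r * A2 z0" using r by (simp add: A2_def)
      also have "\<dots> < B2 (- u)" using u(3) by (simp add: B2_def)
      finally show ?thesis using interior_in_Z[of "- u"] u z0 by auto
    qed
    then show ?thesis by blast
  qed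
qed

lemma interior_sequence:
  assumes "z \<in> Z"
  obtains w where "\<And>n. - \<alpha> < w n" "\<And>n. w n < \<beta>" "w \<longlonglongrightarrow> z"
    "\<And>f :: real \<Rightarrow> real. continuous_on Z f \<Longrightarrow> (\<lambda>n. f (w n)) \<longlonglongrightarrow> f z"
proof -
  obtain z0 where z0: "- \<alpha> < z0" "z0 < \<beta>" using exists_interior by blast
  define w where "w n = z + (z0 - z) / real (Suc n)" for n
  have z: "- \<alpha> \<le> z" "z \<le> \<beta>" using Z_bounds[OF assms] by auto
  have w: "- \<alpha> < w n" "w n < \<beta>" for n
  proof -
    define q where "q = 1 / real (Suc n)"
    have q: "0 < q" "q \<le> 1" by (auto simp: q_def)
    have eq: "w n = (1 - q) * z + q * z0" by (simp add: w_def q_def algebra_simps diff_divide_distrib)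
    have "q * (- \<alpha>) < q * z0" "q * z0 < q * \<beta>"
      by (rule mult_strict_left_mono[OF z0(1) q(1)], rule mult_strict_left_mono[OF z0(2) q(1)])
    moreover have "(1 - q) * (- \<alpha>) \<le> (1 - q) * z" "(1 - q) * z \<le> (1 - q) * \<beta>"
      using q z by (intro mult_left_mono; simp)+
    ultimately show "- \<alpha> < w n" "w n < \<beta>" unfolding eq by (auto simp: algebra_simps)
  qed
  have lim: "w \<longlonglongrightarrow> z"
  proof -
    have "(\<lambda>n. z + (z0 - z) * (1 / real (Suc n))) \<longlonglongrightarrow> z + (z0 - z) * 0"
      using LIMSEQ_inverse_real_of_nat by (intro tendsto_intros) (simp add: inverse_eq_divide)
    then show ?thesis by (simp add: w_def[abs_def])
  qed
  have "(\<lambda>n. f (w n)) \<longlonglongrightarrow> f z" if "continuous_on Z f" for f :: "real \<Rightarrow> real"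
    using that lim assms interior_in_Z[OF w] unfolding continuous_on_sequentially by (auto simp: comp_def)
  with w lim show ?thesis using that by blast
qed

lemma real_shape_le:
  assumes st: "s > 0" "t > 0" and z: "z \<in> Z"
  shows "real_shape s t \<le> s * A z + t * B z"
proof -
  obtain w where w: "\<And>n. - \<alpha> < w n" "\<And>n. w n < \<beta>"
    "\<And>f :: real \<Rightarrow> real. continuous_on Z f \<Longrightarrow> (\<lambda>n. f (w n)) \<longlonglongrightarrow> f z" using interior_sequence[OF z] by metis
  have "(\<lambda>n. s * A (w n) + t * B (w n)) \<longlonglongrightarrow> s * A z + t * B z"
    by (intro tendsto_intros w(3)[OF opt.cont(1)] w(3)[OF opt.cont(2)])
  then show ?thesis
    by (rule LIMSEQ_le_const) (use real_shape_le_stationary[OF st w(1,2)] in auto)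
qed

lemma A_pos_Z: "z \<in> Z \<Longrightarrow> A z > 0" and B_pos_Z: "z \<in> Z \<Longrightarrow> B z > 0"
  unfolding A_def B_def by (auto simp: Z_def intro!: SA.moment_pos SB.moment_pos)

text \<open>
  An almost optimal exit at distance \<open>x\<close> along the horizontal axis would make \<open>z\<close> almost optimal for the direction
  \<open>(s - x, t)\<close> as well, whereas the derivative in \<open>z\<close> for this direction is \<open>x A2(z) > 0\<close>. A parameter \<open>v\<close>
  slightly below \<open>z\<close> is then better, with an explicit margin.
\<close>

lemma horizontal_exit_small:
  assumes st: "s > 0" "t > 0" and z: "- \<alpha> < z" "z < \<beta>" and crit: "s * A2 z = t * B2 z" and \<eta>: "\<eta> > 0"
  shows "\<exists>e>0. \<forall>x. 0 \<le> x \<and> x < s \<and> s * A z + t * B z \<le> x * A z + real_shape (s - x) t + e \<longrightarrow> x \<le> \<eta>"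
proof -
  have zZ: "z \<in> Z" using z by (rule interior_in_Z)
  define w where "w n = z - (z + \<alpha>) / real (n + 2)" for n
  have w: "- \<alpha> < w n" "w n < z" for n
  proof -
    have "(z + \<alpha>) / real (n + 2) < z + \<alpha>" "(z + \<alpha>) / real (n + 2) > 0"
      using z by (auto simp: divide_less_eq)
    then show "- \<alpha> < w n" "w n < z" by (auto simp: w_def)
  qed
  have wZ: "w n \<in> Z" for n using w[of n] z by (intro interior_in_Z) auto
  have "w \<longlonglongrightarrow> z" unfolding w_def by real_asymp
  moreover have "continuous_on Z (\<lambda>z. t * B2 z / A2 z)"
    using opt.pos by (intro continuous_intros opt.cont) fastforce
  ultimately have "(\<lambda>n. t * B2 (w n) / A2 (w n)) \<longlonglongrightarrow> t * B2 z / A2 z"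
    using zZ wZ unfolding continuous_on_sequentially by (auto simp: comp_def)
  moreover have "t * B2 z / A2 z = s" using crit opt.pos(1)[OF zZ] by (simp add: divide_eq_eq mult.commute)
  ultimately have "(\<lambda>n. t * B2 (w n) / A2 (w n)) \<longlonglongrightarrow> s" by simp
  then have "\<forall>\<^sub>F n in sequentially. s - \<eta> / 2 < t * B2 (w n) / A2 (w n)"
    using \<eta> by (intro order_tendstoD) auto
  then obtain n where n: "s - \<eta> / 2 < t * B2 (w n) / A2 (w n)"
    by (auto simp: eventually_sequentially)
  define v where "v = w n"
  have v: "- \<alpha> < v" "v < z" "v < \<beta>" "v \<in> Z" using w[of n] wZ[of n] z by (auto simp: v_def)
  have A2v: "A2 v > 0" using opt.pos v by blast
  define \<kappa> where "\<kappa> = z - v"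
  have \<kappa>: "\<kappa> > 0" using v by (simp add: \<kappa>_def)
  define e where "e = \<eta> / 2 * (\<kappa> * A2 v)"
  have e: "e > 0" using \<eta> \<kappa> A2v by (simp add: e_def)
  have "x \<le> \<eta>" if x: "0 \<le> x" "x < s" and le: "s * A z + t * B z \<le> x * A z + real_shape (s - x) t + e" for x
  proof -
    have "real_shape (s - x) t \<le> (s - x) * A v + t * B v"
      using x st v by (intro real_shape_le_stationary) auto
    moreover have "(s - x) * A v \<le> (s - x) * (A z + \<kappa> * A2 v)"
      using opt.tangent(1)[OF v(4) zZ] v x by (intro mult_left_mono) (auto simp: \<kappa>_def)
    moreover have "t * B v \<le> t * (B z - \<kappa> * B2 v)"
      using opt.tangent(2)[OF v(4) zZ] v st by (intro mult_left_mono) (auto simp: \<kappa>_def)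
    ultimately have "0 \<le> (s - x) * \<kappa> * A2 v - t * \<kappa> * B2 v + e"
      using le by (simp add: algebra_simps)
    also have "\<dots> = (\<kappa> * A2 v) * ((s - x) - t * B2 v / A2 v + \<eta> / 2)"
      using A2v by (simp add: e_def field_simps)
    finally have "0 \<le> (s - x) - t * B2 v / A2 v + \<eta> / 2"
      using mult_pos_neg[OF mult_pos_pos[OF \<kappa> A2v], of "(s - x) - t * B2 v / A2 v + \<eta> / 2"] by linarith
    then show ?thesis using n by (simp add: v_def)
  qed
  then show ?thesis using e by blast
qed

text \<open>
  As before, with a parameter slightly above \<open>z\<close>.
\<close>

lemma vertical_exit_small:
  assumes st: "s > 0" "t > 0" and z: "- \<alpha> < z" "z < \<beta>" and crit: "s * A2 z = t * B2 z" and \<eta>: "\<eta> > 0"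
  shows "\<exists>e>0. \<forall>y. 0 \<le> y \<and> y < t \<and> s * A z + t * B z \<le> y * B z + real_shape s (t - y) + e \<longrightarrow> y \<le> \<eta>"
proof -
  have zZ: "z \<in> Z" using z by (rule interior_in_Z)
  define w where "w n = z + (\<beta> - z) / real (n + 2)" for n
  have w: "z < w n" "w n < \<beta>" for n
  proof -
    have "(\<beta> - z) / real (n + 2) < \<beta> - z" "(\<beta> - z) / real (n + 2) > 0"
      using z by (auto simp: divide_less_eq)
    then show "z < w n" "w n < \<beta>" by (auto simp: w_def)
  qed
  have wZ: "w n \<in> Z" for n using w[of n] z by (intro interior_in_Z) auto
  have "w \<longlonglongrightarrow> z" unfolding w_def by real_asymp
  moreover have "continuous_on Z (\<lambda>z. s * A2 z / B2 z)"
    using opt.pos by (intro continuous_intros opt.cont) fastforce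
  ultimately have "(\<lambda>n. s * A2 (w n) / B2 (w n)) \<longlonglongrightarrow> s * A2 z / B2 z"
    using zZ wZ unfolding continuous_on_sequentially by (auto simp: comp_def)
  moreover have "s * A2 z / B2 z = t" using crit opt.pos(2)[OF zZ] by (simp add: divide_eq_eq mult.commute)
  ultimately have "(\<lambda>n. s * A2 (w n) / B2 (w n)) \<longlonglongrightarrow> t" by simp
  then have "\<forall>\<^sub>F n in sequentially. t - \<eta> / 2 < s * A2 (w n) / B2 (w n)"
    using \<eta> by (intro order_tendstoD) auto
  then obtain n where n: "t - \<eta> / 2 < s * A2 (w n) / B2 (w n)"
    by (auto simp: eventually_sequentially)
  define v where "v = w n"
  have v: "- \<alpha> < v" "z < v" "v < \<beta>" "v \<in> Z" using w[of n] wZ[of n] z by (auto simp: v_def)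
  have B2v: "B2 v > 0" using opt.pos v by blast
  define \<kappa> where "\<kappa> = v - z"
  have \<kappa>: "\<kappa> > 0" using v by (simp add: \<kappa>_def)
  define e where "e = \<eta> / 2 * (\<kappa> * B2 v)"
  have e: "e > 0" using \<eta> \<kappa> B2v by (simp add: e_def)
  have "y \<le> \<eta>" if y: "0 \<le> y" "y < t" and le: "s * A z + t * B z \<le> y * B z + real_shape s (t - y) + e" for y
  proof -
    have "real_shape s (t - y) \<le> s * A v + (t - y) * B v"
      using y st v by (intro real_shape_le_stationary) auto
    moreover have "(t - y) * B v \<le> (t - y) * (B z + \<kappa> * B2 v)"
      using opt.tangent(2)[OF v(4) zZ] v y by (intro mult_left_mono) (auto simp: \<kappa>_def algebra_simps)
    moreover have "s * A v \<le> s * (A z - \<kappa> * A2 v)"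
      using opt.tangent(1)[OF v(4) zZ] v st by (intro mult_left_mono) (auto simp: \<kappa>_def algebra_simps)
    ultimately have "0 \<le> (t - y) * \<kappa> * B2 v - s * \<kappa> * A2 v + e"
      using le by (simp add: algebra_simps)
    also have "\<dots> = (\<kappa> * B2 v) * ((t - y) - s * A2 v / B2 v + \<eta> / 2)"
      using B2v by (simp add: e_def field_simps)
    finally have "0 \<le> (t - y) - s * A2 v / B2 v + \<eta> / 2"
      using mult_pos_neg[OF mult_pos_pos[OF \<kappa> B2v], of "(t - y) - s * A2 v / B2 v + \<eta> / 2"] by linarith
    then show ?thesis using n by (simp add: v_def)
  qed
  then show ?thesis using e by blast
qed

text \<open>
  By \<open>exit_inequality\<close> there are almost optimal exit points, which must be close to the origin; dropping the short
  piece of the axis costs little.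
\<close>

lemma real_shape_critical:
  assumes st: "s > 0" "t > 0" and z: "- \<alpha> < z" "z < \<beta>" and crit: "s * A2 z = t * B2 z"
  shows "real_shape s t = s * A z + t * B z"
proof (rule antisym)
  show "real_shape s t \<le> s * A z + t * B z" by (rule real_shape_le_stationary[OF st z])
  show "s * A z + t * B z \<le> real_shape s t"
  proof (rule field_le_epsilon)
    fix e :: real assume e: "e > 0"
    have AB: "A z > 0" "B z > 0" using z by (auto intro: A_pos B_pos)
    define \<eta> where "\<eta> = e / 2 / (A z + B z)"
    have \<eta>: "\<eta> > 0" "\<eta> * A z \<le> e / 2" "\<eta> * B z \<le> e / 2"
      using e AB by (auto simp: \<eta>_def pos_divide_le_eq algebra_simps)
    obtain e1 where e1: "e1 > 0" "\<And>x. 0 \<le> x \<Longrightarrow> x < s \<Longrightarrow> s * A z + t * B z \<le> x * A z + real_shape (s - x) t + e1 \<Longrightarrow> x \<le> \<eta>"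
      using horizontal_exit_small[OF st z crit \<eta>(1)] by blast
    obtain e2 where e2: "e2 > 0" "\<And>y. 0 \<le> y \<Longrightarrow> y < t \<Longrightarrow> s * A z + t * B z \<le> y * B z + real_shape s (t - y) + e2 \<Longrightarrow> y \<le> \<eta>"
      using vertical_exit_small[OF st z crit \<eta>(1)] by blast
    define q where "q = min (e / 2) (min e1 e2)"
    have q: "q > 0" "q \<le> e / 2" "q \<le> e1" "q \<le> e2" using e e1 e2 by (auto simp: q_def)
    obtain L where L: "(s * A z + t * B z) / q < real L" using reals_Archimedean2 by blast
    have "(s * A z + t * B z) / q > 0" using st AB q by (intro divide_pos_pos add_pos_pos) auto
    then have Lpos: "L > 0" using L by (cases L) auto
    have "s * A z + t * B z < q * real L" using L q by (simp add: pos_divide_less_eq mult.commute)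
    then have "s * A z < q * real L" "t * B z < q * real L" using st AB by (smt (verit) mult_pos_pos)+
    then have small: "s * A z / real L \<le> q" "t * B z / real L \<le> q"
      using Lpos by (simp_all add: pos_divide_le_eq)
    from exit_inequality[OF z st Lpos] show "s * A z + t * B z \<le> real_shape s t + e"
    proof
      assume "\<exists>l<L. s * A z + t * B z \<le> real (Suc l) / real L * s * A z + real_shape (s - real l / real L * s) t"
      then obtain l where l: "l < L" "s * A z + t * B z \<le> real (Suc l) / real L * s * A z + real_shape (s - real l / real L * s) t" by blast
      define x where "x = real l / real L * s"
      have x: "0 \<le> x" "x < s" using l(1) st mult_strict_right_mono[of "real l / real L" 1 s] by (auto simp: x_def)
      have "real (Suc l) / real L * s * A z = x * A z + s * A z / real L"
        by (simp add: x_def algebra_simps add_divide_distrib)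
      then have le: "s * A z + t * B z \<le> x * A z + real_shape (s - x) t + q"
        using l(2) small(1) by (simp add: x_def)
      then have "x \<le> \<eta>" using e1(2)[OF x] q by linarith
      then have "x * A z \<le> \<eta> * A z" using AB by (intro mult_right_mono) auto
      moreover have "real_shape (s - x) t \<le> real_shape s t" using x st by (intro real_shape_mono) auto
      ultimately show ?thesis using le \<eta>(2) q(2) by linarith
    next
      assume "\<exists>l<L. s * A z + t * B z \<le> real (Suc l) / real L * t * B z + real_shape s (t - real l / real L * t)"
      then obtain l where l: "l < L" "s * A z + t * B z \<le> real (Suc l) / real L * t * B z + real_shape s (t - real l / real L * t)" by blast
      define y where "y = real l / real L * t"
      have y: "0 \<le> y" "y < t" using l(1) st mult_strict_right_mono[of "real l / real L" 1 t] by (auto simp: y_def)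
      have "real (Suc l) / real L * t * B z = y * B z + t * B z / real L"
        by (simp add: y_def algebra_simps add_divide_distrib)
      then have le: "s * A z + t * B z \<le> y * B z + real_shape s (t - y) + q"
        using l(2) small(2) by (simp add: y_def)
      then have "y \<le> \<eta>" using e2(2)[OF y] q by linarith
      then have "y * B z \<le> \<eta> * B z" using AB by (intro mult_right_mono) auto
      moreover have "real_shape s (t - y) \<le> real_shape s t" using y st by (intro real_shape_mono) auto
      ultimately show ?thesis using le \<eta>(3) q(2) by linarith
    qed
  qed
qed

lemma minimiser_left_end_iff:
  assumes "r > 0" "- \<alpha> \<in> Z"
  shows "opt.minimiser r = - \<alpha> \<longleftrightarrow> r * A2 (- \<alpha>) \<le> B2 (- \<alpha>)"
proof
  obtain z0 where z0: "- \<alpha> < z0" "z0 < \<beta>" using exists_interior by blast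
  assume "opt.minimiser r = - \<alpha>"
  then have "opt.optimal r (- \<alpha>)" using opt.optimal_minimiser[OF assms(1)] by simp
  then have "(z0 - - \<alpha>) * (B2 (- \<alpha>) - r * A2 (- \<alpha>)) \<ge> 0"
    using interior_in_Z[OF z0] unfolding opt.optimal_def by blast
  then show "r * A2 (- \<alpha>) \<le> B2 (- \<alpha>)" using z0 by (simp add: zero_le_mult_iff)
next
  assume le: "r * A2 (- \<alpha>) \<le> B2 (- \<alpha>)"
  have "(w - - \<alpha>) * (B2 (- \<alpha>) - r * A2 (- \<alpha>)) \<ge> 0" if "w \<in> Z" for w
    using Z_bounds[OF that] le by (intro mult_nonneg_nonneg) auto
  then show "opt.minimiser r = - \<alpha>"
    using assms by (intro opt.minimiser_eqI) (auto simp: opt.optimal_def)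
qed

lemma minimiser_right_end_iff:
  assumes "r > 0" "\<beta> \<in> Z"
  shows "opt.minimiser r = \<beta> \<longleftrightarrow> B2 \<beta> \<le> r * A2 \<beta>"
proof
  obtain z0 where z0: "- \<alpha> < z0" "z0 < \<beta>" using exists_interior by blast
  assume "opt.minimiser r = \<beta>"
  then have "opt.optimal r \<beta>" using opt.optimal_minimiser[OF assms(1)] by simp
  then have "(z0 - \<beta>) * (B2 \<beta> - r * A2 \<beta>) \<ge> 0"
    using interior_in_Z[OF z0] unfolding opt.optimal_def by blast
  then show "B2 \<beta> \<le> r * A2 \<beta>" using z0 by (simp add: zero_le_mult_iff)
next
  assume le: "B2 \<beta> \<le> r * A2 \<beta>"
  have "(w - \<beta>) * (B2 \<beta> - r * A2 \<beta>) \<ge> 0" if "w \<in> Z" for w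
    using Z_bounds[OF that] le by (intro mult_nonpos_nonpos) auto
  then show "opt.minimiser r = \<beta>"
    using assms by (intro opt.minimiser_eqI) (auto simp: opt.optimal_def)
qed

lemma minimiser_interior:
  assumes r: "r > 0" and z: "- \<alpha> < opt.minimiser r" "opt.minimiser r < \<beta>"
  shows "r * A2 (opt.minimiser r) = B2 (opt.minimiser r)"
proof -
  let ?z = "opt.minimiser r"
  let ?u = "(?z - \<alpha>) / 2" and ?v = "(?z + \<beta>) / 2"
  have "?u \<in> Z" "?v \<in> Z" using z by (auto intro!: interior_in_Z)
  then have "(?u - ?z) * (B2 ?z - r * A2 ?z) \<ge> 0" "(?v - ?z) * (B2 ?z - r * A2 ?z) \<ge> 0"
    using opt.optimal_minimiser[OF r] unfolding opt.optimal_def by blast+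
  then show ?thesis using z by (auto simp: zero_le_mult_iff)
qed

text \<open>
  The case of an interior minimiser is \<open>real_shape_critical\<close>. If the minimiser is \<open>-\<alpha>\<close>, choose any interior \<open>w\<close> and climb the
  first column until the remaining direction \<open>(s, t - y)\<close> has minimiser \<open>w\<close>, for which the value is known; then let
  \<open>w\<close> tend to \<open>-\<alpha>\<close>. The case of \<open>\<beta>\<close> is symmetric.
\<close>

theorem real_shape_eq_optimum:
  assumes st: "s > 0" "t > 0"
  shows "real_shape s t = opt.optimum s t"
proof (rule antisym)
  define r where "r = s / t"
  define z where "z = opt.minimiser r"
  have r: "r > 0" using st by (simp add: r_def)
  have zZ: "z \<in> Z" unfolding z_def using r by (rule opt.minimiser_in)
  have h: "opt.optimum s t = s * A z + t * B z" by (simp add: opt.optimum_def z_def r_def)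
  show "real_shape s t \<le> opt.optimum s t" unfolding h by (rule real_shape_le[OF st zZ])
  consider (interior) "- \<alpha> < z" "z < \<beta>" | (left) "z = - \<alpha>" | (right) "z = \<beta>"
    using Z_bounds[OF zZ] by linarith
  then show "opt.optimum s t \<le> real_shape s t"
  proof cases
    case interior
    have "r * A2 z = B2 z" using minimiser_interior[OF r] interior by (simp add: z_def)
    then have "s * A2 z = t * B2 z" using st by (simp add: r_def field_simps)
    from real_shape_critical[OF st interior this] show ?thesis by (simp add: h)
  next
    case left
    have zero: "r * A2 (- \<alpha>) \<le> B2 (- \<alpha>)"
      using minimiser_left_end_iff[OF r] zZ left by (simp add: z_def)
    have step: "s * A w + t * B (- \<alpha>) \<le> real_shape s t" if w: "- \<alpha> < w" "w < \<beta>" for w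
    proof -
      have wZ: "w \<in> Z" using w by (rule interior_in_Z)
      have AB2: "A2 w > 0" "B2 w > 0" using opt.pos wZ by auto
      have "r * A2 w < B2 w"
        using opt.slope_defect_increasing[OF r, of "- \<alpha>" w] zZ left wZ w zero by simp
      then have lt: "s * A2 w / B2 w < t" using st AB2 by (simp add: r_def field_simps)
      define y where "y = t - s * A2 w / B2 w"
      have y: "0 < y" "y < t" "t - y > 0" using lt st AB2 by (auto simp: y_def)
      have "s * A2 w = (t - y) * B2 w" using AB2 by (simp add: y_def)
      from real_shape_critical[OF st(1) y(3) w this]
      have real_shape: "real_shape s (t - y) = s * A w + (t - y) * B w" .
      have detour: "y * SB.moment 1 (\<alpha> + d) + (s * A w + (t - y) * B w) \<le> real_shape s t" if "d > 0" for d
        using column_detour[OF st(1) y(1,2) that] unfolding real_shape B_def minus_minus .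
      have "(\<lambda>n. y * SB.moment 1 (\<alpha> + 1 / real (Suc n)) + (s * A w + (t - y) * B w))
          \<longlonglongrightarrow> y * SB.moment 1 \<alpha> + (s * A w + (t - y) * B w)"
      proof (intro tendsto_intros)
        have good: "SB.admissible (\<alpha> + 1 / real (Suc n))" "SB.admissible \<alpha>" for n
        proof -
          have "1 / real (Suc n) > 0" by simp
          then show "SB.admissible (\<alpha> + 1 / real (Suc n))" "SB.admissible \<alpha>"
            using pos by (intro SB.admissible_interior; linarith)+
        qed
        have "(\<lambda>n. \<alpha> + 1 / real (Suc n)) \<longlonglongrightarrow> \<alpha>"
          using LIMSEQ_inverse_real_of_nat_add[of \<alpha>] by (simp add: inverse_eq_divide)
        then show "(\<lambda>n. SB.moment 1 (\<alpha> + 1 / real (Suc n))) \<longlonglongrightarrow> SB.moment 1 \<alpha>"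
          by (intro SB.moment_tendsto good) auto
      qed
      then have "y * SB.moment 1 \<alpha> + (s * A w + (t - y) * B w) \<le> real_shape s t"
        by (rule LIMSEQ_le_const2) (use detour in auto)
      moreover have "B (- \<alpha>) = SB.moment 1 \<alpha>" by (simp add: B_def)
      moreover have "(t - y) * B (- \<alpha>) \<le> (t - y) * B w"
        unfolding B_def using y w pos by (intro mult_left_mono SB.moment_antimono SB.admissible_interior) auto
      ultimately show ?thesis by (simp add: algebra_simps)
    qed
    obtain w where w: "\<And>n. - \<alpha> < w n" "\<And>n. w n < \<beta>"
      "\<And>f :: real \<Rightarrow> real. continuous_on Z f \<Longrightarrow> (\<lambda>n. f (w n)) \<longlonglongrightarrow> f z" using interior_sequence[OF zZ] by metis
    have "(\<lambda>n. s * A (w n) + t * B (- \<alpha>)) \<longlonglongrightarrow> s * A z + t * B (- \<alpha>)"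
      by (intro tendsto_intros w(3)[OF opt.cont(1)] w(3)[OF opt.cont(2)])
    then have "s * A z + t * B (- \<alpha>) \<le> real_shape s t"
      by (rule LIMSEQ_le_const2) (use step[OF w(1,2)] in auto)
    then show ?thesis by (simp add: h left)
  next
    case right
    have zero: "B2 \<beta> \<le> r * A2 \<beta>"
      using minimiser_right_end_iff[OF r] zZ right by (simp add: z_def)
    have step: "s * A \<beta> + t * B w \<le> real_shape s t" if w: "- \<alpha> < w" "w < \<beta>" for w
    proof -
      have wZ: "w \<in> Z" using w by (rule interior_in_Z)
      have AB2: "A2 w > 0" "B2 w > 0" using opt.pos wZ by auto
      have "B2 w < r * A2 w"
        using opt.slope_defect_increasing[OF r, of w \<beta>] zZ right wZ w zero by simp
      then have lt: "t * B2 w / A2 w < s" using st AB2 by (simp add: r_def field_simps)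
      define y where "y = s - t * B2 w / A2 w"
      have y: "0 < y" "y < s" "s - y > 0" using lt st AB2 by (auto simp: y_def)
      have "(s - y) * A2 w = t * B2 w" using AB2 by (simp add: y_def)
      from real_shape_critical[OF y(3) st(2) w this]
      have real_shape: "real_shape (s - y) t = (s - y) * A w + t * B w" .
      have detour: "y * SA.moment 1 (\<beta> + d) + ((s - y) * A w + t * B w) \<le> real_shape s t" if "d > 0" for d
        using row_detour[OF st(2) y(1,2) that] unfolding real_shape A_def .
      have "(\<lambda>n. y * SA.moment 1 (\<beta> + 1 / real (Suc n)) + ((s - y) * A w + t * B w))
          \<longlonglongrightarrow> y * SA.moment 1 \<beta> + ((s - y) * A w + t * B w)"
      proof (intro tendsto_intros)
        have good: "SA.admissible (\<beta> + 1 / real (Suc n))" "SA.admissible \<beta>" for n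
        proof -
          have "1 / real (Suc n) > 0" by simp
          then show "SA.admissible (\<beta> + 1 / real (Suc n))" "SA.admissible \<beta>"
            using pos by (intro SA.admissible_interior; linarith)+
        qed
        have "(\<lambda>n. \<beta> + 1 / real (Suc n)) \<longlonglongrightarrow> \<beta>"
          using LIMSEQ_inverse_real_of_nat_add[of \<beta>] by (simp add: inverse_eq_divide)
        then show "(\<lambda>n. SA.moment 1 (\<beta> + 1 / real (Suc n))) \<longlonglongrightarrow> SA.moment 1 \<beta>"
          by (intro SA.moment_tendsto good) auto
      qed
      then have "y * SA.moment 1 \<beta> + ((s - y) * A w + t * B w) \<le> real_shape s t"
        by (rule LIMSEQ_le_const2) (use detour in auto)
      moreover have "A \<beta> = SA.moment 1 \<beta>" by (simp add: A_def)
      moreover have "(s - y) * A \<beta> \<le> (s - y) * A w"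
        unfolding A_def using y w pos by (intro mult_left_mono SA.moment_antimono SA.admissible_interior) auto
      ultimately show ?thesis by (simp add: algebra_simps)
    qed
    obtain w where w: "\<And>n. - \<alpha> < w n" "\<And>n. w n < \<beta>"
      "\<And>f :: real \<Rightarrow> real. continuous_on Z f \<Longrightarrow> (\<lambda>n. f (w n)) \<longlonglongrightarrow> f z" using interior_sequence[OF zZ] by metis
    have "(\<lambda>n. s * A \<beta> + t * B (w n)) \<longlonglongrightarrow> s * A \<beta> + t * B z"
      by (intro tendsto_intros w(3)[OF opt.cont(1)] w(3)[OF opt.cont(2)])
    then have "s * A \<beta> + t * B z \<le> real_shape s t"
      by (rule LIMSEQ_le_const2) (use step[OF w(1,2)] in auto)
    then show ?thesis by (simp add: h right)
  qed
qed

lemma c1_eq: "c1 \<mu> = (if SA.admissible (- \<alpha>) then ennreal (B2 (- \<alpha>) / A2 (- \<alpha>)) else 0)"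
proof -
  have b: "b_moment \<mu> \<alpha> 2 = ennreal (B2 (- \<alpha>))"
    unfolding b_moment_eq using SB.emoment_eq_moment[of \<alpha> 2] SB.admissible_interior[of \<alpha>] pos by (simp add: B2_def)
  show ?thesis
  proof (cases "SA.admissible (- \<alpha>)")
    case True
    then have "a_moment \<mu> (- \<alpha>) 2 = ennreal (A2 (- \<alpha>))"
      unfolding a_moment_eq using SA.emoment_eq_moment[of "- \<alpha>" 2] by (simp add: A2_def)
    then show ?thesis
      using True b opt.pos left_end_in_Z[OF True] by (simp add: c1_def divide_ennreal less_imp_le)
  next
    case False
    then have "a_moment \<mu> (- \<alpha>) 2 = \<infinity>"
      unfolding a_moment_eq by (simp add: SA.admissible_def less_top[symmetric])
    then show ?thesis using False by (simp add: c1_def)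
  qed
qed

lemma c2_eq: "c2 \<mu> = (if SB.admissible (- \<beta>) then ennreal (B2 \<beta> / A2 \<beta>) else \<infinity>)"
proof -
  have a: "a_moment \<mu> \<beta> 2 = ennreal (A2 \<beta>)"
    unfolding a_moment_eq using SA.emoment_eq_moment[of \<beta> 2] SA.admissible_interior[of \<beta>] pos by (simp add: A2_def)
  show ?thesis
  proof (cases "SB.admissible (- \<beta>)")
    case True
    then have "b_moment \<mu> (- \<beta>) 2 = ennreal (B2 \<beta>)"
      unfolding b_moment_eq using SB.emoment_eq_moment[of "- \<beta>" 2] by (simp add: B2_def)
    then show ?thesis
      using True a opt.pos right_end_in_Z[OF True] by (simp add: c2_def divide_ennreal less_imp_le)
  next
    case False
    then have "b_moment \<mu> (- \<beta>) 2 = \<infinity>"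
      unfolding b_moment_eq by (simp add: SB.admissible_def less_top[symmetric])
    then show ?thesis using False a by (simp add: c2_def ennreal_top_divide)
  qed
qed

lemma c1_le_iff:
  assumes "r > 0"
  shows "ennreal r \<le> c1 \<mu> \<longleftrightarrow> opt.minimiser r = - \<alpha>"
proof (cases "SA.admissible (- \<alpha>)")
  case True
  note Z = left_end_in_Z[OF True]
  have "ennreal r \<le> c1 \<mu> \<longleftrightarrow> r * A2 (- \<alpha>) \<le> B2 (- \<alpha>)"
    using True opt.pos[OF Z] assms by (simp add: c1_eq ennreal_le_iff pos_le_divide_eq less_imp_le)
  then show ?thesis using minimiser_left_end_iff[OF assms Z] by simp
next
  case False
  then have "opt.minimiser r \<noteq> - \<alpha>" using opt.minimiser_in[OF assms] by (auto simp: Z_def)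
  then show ?thesis using False assms by (simp add: c1_eq)
qed

lemma c2_ge_iff:
  assumes "r > 0"
  shows "c2 \<mu> \<le> ennreal r \<longleftrightarrow> opt.minimiser r = \<beta>"
proof (cases "SB.admissible (- \<beta>)")
  case True
  note Z = right_end_in_Z[OF True]
  have "c2 \<mu> \<le> ennreal r \<longleftrightarrow> B2 \<beta> \<le> r * A2 \<beta>"
    using True opt.pos[OF Z] assms by (simp add: c2_eq ennreal_le_iff pos_divide_le_eq less_imp_le)
  then show ?thesis using minimiser_right_end_iff[OF assms Z] by simp
next
  case False
  then have "opt.minimiser r \<noteq> \<beta>" using opt.minimiser_in[OF assms] by (auto simp: Z_def)
  then show ?thesis using False assms by (simp add: c2_eq top_unique)
qed

text \<open>
  The critical slope is recovered from the minimiser, so distinct slopes between \<open>c1\<close> and \<open>c2\<close> have distinct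
  minimisers.
\<close>

lemma minimiser_between:
  assumes r: "r > 0" and c: "c1 \<mu> < ennreal r" "ennreal r < c2 \<mu>"
  shows "r = B2 (opt.minimiser r) / A2 (opt.minimiser r)"
proof -
  have z: "opt.minimiser r \<in> Z" using r by (rule opt.minimiser_in)
  have "- \<alpha> < opt.minimiser r" "opt.minimiser r < \<beta>"
  proof -
    have "opt.minimiser r \<noteq> - \<alpha>" using c(1) unfolding c1_le_iff[OF r, symmetric] not_le .
    moreover have "opt.minimiser r \<noteq> \<beta>" using c(2) unfolding c2_ge_iff[OF r, symmetric] not_le .
    ultimately show "- \<alpha> < opt.minimiser r" "opt.minimiser r < \<beta>" using Z_bounds[OF z] by linarith+
  qed
  from minimiser_interior[OF r this] show ?thesis
    using opt.pos(1)[OF z] by (simp add: eq_divide_eq)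
qed

lemma c1_less_c2: "c1 \<mu> < c2 \<mu>"
proof -
  obtain z where z: "- \<alpha> < z" "z < \<beta>" using exists_interior by blast
  note zZ = interior_in_Z[OF z]
  define r where "r = B2 z / A2 z"
  have r: "r > 0" using opt.pos[OF zZ] by (simp add: r_def)
  have "opt.minimiser r = z" unfolding r_def by (rule opt.minimiser_ratio[OF zZ])
  then have "opt.minimiser r \<noteq> - \<alpha>" "opt.minimiser r \<noteq> \<beta>" using z by auto
  then have "c1 \<mu> < ennreal r" "ennreal r < c2 \<mu>"
    unfolding c1_le_iff[OF r, symmetric] c2_ge_iff[OF r, symmetric] not_le .
  then show ?thesis by (rule less_trans)
qed

lemma g_eq_optimum: "s > 0 \<Longrightarrow> t > 0 \<Longrightarrow> g s t = ennreal (opt.optimum s t)"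
  by (simp add: g_eq_real_shape real_shape_eq_optimum)

lemma shape_below_c1:
  assumes st: "s > 0" "t > 0" and le: "ennreal (s / t) \<le> c1 \<mu>"
  shows "g s t = ennreal s * a_moment \<mu> (- \<alpha>) 1 + ennreal t * b_moment \<mu> \<alpha> 1"
proof -
  have r: "s / t > 0" using st by simp
  have z: "opt.minimiser (s / t) = - \<alpha>" using c1_le_iff[OF r] le by simp
  then have "- \<alpha> \<in> Z" using opt.minimiser_in[OF r] by simp
  then have good: "SA.admissible (- \<alpha>)" "SB.admissible \<alpha>" by (auto simp: Z_def)
  have "a_moment \<mu> (- \<alpha>) 1 = ennreal (A (- \<alpha>))" "b_moment \<mu> \<alpha> 1 = ennreal (B (- \<alpha>))"
    unfolding a_moment_eq b_moment_eq A_def B_def using good by (simp_all add: SA.emoment_eq_moment SB.emoment_eq_moment)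
  then show ?thesis
    using st A_pos_Z[OF \<open>- \<alpha> \<in> Z\<close>] B_pos_Z[OF \<open>- \<alpha> \<in> Z\<close>]
    by (simp add: g_eq_optimum opt.optimum_def z ennreal_mult)
qed

lemma shape_above_c2:
  assumes st: "s > 0" "t > 0" and le: "c2 \<mu> \<le> ennreal (s / t)"
  shows "g s t = ennreal s * a_moment \<mu> \<beta> 1 + ennreal t * b_moment \<mu> (- \<beta>) 1"
proof -
  have r: "s / t > 0" using st by simp
  have z: "opt.minimiser (s / t) = \<beta>" using c2_ge_iff[OF r] le by simp
  then have "\<beta> \<in> Z" using opt.minimiser_in[OF r] by simp
  then have good: "SA.admissible \<beta>" "SB.admissible (- \<beta>)" by (auto simp: Z_def)
  have "a_moment \<mu> \<beta> 1 = ennreal (A \<beta>)" "b_moment \<mu> (- \<beta>) 1 = ennreal (B \<beta>)"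
    unfolding a_moment_eq b_moment_eq A_def B_def using good by (simp_all add: SA.emoment_eq_moment SB.emoment_eq_moment)
  then show ?thesis
    using st A_pos_Z[OF \<open>\<beta> \<in> Z\<close>] B_pos_Z[OF \<open>\<beta> \<in> Z\<close>]
    by (simp add: g_eq_optimum opt.optimum_def z ennreal_mult)
qed

lemma shape_strictly_concave:
  assumes c: "0 < c" "c < 1" and st: "s1 > 0" "s2 > 0" "t1 > 0" "t2 > 0"
    and between: "c1 \<mu> < ennreal (s1 / t1)" "ennreal (s1 / t1) < c2 \<mu>"
      "c1 \<mu> < ennreal (s2 / t2)" "ennreal (s2 / t2) < c2 \<mu>"
    and dir: "\<And>k. (s1, t1) \<noteq> k *\<^sub>R (s2, t2)"
  shows "ennreal c * g s1 t1 + ennreal (1 - c) * g s2 t2 < g (c * s1 + (1 - c) * s2) (c * t1 + (1 - c) * t2)"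
proof -
  have r: "s1 / t1 > 0" "s2 / t2 > 0" using st by auto
  have "opt.minimiser (s1 / t1) \<noteq> opt.minimiser (s2 / t2)"
  proof
    assume "opt.minimiser (s1 / t1) = opt.minimiser (s2 / t2)"
    then have "s1 / t1 = s2 / t2"
      using minimiser_between[OF r(1) between(1,2)] minimiser_between[OF r(2) between(3,4)] by simp
    then have "(s1, t1) = (t1 / t2) *\<^sub>R (s2, t2)" using st by (simp add: field_simps)
    with dir show False by blast
  qed
  from opt.optimum_strictly_concave[OF c st(1,2,3,4) this]
  have lt: "c * opt.optimum s1 t1 + (1 - c) * opt.optimum s2 t2 < opt.optimum (c * s1 + (1 - c) * s2) (c * t1 + (1 - c) * t2)" .
  have nonneg: "opt.optimum s1 t1 \<ge> 0" "opt.optimum s2 t2 \<ge> 0"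
    using real_shape_nonneg[of s1 t1] real_shape_nonneg[of s2 t2] real_shape_eq_optimum st by auto
  have "c * s1 + (1 - c) * s2 > 0" "c * t1 + (1 - c) * t2 > 0" using c st by (auto intro!: add_pos_pos)
  then show ?thesis
    using lt nonneg c st
    by (simp add: g_eq_optimum ennreal_mult[symmetric] ennreal_plus[symmetric] ennreal_less_iff del: ennreal_plus)
qed

lemma shape_C1: "continuously_differentiable_on (\<lambda>(s, t). enn2real (g s t)) ({0<..} \<times> {0<..})"
proof -
  let ?Q = "{0<..} \<times> {0<..} :: (real \<times> real) set"
  obtain D where D: "\<And>x. x \<in> ?Q \<Longrightarrow> ((\<lambda>(s, t). opt.optimum s t) has_derivative blinfun_apply (D x)) (at x)"
    and cont: "continuous_on ?Q D"
    using opt.optimum_C1 unfolding continuously_differentiable_on_def by blast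
  have "open ?Q" by (intro open_Times) auto
  then have "((\<lambda>(s, t). enn2real (g s t)) has_derivative blinfun_apply (D x)) (at x)" if "x \<in> ?Q" for x
  proof (rule has_derivative_transform_within_open[OF D[OF that] _ that])
    fix y assume "y \<in> ?Q"
    then show "(case y of (s, t) \<Rightarrow> opt.optimum s t) = (case y of (s, t) \<Rightarrow> enn2real (g s t))"
      using real_shape_eq_optimum by (auto simp: real_shape_def)
  qed
  with cont show ?thesis unfolding continuously_differentiable_on_def by blast
qed

end

theorem mainTheorem5:
  fixes \<mu> :: "((nat \<Rightarrow> real) \<times> (nat \<Rightarrow> real)) measure"
    and g :: "real \<Rightarrow> real \<Rightarrow> ennreal"
  assumes model: "exponential_model \<mu>"
    and shape: "is_shape_function \<mu> g"
    and pos: "alpha_inf \<mu> + beta_inf \<mu> > 0"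
  shows "c1 \<mu> < c2 \<mu>
    \<and> (\<forall>s t. s > 0 \<and> t > 0 \<and> ennreal (s / t) \<le> c1 \<mu> \<longrightarrow>
          g s t = ennreal s * a_moment \<mu> (- alpha_inf \<mu>) 1 + ennreal t * b_moment \<mu> (alpha_inf \<mu>) 1)
    \<and> (\<forall>s t. s > 0 \<and> t > 0 \<and> c2 \<mu> \<le> ennreal (s / t) \<longrightarrow>
          g s t = ennreal s * a_moment \<mu> (beta_inf \<mu>) 1 + ennreal t * b_moment \<mu> (- beta_inf \<mu>) 1)
    \<and> (\<forall>c s1 s2 t1 t2. 0 < c \<and> c < 1 \<and> s1 > 0 \<and> s2 > 0 \<and> t1 > 0 \<and> t2 > 0
          \<and> c1 \<mu> < ennreal (s1 / t1) \<and> ennreal (s1 / t1) < c2 \<mu>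
          \<and> c1 \<mu> < ennreal (s2 / t2) \<and> ennreal (s2 / t2) < c2 \<mu>
          \<and> (\<forall>k::real. (s1, t1) \<noteq> k *\<^sub>R (s2, t2)) \<longrightarrow>
          g (c * s1 + (1 - c) * s2) (c * t1 + (1 - c) * t2)
            > ennreal c * g s1 t1 + ennreal (1 - c) * g s2 t2)
    \<and> (\<forall>s t. s > 0 \<and> t > 0 \<longrightarrow> g s t < \<infinity>)
    \<and> continuously_differentiable_on (\<lambda>(s, t). enn2real (g s t)) ({0<..} \<times> {0<..})"
proof -
  interpret corner_growth \<mu> g by unfold_locales (fact model shape pos)+
  show ?thesis
  proof (intro conjI)
    show "c1 \<mu> < c2 \<mu>" by (rule c1_less_c2)
    show "\<forall>s t. s > 0 \<and> t > 0 \<and> ennreal (s / t) \<le> c1 \<mu> \<longrightarrow>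
        g s t = ennreal s * a_moment \<mu> (- \<alpha>) 1 + ennreal t * b_moment \<mu> \<alpha> 1"
      by (intro allI impI, elim conjE, rule shape_below_c1)
    show "\<forall>s t. s > 0 \<and> t > 0 \<and> c2 \<mu> \<le> ennreal (s / t) \<longrightarrow>
        g s t = ennreal s * a_moment \<mu> \<beta> 1 + ennreal t * b_moment \<mu> (- \<beta>) 1"
      by (intro allI impI, elim conjE, rule shape_above_c2)
    show "\<forall>c s1 s2 t1 t2. 0 < c \<and> c < 1 \<and> s1 > 0 \<and> s2 > 0 \<and> t1 > 0 \<and> t2 > 0
          \<and> c1 \<mu> < ennreal (s1 / t1) \<and> ennreal (s1 / t1) < c2 \<mu>
          \<and> c1 \<mu> < ennreal (s2 / t2) \<and> ennreal (s2 / t2) < c2 \<mu>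
          \<and> (\<forall>k::real. (s1, t1) \<noteq> k *\<^sub>R (s2, t2)) \<longrightarrow>
          g (c * s1 + (1 - c) * s2) (c * t1 + (1 - c) * t2)
            > ennreal c * g s1 t1 + ennreal (1 - c) * g s2 t2"
      by (intro allI impI, elim conjE, rule shape_strictly_concave) auto
    show "\<forall>s t. s > 0 \<and> t > 0 \<longrightarrow> g s t < \<infinity>"
      by (simp add: g_eq_optimum)
    show "continuously_differentiable_on (\<lambda>(s, t). enn2real (g s t)) ({0<..} \<times> {0<..})"
      by (rule shape_C1)
  qed
qed

end
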